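(* Let $\lambda\in\{2,4\}$ and $r\in\mathbb{N}$. Then for $n\ge2$, $$\lambda_n\big(\boldsymbol{W}^r_{2,w}(\mathbb{R}^d),L_{2,w}(\mathbb{R}^d)\big)=d_n\big(\boldsymbol{W}^r_{2,w}(\mathbb{R}^d),L_{2,w}(\mathbb{R}^d)\big)\asymp n^{-r_\lambda}(\log n)^{r_\lambda(d-1)}.$$
   Context: Fix $d\in\mathbb{N}$, $a>0$, $b\in\mathbb{R}$. Let $w(x)=\exp(-a|x|^\lambda+b)$ for $x\in\mathbb{R}$, and $w(\boldsymbol{x})=\prod_{i=1}^dw(x_i)$ for $\boldsymbol{x}\in\mathbb{R}^d$. $L_{2,w}(\mathbb{R}^d)$ is the space of measurable $f$ on $\mathbb{R}^d$ with finite norm $\|f\|_{L_{2,w}(\mathbb{R}^d)}=\big(\int_{\mathbb{R}^d}|f(\boldsymbol{x})w(\boldsymbol{x})|^2\,d\boldsymbol{x}\big)^{1/2}$. The Sobolev space of mixed smoothness $W^r_{2,w}(\mathbb{R}^d)$ consists of all $f\in L_{2,w}(\mathbb{R}^d)$ whose weak derivatives $D^{\boldsymbol{k}}f$ belong to $L_{2,w}(\mathbb{R}^d)$ for all $\boldsymbol{k}\in\mathbb{N}_0^d$ with $|\boldsymbol{k}|_\infty=\max_jk_j\le r$, with norm $\|f\|_{W^r_{2,w}(\mathbb{R}^d)}=\big(\sum_{|\boldsymbol{k}|_\infty\le r}\|D^{\boldsymbol{k}}f\|^2_{L_{2,w}(\mathbb{R}^d)}\big)^{1/2}$; $\boldsymbol{W}^r_{2,w}(\mathbb{R}^d)$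 denotes its unit ball. $r_\lambda=(1-1/\lambda)r$. For a Banach space $X$ and $F\subset X$, the Kolmogorov $n$-width is $d_n(F,X)=\inf_{L_n}\sup_{f\in F}\inf_{g\in L_n}\|f-g\|_X$, the infimum being over all linear subspaces $L_n\subset X$ of dimension $\le n$; the linear $n$-width is $\lambda_n(F,X)=\inf_{A_n}\sup_{f\in F}\|f-A_n(f)\|_X$, the infimum being over all linear operators $A_n$ in $X$ with $\operatorname{rank}A_n\le n$. $A_n\asymp B_n$ means that there are constants $c,C>0$ independent of $n$ (they may depend on $\lambda,a,b,r,d$) with $cB_n\le A_n\le CB_n$ for all indicated $n$. *)

theory Defs
  imports "HOL-Analysis.Analysis"
begin

section \<open>Measurable functions modulo equality almost everywhere\<close>

text \<open>
  The elements of the \<open>L\<^sub>2\<close> and Sobolev spaces below are equivalence classes of measurable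
  functions. The choice of Borel representatives (rather than Lebesgue measurable ones) is
  immaterial, since every Lebesgue measurable function is almost everywhere equal to a Borel
  measurable one.
\<close>

definition ae_eq :: "('a::euclidean_space \<Rightarrow> real) \<Rightarrow> ('a \<Rightarrow> real) \<Rightarrow> bool" where
  "ae_eq f g \<longleftrightarrow> f \<in> borel_measurable lborel \<and> g \<in> borel_measurable lborel \<and>
     (AE x in lborel. f x = g x)"

lemma part_equivp_ae_eq: "part_equivp (ae_eq :: ('a::euclidean_space \<Rightarrow> real) \<Rightarrow> _)"
proof (rule part_equivpI)
  have "ae_eq (\<lambda>_::'a. 0) (\<lambda>_. 0)" by (simp add: ae_eq_def)
  then show "\<exists>f::'a \<Rightarrow> real. ae_eq f f" by blast
  show "symp (ae_eq :: ('a \<Rightarrow> real) \<Rightarrow> _)"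
    unfolding symp_def ae_eq_def by (simp add: eq_commute)
  show "transp (ae_eq :: ('a \<Rightarrow> real) \<Rightarrow> _)"
  proof (rule transpI)
    fix f g h :: "'a \<Rightarrow> real"
    assume fg: "ae_eq f g" and gh: "ae_eq g h"
    have "AE x in lborel. f x = g x" "AE x in lborel. g x = h x"
      using fg gh by (simp_all only: ae_eq_def)
    then have "AE x in lborel. f x = h x" by eventually_elim simp
    with fg gh show "ae_eq f h" by (simp only: ae_eq_def simp_thms)
  qed
qed

lemma ae_eq_sym: "ae_eq f g \<Longrightarrow> ae_eq g f"
  unfolding ae_eq_def by (simp add: eq_commute)

lemma ae_eq_lift2:
  assumes "ae_eq f f'" "ae_eq g g'" and [measurable]: "case_prod h \<in> borel_measurable borel"
  shows "ae_eq (\<lambda>x. h (f x) (g x)) (\<lambda>x. h (f' x) (g' x))"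
proof -
  have [measurable]: "f \<in> borel_measurable lborel" "f' \<in> borel_measurable lborel"
      "g \<in> borel_measurable lborel" "g' \<in> borel_measurable lborel"
    and ae: "AE x in lborel. f x = f' x" "AE x in lborel. g x = g' x"
    using assms(1,2) by (simp_all only: ae_eq_def)
  have "(\<lambda>x. case_prod h (f x, g x)) \<in> borel_measurable lborel"
    "(\<lambda>x. case_prod h (f' x, g' x)) \<in> borel_measurable lborel"
    by measurable
  moreover have "AE x in lborel. h (f x) (g x) = h (f' x) (g' x)"
    using ae by eventually_elim simp
  ultimately show ?thesis by (simp add: ae_eq_def)
qed

lemma ae_eq_lift1:
  assumes "ae_eq f f'" "h \<in> borel_measurable borel"
  shows "ae_eq (\<lambda>x. h (f x)) (\<lambda>x. h (f' x))"
  by (rule ae_eq_lift2 [OF assms(1) assms(1), where h = "\<lambda>u v. h u"])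
     (use assms(2) in \<open>simp add: case_prod_unfold borel_prod [symmetric]\<close>)

quotient_type (overloaded) 'a mfun = "'a::euclidean_space \<Rightarrow> real" / partial: ae_eq
  by (rule part_equivp_ae_eq)

instantiation mfun :: (euclidean_space) real_vector
begin

lift_definition zero_mfun :: "'a mfun" is "\<lambda>_. 0"
  by (simp add: ae_eq_def)

lift_definition plus_mfun :: "'a mfun \<Rightarrow> 'a mfun \<Rightarrow> 'a mfun" is "\<lambda>f g x. f x + g x"
  by (rule ae_eq_lift2, assumption, assumption) (simp add: case_prod_unfold borel_prod [symmetric])

lift_definition uminus_mfun :: "'a mfun \<Rightarrow> 'a mfun" is "\<lambda>f x. - f x"
  by (erule ae_eq_lift1) simp

lift_definition minus_mfun :: "'a mfun \<Rightarrow> 'a mfun \<Rightarrow> 'a mfun" is "\<lambda>f g x. f x - g x"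
  by (rule ae_eq_lift2, assumption, assumption) (simp add: case_prod_unfold borel_prod [symmetric])

lift_definition scaleR_mfun :: "real \<Rightarrow> 'a mfun \<Rightarrow> 'a mfun" is "\<lambda>c f x. c * f x"
  by (erule ae_eq_lift1) simp

instance
  by standard (transfer; auto simp: ae_eq_def algebra_simps)+

end

section \<open>The weighted space \<open>L\<^sub>2\<^sub>,\<^sub>w\<close>\<close>

definition weight1 :: "real \<Rightarrow> real \<Rightarrow> real \<Rightarrow> real \<Rightarrow> real" where
  "weight1 lam a b x = exp (- a * \<bar>x\<bar> powr lam + b)"

definition weight :: "real \<Rightarrow> real \<Rightarrow> real \<Rightarrow> real ^ 'd::finite \<Rightarrow> real" where
  "weight lam a b x = (\<Prod>i\<in>UNIV. weight1 lam a b (x $ i))"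

lemma borel_measurable_weight [measurable]:
  "weight lam a b \<in> borel_measurable borel"
  unfolding weight_def [abs_def] weight1_def [abs_def] by measurable

lemma ae_eq_weighted_sq:
  assumes "ae_eq f g"
  shows "(\<lambda>x. (f x * weight lam a b x)\<^sup>2) \<in> borel_measurable lborel"
    and "(\<lambda>x. (g x * weight lam a b x)\<^sup>2) \<in> borel_measurable lborel"
    and "AE x in lborel. (f x * weight lam a b x)\<^sup>2 = (g x * weight lam a b x)\<^sup>2"
proof -
  have [measurable]: "f \<in> borel_measurable lborel" "g \<in> borel_measurable lborel"
    and ae: "AE x in lborel. f x = g x"
    using assms by (simp_all only: ae_eq_def)
  show "(\<lambda>x. (f x * weight lam a b x)\<^sup>2) \<in> borel_measurable lborel"
    "(\<lambda>x. (g x * weight lam a b x)\<^sup>2) \<in> borel_measurable lborel"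
    by measurable
  show "AE x in lborel. (f x * weight lam a b x)\<^sup>2 = (g x * weight lam a b x)\<^sup>2"
    using ae by eventually_elim simp
qed

lift_definition in_L2w :: "real \<Rightarrow> real \<Rightarrow> real \<Rightarrow> (real ^ 'd::finite) mfun \<Rightarrow> bool"
  is "\<lambda>lam a b f. integrable lborel (\<lambda>x. (f x * weight lam a b x)\<^sup>2)"
  by (intro integrable_cong_AE ae_eq_weighted_sq)

definition L2w :: "real \<Rightarrow> real \<Rightarrow> real \<Rightarrow> (real ^ 'd::finite) mfun set" where
  "L2w lam a b = {f. in_L2w lam a b f}"

text \<open>Meaningful on \<open>L2w lam a b\<close> only: elsewhere the integral is 0 by convention.\<close>

lift_definition norm_L2w :: "real \<Rightarrow> real \<Rightarrow> real \<Rightarrow> (real ^ 'd::finite) mfun \<Rightarrow> real"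
  is "\<lambda>lam a b f. sqrt (integral\<^sup>L lborel (\<lambda>x. (f x * weight lam a b x)\<^sup>2))"
  by (intro arg_cong [where f = sqrt] integral_cong_AE ae_eq_weighted_sq)

section \<open>Test functions and weak derivatives\<close>

definition partial_deriv :: "'d \<Rightarrow> (real ^ 'd::finite \<Rightarrow> real) \<Rightarrow> real ^ 'd \<Rightarrow> real" where
  "partial_deriv j \<phi> x = frechet_derivative \<phi> (at x) (axis j 1)"

definition partials :: "'d list \<Rightarrow> (real ^ 'd::finite \<Rightarrow> real) \<Rightarrow> real ^ 'd \<Rightarrow> real" where
  "partials js \<phi> = foldr partial_deriv js \<phi>"

text \<open>
  A function is infinitely differentiable iff all its iterated partial derivatives are (Frechet)
  differentiable; for the empty list \<open>partials js \<phi>\<close> is \<open>\<phi>\<close> itself.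
\<close>

definition smooth :: "(real ^ 'd::finite \<Rightarrow> real) \<Rightarrow> bool" where
  "smooth \<phi> \<longleftrightarrow> (\<forall>js x. partials js \<phi> differentiable (at x))"

definition test_function :: "(real ^ 'd::finite \<Rightarrow> real) \<Rightarrow> bool" where
  "test_function \<phi> \<longleftrightarrow> smooth \<phi> \<and> compact (closure {x. \<phi> x \<noteq> 0})"

text \<open>
  The classical derivative \<open>D\<^sup>k \<phi>\<close> for a multi-index \<open>k\<close>. As the index type carries no order, the
  order of differentiation is chosen arbitrarily; by Schwarz's theorem it does not matter for
  smooth \<open>\<phi>\<close>.
\<close>

definition multi_deriv :: "('d \<Rightarrow> nat) \<Rightarrow> (real ^ 'd::finite \<Rightarrow> real) \<Rightarrow> real ^ 'd \<Rightarrow> real" where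
  "multi_deriv k \<phi> = partials (SOME js. \<forall>j. count_list js j = k j) \<phi>"

definition locally_integrable :: "('a::euclidean_space \<Rightarrow> real) \<Rightarrow> bool" where
  "locally_integrable f \<longleftrightarrow> (\<forall>K. compact K \<longrightarrow> set_integrable lborel K f)"

definition is_weak_deriv ::
  "('d \<Rightarrow> nat) \<Rightarrow> (real ^ 'd::finite \<Rightarrow> real) \<Rightarrow> (real ^ 'd \<Rightarrow> real) \<Rightarrow> bool" where
  "is_weak_deriv k f g \<longleftrightarrow> locally_integrable f \<and> locally_integrable g \<and>
     (\<forall>\<phi>. test_function \<phi> \<longrightarrow>
        integral\<^sup>L lborel (\<lambda>x. f x * multi_deriv k \<phi> x) =
        (- 1) ^ (\<Sum>j\<in>UNIV. k j) * integral\<^sup>L lborel (\<lambda>x. g x * \<phi> x))"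

lemma borel_measurable_partials:
  assumes "smooth \<phi>"
  shows "partials js \<phi> \<in> borel_measurable borel"
proof (rule borel_measurable_continuous_onI)
  show "continuous_on UNIV (partials js \<phi>)"
    using assms unfolding smooth_def
    by (intro differentiable_imp_continuous_on) (auto simp: differentiable_on_def)
qed

lemma locally_integrable_cong:
  fixes f g :: "'a::euclidean_space \<Rightarrow> real"
  assumes "ae_eq f g" "locally_integrable f"
  shows "locally_integrable g"
  unfolding locally_integrable_def
proof (intro allI impI)
  fix K :: "'a set" assume K: "compact K"
  then have [measurable]: "K \<in> sets borel" by (simp add: borel_compact)
  have [measurable]: "f \<in> borel_measurable lborel" "g \<in> borel_measurable lborel"
    and ae: "AE x in lborel. f x = g x"
    using assms(1) by (simp_all only: ae_eq_def)
  have "set_integrable lborel K f"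
    using assms(2) K by (auto simp: locally_integrable_def)
  moreover have "set_integrable lborel K f \<longleftrightarrow> set_integrable lborel K g"
    unfolding set_integrable_def
  proof (rule integrable_cong_AE)
    show "AE x in lborel. indicat_real K x *\<^sub>R f x = indicat_real K x *\<^sub>R g x"
      using ae by eventually_elim simp
  qed measurable
  ultimately show "set_integrable lborel K g" by simp
qed

lemma integral_times_cong:
  assumes "ae_eq f g" "h \<in> borel_measurable borel"
  shows "integral\<^sup>L lborel (\<lambda>x. f x * h x) = integral\<^sup>L lborel (\<lambda>x. g x * h x)"
proof (rule integral_cong_AE)
  have [measurable]: "f \<in> borel_measurable lborel" "g \<in> borel_measurable lborel"
      "h \<in> borel_measurable lborel" and ae: "AE x in lborel. f x = g x"
    using assms by (simp_all add: ae_eq_def)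
  show "(\<lambda>x. f x * h x) \<in> borel_measurable lborel" "(\<lambda>x. g x * h x) \<in> borel_measurable lborel"
    by measurable
  show "AE x in lborel. f x * h x = g x * h x"
    using ae by eventually_elim simp
qed

lemma is_weak_deriv_cong:
  assumes "ae_eq f f'" "ae_eq g g'" "is_weak_deriv k f g"
  shows "is_weak_deriv k f' g'"
proof -
  have "integral\<^sup>L lborel (\<lambda>x. f' x * multi_deriv k \<phi> x) =
        (- 1) ^ (\<Sum>j\<in>UNIV. k j) * integral\<^sup>L lborel (\<lambda>x. g' x * \<phi> x)"
    if \<phi>: "test_function \<phi>" for \<phi>
  proof -
    have "multi_deriv k \<phi> \<in> borel_measurable borel"
      using \<phi> by (simp add: test_function_def multi_deriv_def borel_measurable_partials)
    moreover have "\<phi> \<in> borel_measurable borel"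
      using \<phi> borel_measurable_partials [of \<phi> "[]"] by (simp add: test_function_def partials_def)
    ultimately have "integral\<^sup>L lborel (\<lambda>x. f' x * multi_deriv k \<phi> x) =
          integral\<^sup>L lborel (\<lambda>x. f x * multi_deriv k \<phi> x)"
        "integral\<^sup>L lborel (\<lambda>x. g' x * \<phi> x) = integral\<^sup>L lborel (\<lambda>x. g x * \<phi> x)"
      by (simp_all only: integral_times_cong [OF assms(1)] integral_times_cong [OF assms(2)])
    with assms(3) \<phi> show ?thesis by (simp only: is_weak_deriv_def)
  qed
  moreover have "locally_integrable f'" "locally_integrable g'"
    using assms(3) locally_integrable_cong [OF assms(1)] locally_integrable_cong [OF assms(2)]
    by (simp_all only: is_weak_deriv_def)
  ultimately show ?thesis
    by (simp add: is_weak_deriv_def)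
qed

lift_definition has_weak_deriv ::
  "('d \<Rightarrow> nat) \<Rightarrow> (real ^ 'd::finite) mfun \<Rightarrow> (real ^ 'd) mfun \<Rightarrow> bool"
  is is_weak_deriv
  by (rule iffI, erule (2) is_weak_deriv_cong)
    (erule (1) is_weak_deriv_cong [OF ae_eq_sym ae_eq_sym], assumption)

text \<open>The weak derivative is unique as an equivalence class, provided it exists.\<close>

definition weak_deriv :: "('d \<Rightarrow> nat) \<Rightarrow> (real ^ 'd::finite) mfun \<Rightarrow> (real ^ 'd) mfun" where
  "weak_deriv k f = (THE g. has_weak_deriv k f g)"

section \<open>The weighted Sobolev space of mixed smoothness\<close>

definition W2w :: "nat \<Rightarrow> real \<Rightarrow> real \<Rightarrow> real \<Rightarrow> (real ^ 'd::finite) mfun set" where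
  "W2w r lam a b = {f \<in> L2w lam a b.
     \<forall>k. (\<forall>j. k j \<le> r) \<longrightarrow> (\<exists>g \<in> L2w lam a b. has_weak_deriv k f g)}"

definition norm_W2w :: "nat \<Rightarrow> real \<Rightarrow> real \<Rightarrow> real \<Rightarrow> (real ^ 'd::finite) mfun \<Rightarrow> real" where
  "norm_W2w r lam a b f =
     sqrt (\<Sum>k | \<forall>j. k j \<le> r. (norm_L2w lam a b (weak_deriv k f))\<^sup>2)"

definition unit_ball_W2w :: "nat \<Rightarrow> real \<Rightarrow> real \<Rightarrow> real \<Rightarrow> (real ^ 'd::finite) mfun set" where
  "unit_ball_W2w r lam a b = {f \<in> W2w r lam a b. norm_W2w r lam a b f \<le> 1}"

section \<open>Widths\<close>

text \<open>
  The widths are taken in a normed space whose elements form a linear subspace \<open>X\<close> of an ambient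
  vector space, with norm \<open>N\<close> on \<open>X\<close>. They are extended reals, so that infima and suprema are
  the true ones. The library function \<open>dim\<close> is 0 on infinite-dimensional spaces, hence the bound
  on the dimension is expressed through a finite spanning set.
\<close>

definition dim_at_most :: "nat \<Rightarrow> 'v::real_vector set \<Rightarrow> bool" where
  "dim_at_most n L \<longleftrightarrow> (\<exists>B. finite B \<and> card B \<le> n \<and> span B = L)"

definition kolmogorov_width ::
  "'v::real_vector set \<Rightarrow> 'v set \<Rightarrow> ('v \<Rightarrow> real) \<Rightarrow> nat \<Rightarrow> ereal" where
  "kolmogorov_width F X N n =
     (INF L \<in> {L. subspace L \<and> L \<subseteq> X \<and> dim_at_most n L}.
        SUP f\<in>F. INF g\<in>L. ereal (N (f - g)))"

definition linear_operator_in :: "'v::real_vector set \<Rightarrow> ('v \<Rightarrow> 'v) \<Rightarrow> bool" where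
  "linear_operator_in X A \<longleftrightarrow> A ` X \<subseteq> X \<and>
     (\<forall>f\<in>X. \<forall>g\<in>X. A (f + g) = A f + A g) \<and> (\<forall>c. \<forall>f\<in>X. A (c *\<^sub>R f) = c *\<^sub>R A f)"

definition linear_width ::
  "'v::real_vector set \<Rightarrow> 'v set \<Rightarrow> ('v \<Rightarrow> real) \<Rightarrow> nat \<Rightarrow> ereal" where
  "linear_width F X N n =
     (INF A \<in> {A. linear_operator_in X A \<and> dim_at_most n (A ` X)}.
        SUP f\<in>F. ereal (N (f - A f)))"

end

theory Submission
  imports Defs "HOL-Probability.Probability"
begin

text \<open>
  Let \<open>W = w\<^sup>2\<close> in one variable, write \<open>W = exp (- V)\<close> with an even polynomial \<open>V\<close> of degree
  \<open>\<lambda>\<close>, and let \<open>p\<^sub>m\<close> be the orthonormal polynomials of \<open>W\<close>. Orthogonality and parity give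
  \<open>V' p\<^sub>m - p\<^sub>m' = \<alpha>\<^bsub>m+1\<^esub> p\<^bsub>m+1\<^esub> + \<beta>\<^bsub>m+3\<^esub> p\<^bsub>m+3\<^esub>\<close>, and the string equation of the recurrence
  coefficients (explicit for \<open>\<lambda> = 2\<close>, Freud's equation for \<open>\<lambda> = 4\<close>) yields
  \<open>\<alpha>\<^sub>m\<close> of order \<open>m\<close> to the power \<open>1 - 1/\<lambda>\<close> and \<open>0 \<le> \<beta>\<^sub>m \<le> q \<alpha>\<^sub>m\<close> with \<open>q < 1\<close>. So a weak
  derivative acts on the coefficients in the tensor product basis like an invertible perturbation of
  a weighted shift, and the Sobolev norm of \<open>f\<close> is equivalent to the \<open>\<ell>\<^sub>2\<close> norm of its coefficients
  with weights \<open>\<Prod>\<^sub>j (k\<^sub>j + 1)\<close> to the power \<open>r\<^sub>\<lambda>\<close>. The widths are thus governed by the number of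
  points in hyperbolic crosses \<open>\<Prod>\<^sub>j (k\<^sub>j + 1) \<le> T\<close>, which is of order \<open>T (log T)\<^bsup>d-1\<^esup>\<close>. Orthogonal
  projections show that linear and Kolmogorov widths agree.
\<close>

subsection \<open>Orthogonal polynomials for the weights\<close>

text \<open>The link between derivatives and coefficients is duality: a derivative of
  \<open>f\<close> paired with \<open>P k\<close> is \<open>f\<close> paired with the adjoint of
  \<open>P k\<close>, and the adjoint only raises an index, by 1 or 3. Coefficients of a derivative
  are thus read off from higher coefficients of \<open>f\<close>, and bounding \<open>f\<close> by
  its derivative means solving a recurrence from infinity downwards. This needs \<open>q < 1\<close>
  uniformly in the index and an a priori bound that excludes growing homogeneous solutions. Equal
  neighbouring recurrence coefficients in Freud's equation would give
  \<open>beta / alpha = 1/3\<close>; crude bounds on neighbours yield some bound below 1. The index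
  0 in a direction is invisible to the derivative in that direction, so the lower-order norm must be
  kept beside it. A second obstacle: weak derivatives are tested with compactly supported functions,
  whereas the coefficient relation involves \<open>P k\<close> times the weight. Smooth cut-offs
  with bounds independent of their radius bridge this. Infinite sums are taken in
  \<open>ennreal\<close>, so that inequalities can be stated before finiteness is known.\<close>

lemma power_le_exp_real:
  fixes y s :: real
  assumes "y \<ge> 0" "s > 0"
  shows "y ^ n \<le> fact n / s ^ n * exp (s * y)"
proof -
  have "(s * y) ^ n / fact n \<le> exp (s * y)"
  proof -
    have "(\<Sum>i\<in>{n}. (s * y) ^ i /\<^sub>R fact i) \<le> (\<Sum>i. (s * y) ^ i /\<^sub>R fact i)"
      using assms by (intro sum_le_suminf summable_exp_generic) auto
    then show ?thesis by (simp add: exp_def divide_inverse mult.commute)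
  qed
  then show ?thesis using assms by (simp add: field_simps power_mult_distrib)
qed

lemma poly_bound_1_plus_square:
  fixes p :: "real poly"
  shows "\<exists>C>0. \<exists>N. \<forall>x. \<bar>poly p x\<bar> \<le> C * (1 + x\<^sup>2) ^ N"
proof (induction p)
  case 0
  show ?case by (auto intro!: exI[of _ 1])
next
  case (pCons c p)
  then obtain C N where C: "C > 0" "\<And>x. \<bar>poly p x\<bar> \<le> C * (1 + x\<^sup>2) ^ N" by blast
  have "\<bar>poly (pCons c p) x\<bar> \<le> (\<bar>c\<bar> + C) * (1 + x\<^sup>2) ^ Suc N" for x
  proof -
    have x: "\<bar>x\<bar> \<le> 1 + x\<^sup>2"
      using zero_le_power2[of "\<bar>x\<bar> - 1"] by (simp add: power2_eq_square algebra_simps)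
    have 1: "1 \<le> (1 + x\<^sup>2) ^ Suc N" by (intro one_le_power) simp
    have "\<bar>poly (pCons c p) x\<bar> \<le> \<bar>c\<bar> + \<bar>x\<bar> * \<bar>poly p x\<bar>"
      by (simp add: abs_mult[symmetric] abs_triangle_ineq)
    also have "\<dots> \<le> \<bar>c\<bar> * (1 + x\<^sup>2) ^ Suc N + (1 + x\<^sup>2) * (C * (1 + x\<^sup>2) ^ N)"
      using C x 1 by (intro add_mono mult_mono) (auto simp: mult_le_cancel_left1 simp del: power_Suc)
    finally show ?thesis by (simp add: algebra_simps)
  qed
  moreover have "\<bar>c\<bar> + C > 0" using C by simp
  ultimately show ?case by blast
qed

lemma integrable_inverse_1_plus_sq: "integrable lborel (\<lambda>x::real. 1 / (1 + x\<^sup>2))"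
  using integrable_inverse_1_plus_square
  by (simp add: set_integrable_def einterval_def inverse_eq_divide)

lemma borel_measurable_poly [measurable]: "poly (p :: real poly) \<in> borel_measurable borel"
  by (intro borel_measurable_continuous_onI continuous_intros)

locale freud_weight =
  fixes e :: nat and a b :: real
  assumes e: "e \<in> {2, 4}" and a_pos: "a > 0"
begin

text \<open>Since \<open>e\<close> is even, the logarithm of the squared weight is a polynomial.
  Differentiating \<open>W = exp R\<close> stays within polynomials times \<open>W\<close>, and
  \<open>R\<close> can serve as exponent in the bump functions.\<close>

definition R :: "real poly" where
  "R = [:2 * b:] - monom (2 * a) e"

definition W :: "real \<Rightarrow> real" where
  "W x = exp (poly R x)"

definition V' :: "real poly" where
  "V' = - pderiv R"

lemma W_pos [simp]: "W x > 0" by (simp add: W_def)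

lemma even_e: "even e" using e by auto

lemma W_minus [simp]: "W (- x) = W x"
  using even_e by (simp add: W_def R_def poly_monom)

lemma W_measurable [measurable]: "W \<in> borel_measurable borel"
  unfolding W_def by measurable

lemma V'_eq: "V' = monom (2 * a * real e) (e - 1)"
  by (simp add: V'_def R_def pderiv_diff pderiv_monom pderiv_pCons)

lemma weight1_sq: "(weight1 (real e) a b x)\<^sup>2 = W x"
proof -
  have "\<bar>x\<bar> powr real e = x ^ e"
    using even_e e by (cases "x = 0") (auto simp: powr_realpow power_even_abs)
  then show ?thesis
    by (simp add: weight1_def W_def R_def poly_monom exp_double[symmetric] algebra_simps
        flip: exp_of_nat_mult)
qed

lemma sq_le_1_plus_power_e: "x\<^sup>2 \<le> 1 + x ^ e" for x :: real
proof -
  have "x\<^sup>2 \<le> 1 + (x\<^sup>2)\<^sup>2"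
    using zero_le_power2[of "x\<^sup>2 - 1"] zero_le_power2[of x]
    by (simp add: power2_eq_square algebra_simps del: zero_le_square)
  then show ?thesis using e by auto
qed

text \<open>The decay \<open>s * x ^ e\<close> is spent in two halves: one absorbs
  \<open>exp (t * |x|)\<close> through \<open>(s * |x| - t)^2 >= 0\<close> and
  \<open>x^2 <= 1 + x ^ e\<close>, the other absorbs the polynomial factor. The leftover constants
  \<open>s / 2\<close> and \<open>s\<close> make the \<open>3 * s / 2\<close> in
  \<open>K\<close>.\<close>

lemma weight_decay:
  fixes s t :: real
  assumes "s > 0"
  shows "\<exists>C>0. \<forall>x. exp (t * \<bar>x\<bar>) * (1 + x\<^sup>2) ^ N * exp (- s * x ^ e) \<le> C"
proof -
  define K where "K = fact N / (s/2) ^ N * exp (t\<^sup>2 / (2 * s) + 3 * s / 2)"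
  have "exp (t * \<bar>x\<bar>) * (1 + x\<^sup>2) ^ N * exp (- s * x ^ e) \<le> K" for x
  proof -
    have "0 \<le> (s * \<bar>x\<bar> - t)\<^sup>2 / (2 * s)" using assms by simp
    then have 1: "t * \<bar>x\<bar> \<le> t\<^sup>2 / (2 * s) + s / 2 * x\<^sup>2"
      using assms by (simp add: power2_eq_square field_simps)
    have 2: "s / 2 * x\<^sup>2 \<le> s / 2 * (1 + x ^ e)"
      using assms sq_le_1_plus_power_e[of x] by (intro mult_left_mono) auto
    have e0: "x ^ e \<ge> 0" using even_e by (simp add: zero_le_even_power)
    have "(1 + x\<^sup>2) ^ N \<le> (2 + x ^ e) ^ N"
      using sq_le_1_plus_power_e[of x] by (intro power_mono) auto
    also have "\<dots> \<le> fact N / (s/2) ^ N * exp (s / 2 * (2 + x ^ e))"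
      using e0 assms by (intro power_le_exp_real) auto
    finally have "exp (t * \<bar>x\<bar>) * (1 + x\<^sup>2) ^ N * exp (- s * x ^ e) \<le>
        exp (t\<^sup>2 / (2 * s) + s / 2 * (1 + x ^ e)) * (fact N / (s/2) ^ N * exp (s / 2 * (2 + x ^ e))) * exp (- s * x ^ e)"
    proof (intro mult_mono)
      have "t * \<bar>x\<bar> \<le> t\<^sup>2 / (2 * s) + s / 2 * (1 + x ^ e)" using 1 2 by linarith
      then show "exp (t * \<bar>x\<bar>) \<le> exp (t\<^sup>2 / (2 * s) + s / 2 * (1 + x ^ e))" by simp
    qed (use assms e0 in auto)
    also have "\<dots> = K"
      using assms by (simp add: K_def field_simps flip: exp_add)
    finally show ?thesis .
  qed
  moreover have "K > 0" using assms by (simp add: K_def)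
  ultimately show ?thesis by blast
qed

text \<open>One extra power of \<open>1 + x^2\<close> leaves the integrable majorant
  \<open>1 / (1 + x^2)\<close>. With \<open>t = 0\<close> this gives the moments of
  \<open>W\<close>; positive \<open>t\<close> provides the exponential moments on which completeness
  of the polynomials rests.\<close>

lemma integrable_exp_poly_W:
  fixes p :: "real poly"
  shows "integrable lborel (\<lambda>x. exp (t * \<bar>x\<bar>) * poly p x * W x)"
proof -
  obtain C N where C: "C > 0" "\<And>x. \<bar>poly p x\<bar> \<le> C * (1 + x\<^sup>2) ^ N"
    using poly_bound_1_plus_square by blast
  obtain K where K: "K > 0" "\<And>x. exp (t * \<bar>x\<bar>) * (1 + x\<^sup>2) ^ Suc N * exp (- (2*a) * x ^ e) \<le> K"
    using weight_decay[of "2*a" t "Suc N"] a_pos by auto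
  show ?thesis
  proof (rule Bochner_Integration.integrable_bound)
    show "integrable lborel (\<lambda>x. C * K * exp (2 * b) * (1 / (1 + x\<^sup>2)))"
      by (intro integrable_mult_right integrable_inverse_1_plus_sq)
    show "AE x in lborel. norm (exp (t * \<bar>x\<bar>) * poly p x * W x) \<le> norm (C * K * exp (2 * b) * (1 / (1 + x\<^sup>2)))"
    proof (intro always_eventually allI)
      fix x :: real
      have p: "1 + x\<^sup>2 > 0" by (simp add: add_pos_nonneg)
      have "norm (exp (t * \<bar>x\<bar>) * poly p x * W x) = exp (t * \<bar>x\<bar>) * \<bar>poly p x\<bar> * W x"
        by (simp add: abs_mult less_imp_le)
      also have "\<dots> \<le> exp (t * \<bar>x\<bar>) * (C * (1 + x\<^sup>2) ^ N) * W x"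
        using C by (intro mult_mono) (auto simp: less_imp_le)
      also have "\<dots> = C * exp (2*b) * (exp (t * \<bar>x\<bar>) * (1 + x\<^sup>2) ^ Suc N * exp (- (2*a) * x ^ e)) * (1 / (1 + x\<^sup>2))"
      proof -
        have W: "W x = exp (2*b) * exp (- (2*a) * x ^ e)"
          by (simp add: W_def R_def poly_monom flip: exp_add)
        define D where "D = 1 + x\<^sup>2"
        have "D \<noteq> 0" using p by (simp add: D_def)
        then show ?thesis unfolding W D_def[symmetric] by simp
      qed
      also have "\<dots> \<le> C * exp (2*b) * K * (1 / (1 + x\<^sup>2))"
        using K C p by (intro mult_right_mono mult_left_mono) auto
      also have "\<dots> = norm (C * K * exp (2 * b) * (1 / (1 + x\<^sup>2)))"
        using C K p by (simp add: abs_mult)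
      finally show "norm (exp (t * \<bar>x\<bar>) * poly p x * W x) \<le> norm (C * K * exp (2 * b) * (1 / (1 + x\<^sup>2)))" .
    qed
  qed measurable
qed

lemma integrable_poly_W: "integrable lborel (\<lambda>x. poly p x * W x)"
  using integrable_exp_poly_W[of 0 p] by simp

definition I :: "real poly \<Rightarrow> real" where
  "I p = (LBINT x. poly p x * W x)"

lemma I_add: "I (p + q) = I p + I q"
  by (simp add: I_def algebra_simps integrable_poly_W Bochner_Integration.integral_add)

lemma I_diff: "I (p - q) = I p - I q"
  by (simp add: I_def algebra_simps integrable_poly_W Bochner_Integration.integral_diff)

lemma I_smult: "I (smult c p) = c * I p"
  by (simp add: I_def mult.assoc)

lemma I_0 [simp]: "I 0 = 0" by (simp add: I_def)

lemma I_odd: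
  assumes "\<And>x. poly p (- x) = - poly p x"
  shows "I p = 0"
proof -
  have "I p = (LBINT x. poly p (0 + (-1) * x) * W (0 + (-1) * x))"
    unfolding I_def by (subst lborel_integral_real_affine[where c = "-1" and t = 0]) auto
  also have "\<dots> = - I p" by (simp add: assms I_def)
  finally show ?thesis by simp
qed

text \<open>A nonzero polynomial vanishes only on a finite, hence null, set. This definiteness is
  what makes the divisions by \<open>h n\<close> legitimate.\<close>

lemma I_sq_pos:
  assumes "p \<noteq> 0"
  shows "I (p * p) > 0"
proof -
  have "I (p * p) \<ge> 0"
    unfolding I_def by (intro integral_nonneg_AE) (auto simp: less_imp_le)
  moreover have "I (p * p) \<noteq> 0"
  proof
    assume "I (p * p) = 0"
    then have "AE x in lborel. poly (p*p) x * W x = 0"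
      unfolding I_def by (subst (asm) integral_nonneg_eq_0_iff_AE)
        (auto simp: less_imp_le intro!: integrable_poly_W[of "p*p", simplified])
    then have ae: "AE x in lborel. poly p x = 0"
      by eventually_elim (use W_pos in \<open>auto simp: less_le\<close>)
    have "finite {x. poly p x = 0}" using assms by (rule poly_roots_finite)
    then have "AE x in lborel. x \<notin> {x. poly p x = 0}"
      by (intro AE_not_in finite_imp_null_set_lborel)
    with ae have "AE x::real in lborel. False" by eventually_elim auto
    then show False
      by (simp add: eventually_False ae_filter_eq_bot_iff)
  qed
  ultimately show ?thesis by simp
qed

end

lemma degree_le_predI: "degree p \<le> Suc n \<Longrightarrow> coeff p (Suc n) = 0 \<Longrightarrow> degree p \<le> n"
  by (metis le_SucE leading_coeff_0_iff degree_0 le0)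

context freud_weight
begin

text \<open>As the weight is even, the recurrence of the monic orthogonal polynomials has no middle term.\<close>

fun monic_poly :: "nat \<Rightarrow> real poly" where
  "monic_poly 0 = 1"
| "monic_poly (Suc 0) = [:0, 1:]"
| "monic_poly (Suc (Suc n)) = [:0, 1:] * monic_poly (Suc n) - smult (I (monic_poly (Suc n) * monic_poly (Suc n)) / I (monic_poly n * monic_poly n)) (monic_poly n)"

definition h :: "nat \<Rightarrow> real" where "h n = I (monic_poly n * monic_poly n)"

text \<open>The value at 0 makes \<open>monic_poly_Suc\<close> hold for all \<open>n\<close>: at
  \<open>n = 0\<close> the truncated index \<open>n - 1\<close> would bring in
  \<open>monic_poly 0\<close>, and the coefficient 0 removes it. The same value is the initial
  condition in Freud's equation.\<close>

definition rec_coeff :: "nat \<Rightarrow> real" where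
  "rec_coeff n = (if n = 0 then 0 else h n / h (n - 1))"

lemma monic_poly_Suc: "monic_poly (Suc n) = [:0, 1:] * monic_poly n - smult (rec_coeff n) (monic_poly (n - 1))"
  by (cases n) (auto simp: rec_coeff_def h_def)

declare monic_poly.simps(3) [simp del]

lemma degree_lead_monic_poly: "degree (monic_poly n) = n \<and> coeff (monic_poly n) n = 1"
proof (induction n rule: less_induct)
  case (less n)
  show ?case
  proof (cases n)
    case (Suc m)
    have m: "degree (monic_poly m) = m" "coeff (monic_poly m) m = 1" using less[of m] Suc by auto
    have d: "degree (smult (rec_coeff m) (monic_poly (m - 1))) < Suc m"
      using less[of "m - 1"] Suc by (auto intro: le_less_trans[OF degree_smult_le])
    have "monic_poly m \<noteq> 0" using m(2) by auto
    then have d1: "degree ([:0, 1:] * monic_poly m) = Suc m" using m by (simp add: degree_mult_eq)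
    have "degree (monic_poly n) = Suc m"
      unfolding Suc monic_poly_Suc using d d1 by (metis degree_add_eq_left degree_minus diff_conv_add_uminus)
    moreover have "coeff (monic_poly n) n = 1"
      unfolding Suc monic_poly_Suc using m coeff_eq_0[OF d] by simp
    ultimately show ?thesis using Suc by simp
  qed simp
qed

lemma degree_monic_poly [simp]: "degree (monic_poly n) = n" and lead_monic_poly [simp]: "coeff (monic_poly n) n = 1"
  using degree_lead_monic_poly by auto

lemma monic_poly_nonzero [simp]: "monic_poly n \<noteq> 0"
  using lead_monic_poly[of n] by (metis coeff_0 zero_neq_one)

lemma h_pos [simp]: "h n > 0"
  unfolding h_def by (intro I_sq_pos) simp

lemma h_nonzero [simp]: "h n \<noteq> 0"
  using h_pos[of n] by linarith

lemma poly_monic_poly_minus: "poly (monic_poly n) (- x) = (- 1) ^ n * poly (monic_poly n) x"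
proof (induction n rule: less_induct)
  case (less n)
  show ?case
  proof (cases n)
    case (Suc m)
    show ?thesis
    proof (cases m)
      case (Suc l)
      with less[of m] less[of l] \<open>n = Suc m\<close> show ?thesis
        by (simp add: monic_poly_Suc[of "Suc l"] algebra_simps)
    qed (simp add: Suc)
  qed simp
qed

lemma I_monic_poly_parity:
  assumes "odd (m + n)"
  shows "I (monic_poly m * monic_poly n) = 0"
  using assms by (intro I_odd) (auto simp: poly_monic_poly_minus simp flip: power_add)

lemma rec_coeff_pos: "n > 0 \<Longrightarrow> rec_coeff n > 0"
  by (simp add: rec_coeff_def)

lemma rec_coeff_nonneg: "rec_coeff n \<ge> 0"
  by (simp add: rec_coeff_def less_imp_le)

lemma h_Suc: "h (Suc n) = rec_coeff (Suc n) * h n"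
  using h_pos[of n] by (simp add: rec_coeff_def)

lemma X_monic_poly: "[:0, 1:] * monic_poly n = monic_poly (Suc n) + smult (rec_coeff n) (monic_poly (n - 1))"
  by (simp add: monic_poly_Suc)

lemma I_mult_add: "I (p * (q + r)) = I (p * q) + I (p * r)"
  by (simp add: distrib_left I_add)

lemma I_mult_smult: "I (p * smult c q) = c * I (p * q)"
  by (simp add: I_smult)

lemma I_monic_poly_X: "I (monic_poly m * ([:0, 1:] * monic_poly n)) = I (monic_poly m * monic_poly (Suc n)) + rec_coeff n * I (monic_poly m * monic_poly (n - 1))"
  by (simp only: X_monic_poly I_mult_add I_mult_smult)

text \<open>The polynomials are defined by recurrence and not by Gram-Schmidt, so orthogonality is
  an induction in which \<open>X\<close> is moved from one factor to the other. Parity settles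
  \<open>m = n - 1\<close>; for \<open>m = n - 2\<close> the two remaining terms cancel because
  \<open>rec_coeff\<close> is a quotient of consecutive \<open>h\<close>; for smaller
  \<open>m\<close> both vanish.\<close>

lemma I_monic_poly_less: "m < n \<Longrightarrow> I (monic_poly n * monic_poly m) = 0"
proof (induction n arbitrary: m rule: less_induct)
  case (less n)
  then obtain k where n: "n = Suc k" by (cases n) auto
  show ?case
  proof (cases "m = k")
    case True
    then show ?thesis using n by (intro I_monic_poly_parity) auto
  next
    case False
    then have mk: "m < k" using less n by auto
    have IH: "I (monic_poly j * monic_poly i) = 0" if "j < n" "i < j" for i j using less.IH that by blast
    have "I (monic_poly m * monic_poly (Suc k)) = I (monic_poly m * ([:0,1:] * monic_poly k)) - rec_coeff k * I (monic_poly m * monic_poly (k - 1))"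
      using I_monic_poly_X[of m k] by simp
    also have "I (monic_poly m * ([:0,1:] * monic_poly k)) = I (monic_poly k * ([:0,1:] * monic_poly m))"
      by (simp only: mult_ac)
    also have "\<dots> = I (monic_poly k * monic_poly (Suc m)) + rec_coeff m * I (monic_poly k * monic_poly (m - 1))"
      by (rule I_monic_poly_X)
    also have "I (monic_poly k * monic_poly (m - 1)) = 0" using mk n by (intro IH) auto
    also have "I (monic_poly k * monic_poly (Suc m)) = rec_coeff k * I (monic_poly m * monic_poly (k - 1))"
    proof (cases "Suc m = k")
      case True
      then show ?thesis using h_Suc[of m] by (auto simp: h_def)
    next
      case False
      then have "I (monic_poly k * monic_poly (Suc m)) = 0" "I (monic_poly (k - 1) * monic_poly m) = 0"
        using mk n by (auto intro!: IH)
      then show ?thesis by (simp add: mult.commute)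
    qed
    finally show ?thesis by (simp add: n mult.commute)
  qed
qed

lemma I_monic_poly: "I (monic_poly m * monic_poly n) = (if m = n then h n else 0)"
  using I_monic_poly_less[of m n] I_monic_poly_less[of n m] by (cases m n rule: linorder_cases) (auto simp: h_def mult.commute)

lemma I_ortho_imp_0:
  assumes "degree p \<le> n" "\<And>m. m \<le> n \<Longrightarrow> I (p * monic_poly m) = 0"
  shows "p = 0"
  using assms
proof (induction n arbitrary: p)
  case 0
  then obtain c where "p = [:c:]" by (metis degree_eq_zeroE le_zero_eq)
  moreover from this have "p * p = smult c (p * monic_poly 0)" by simp
  ultimately have "I (p * p) = 0" using 0(2)[of 0] by (simp add: I_smult del: monic_poly.simps)
  then show ?case using I_sq_pos[of p] by auto
next
  case (Suc n)
  define c where "c = coeff p (Suc n)"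
  define r where "r = p - smult c (monic_poly (Suc n))"
  have "degree r \<le> Suc n" using Suc(2) unfolding r_def
    by (intro degree_diff_le) (auto intro: order.trans[OF degree_smult_le])
  moreover have "coeff r (Suc n) = 0" by (simp add: r_def c_def)
  ultimately have dr: "degree r \<le> n" by (rule degree_le_predI)
  have "I (r * monic_poly m) = 0" if "m \<le> n" for m
    using Suc(3)[of m] that by (simp add: r_def left_diff_distrib I_diff I_smult I_monic_poly)
  then have "r = 0" using dr Suc.IH by blast
  then have "p = smult c (monic_poly (Suc n))" by (simp add: r_def)
  then have "I (p * p) = 0" using Suc(3)[of "Suc n"] by (simp add: I_smult I_mult_smult)
  then show ?case using I_sq_pos[of p] by auto
qed

lemma I_monic_poly_low_degree:
  assumes "degree p < n"
  shows "I (p * monic_poly n) = 0"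
  using assms
proof (induction "degree p" arbitrary: p rule: less_induct)
  case less
  define c r where "c = lead_coeff p" and "r = p - smult c (monic_poly (degree p))"
  have "I (r * monic_poly n) = 0"
  proof (cases "r = 0")
    case False
    have "degree r \<le> degree p" unfolding r_def
      by (intro degree_diff_le) (auto intro: order.trans[OF degree_smult_le])
    moreover have "coeff r (degree p) = 0" by (simp add: r_def c_def)
    ultimately have "degree r < degree p" using False
      by (metis leading_coeff_0_iff order_le_imp_less_or_eq)
    then show ?thesis using less by auto
  qed simp
  moreover have "I (p * monic_poly n) = I (r * monic_poly n) + c * I (monic_poly (degree p) * monic_poly n)"
    by (simp add: r_def left_diff_distrib I_diff I_smult)
  ultimately show ?case using less by (simp add: I_monic_poly)
qed

lemma poly_W_bounded: "\<exists>C>0. \<forall>x. \<bar>poly p x * W x\<bar> \<le> C * (1 / (1 + x\<^sup>2))"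
proof -
  obtain C N where C: "C > 0" "\<And>x. \<bar>poly p x\<bar> \<le> C * (1 + x\<^sup>2) ^ N"
    using poly_bound_1_plus_square by blast
  obtain K where K: "K > 0" "\<And>x. exp (0 * \<bar>x\<bar>) * (1 + x\<^sup>2) ^ Suc N * exp (- (2*a) * x ^ e) \<le> K"
    using weight_decay[of "2*a" 0 "Suc N"] a_pos by auto
  have "\<bar>poly p x * W x\<bar> \<le> (C * exp (2*b) * K) * (1 / (1 + x\<^sup>2))" for x
  proof -
    define D where "D = 1 + x\<^sup>2"
    have D: "D > 0" by (simp add: D_def add_pos_nonneg)
    have W: "W x = exp (2*b) * exp (- (2*a) * x ^ e)"
      by (simp add: W_def R_def poly_monom flip: exp_add)
    have "D ^ Suc N * exp (- (2*a) * x ^ e) \<le> K" using K(2)[of x] by (simp add: D_def)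
    then have "D ^ N * exp (- (2*a) * x ^ e) \<le> K * (1 / D)" using D by (simp add: field_simps)
    then have "(C * exp (2*b)) * (D ^ N * exp (- (2*a) * x ^ e)) \<le> (C * exp (2*b)) * (K * (1 / D))"
      using C by (intro mult_left_mono) auto
    moreover have "\<bar>poly p x * W x\<bar> \<le> (C * D ^ N) * W x"
      using C(2)[of x] by (auto simp: abs_mult D_def less_imp_le intro!: mult_right_mono)
    ultimately show ?thesis by (simp add: W D_def mult_ac)
  qed
  moreover have "C * exp (2*b) * K > 0" using C K by simp
  ultimately show ?thesis by blast
qed

lemma poly_W_tendsto_0:
  assumes "F \<le> at_infinity"
  shows "((\<lambda>x. poly p x * W x) \<longlongrightarrow> 0) F"
proof -
  obtain C where C: "\<And>x. \<bar>poly p x * W x\<bar> \<le> C * (1 / (1 + x\<^sup>2))" using poly_W_bounded by blast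
  have "((\<lambda>x::real. C * (1 / (1 + x\<^sup>2))) \<longlongrightarrow> 0) at_infinity"
    unfolding at_infinity_eq_at_top_bot
    by (intro filterlim_sup) real_asymp+
  then have "((\<lambda>x. C * (1 / (1 + x\<^sup>2))) \<longlongrightarrow> 0) F" using assms by (rule tendsto_mono[rotated])
  then show ?thesis by (rule Lim_null_comparison[rotated]) (use C in auto)
qed

section \<open>Integration by parts, the adjoint of the derivative and the string equations\<close>

lemma W_has_field_derivative: "(W has_real_derivative - poly V' x * W x) (at x)"
  unfolding W_def V'_def by (auto intro!: derivative_eq_intros)

text \<open>The integrand is minus the derivative of \<open>p * W\<close>, which vanishes at both
  infinities.\<close>

lemma I_by_parts: "I (p * V' - pderiv p) = 0"
proof -
  let ?F = "\<lambda>x. poly p x * W x"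
  let ?f = "\<lambda>x. poly (pderiv p - p * V') x * W x"
  have "(LBINT x=-\<infinity>..\<infinity>. ?f x) = 0 - 0"
  proof (rule interval_integral_FTC_integrable)
    show "(?F has_vector_derivative ?f x) (at x)" for x
      unfolding has_real_derivative_iff_has_vector_derivative[symmetric]
      by (auto intro!: derivative_eq_intros W_has_field_derivative simp: algebra_simps)
    show "isCont ?f x" for x unfolding W_def by (intro continuous_intros)
    show "set_integrable lborel (einterval (-\<infinity>) \<infinity>) ?f"
      using integrable_poly_W[of "pderiv p - p * V'"] by (simp add: set_integrable_def einterval_def)
    show "((?F \<circ> real_of_ereal) \<longlongrightarrow> 0) (at_right (-\<infinity>))" "((?F \<circ> real_of_ereal) \<longlongrightarrow> 0) (at_left \<infinity>)"
      unfolding ereal_tendsto_simps by (rule poly_W_tendsto_0, simp add: at_infinity_eq_at_top_bot)+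
  qed simp
  then have "I (pderiv p - p * V') = 0"
    by (simp add: I_def interval_lebesgue_integral_def einterval_def set_lebesgue_integral_def)
  then show ?thesis by (simp add: I_diff)
qed

lemma V'_2: "e = 2 \<Longrightarrow> V' = monom (4 * a) 1"
  unfolding V'_eq by simp

lemma V'_4: "e = 4 \<Longrightarrow> V' = monom (8 * a) 3"
  unfolding V'_eq by simp

text \<open>The formal adjoint of the derivative with respect to the weight \<open>W\<close>.\<close>

definition adj_deriv :: "real poly \<Rightarrow> real poly" where
  "adj_deriv p = p * V' - pderiv p"

lemma I_adj_deriv: "I (adj_deriv p * q) = I (p * pderiv q)"
  using I_by_parts[of "p * q"] by (simp add: adj_deriv_def pderiv_mult algebra_simps I_add I_diff)

text \<open>Coefficients of \<open>adj_deriv (monic_poly n)\<close> at \<open>n + 1\<close> (the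
  argument is this target index) and at \<open>n + 3\<close>. The first is read off by adjointness,
  the second is the leading coefficient of \<open>V'\<close> when that has degree 3.\<close>

definition step1_coeff :: "nat \<Rightarrow> real" where "step1_coeff n = real n * h (n - 1) / h n"
definition step3_coeff :: "real" where "step3_coeff = (if e = 4 then 8 * a else 0)"

lemma I_monic_poly_pderiv_Suc: "I (monic_poly n * pderiv (monic_poly (Suc n))) = real (Suc n) * h n"
proof -
  define r where "r = pderiv (monic_poly (Suc n)) - smult (real (Suc n)) (monic_poly n)"
  have "degree r \<le> n" unfolding r_def
    by (intro degree_diff_le) (auto intro: order.trans[OF degree_smult_le] simp: degree_pderiv)
  moreover have "coeff r n = 0" by (simp add: r_def coeff_pderiv)
  ultimately have "r = 0 \<or> degree r < n" by (metis leading_coeff_0_iff order_le_imp_less_or_eq)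
  then have "I (r * monic_poly n) = 0" using I_monic_poly_low_degree by auto
  then show ?thesis
    by (simp add: r_def left_diff_distrib I_diff I_smult I_monic_poly mult.commute[of "monic_poly n" "pderiv _"])
qed

lemma poly_pderiv_monic_poly_minus: "poly (pderiv (monic_poly n)) (- x) = - ((- 1) ^ n * poly (pderiv (monic_poly n)) x)"
proof -
  have "(poly (monic_poly n) has_real_derivative poly (pderiv (monic_poly n)) (- x)) (at (- x))" by (rule poly_DERIV)
  then have "((\<lambda>x. poly (monic_poly n) (- x)) has_real_derivative - poly (pderiv (monic_poly n)) (- x)) (at x)"
    using DERIV_mirror by blast
  then have "((\<lambda>x. (- 1) ^ n * poly (monic_poly n) x) has_real_derivative - poly (pderiv (monic_poly n)) (- x)) (at x)"
    by (simp add: poly_monic_poly_minus)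
  moreover have "((\<lambda>x. (- 1) ^ n * poly (monic_poly n) x) has_real_derivative (- 1) ^ n * poly (pderiv (monic_poly n)) x) (at x)"
    by (intro DERIV_cmult poly_DERIV)
  ultimately have "- poly (pderiv (monic_poly n)) (- x) = (- 1) ^ n * poly (pderiv (monic_poly n)) x" by (rule DERIV_unique)
  then show ?thesis by simp
qed

text \<open>Adjointness kills the components at indices \<open>m\<close> up to \<open>n\<close>, as
  the derivative of \<open>monic_poly m\<close> is zero or has degree below \<open>n\<close>; parity
  kills \<open>n + 2\<close>, and multiplication by \<open>V'\<close> raises the degree by at most
  3. Only \<open>n + 1\<close> and \<open>n + 3\<close> remain.\<close>

lemma adj_deriv_monic_poly: "adj_deriv (monic_poly n) = smult (step1_coeff (Suc n)) (monic_poly (Suc n)) + smult step3_coeff (monic_poly (n + 3))"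
proof -
  define d where "d = adj_deriv (monic_poly n)"
  have dp: "degree (pderiv (monic_poly n)) \<le> n" by (simp add: degree_pderiv)
  have odd: "I (d * monic_poly (n + 2)) = 0"
    unfolding d_def I_adj_deriv by (intro I_odd) (simp add: poly_monic_poly_minus poly_pderiv_monic_poly_minus)
  have low: "I (d * monic_poly m) = 0" if "m \<le> n" for m
  proof -
    have "degree (pderiv (monic_poly m)) < n \<or> pderiv (monic_poly m) = 0"
      using that by (cases m) (auto simp: degree_pderiv pderiv_eq_0_iff)
    then have "I (pderiv (monic_poly m) * monic_poly n) = 0" using I_monic_poly_low_degree by auto
    then show ?thesis by (simp only: d_def I_adj_deriv mult.commute[of "monic_poly n" "pderiv (monic_poly m)"])
  qed
  have one: "I (d * monic_poly (Suc n)) = step1_coeff (Suc n) * h (Suc n)"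
    using h_pos[of "Suc n"] by (simp add: d_def I_adj_deriv I_monic_poly_pderiv_Suc step1_coeff_def)
  have deg: "degree d \<le> n + 3" and co: "coeff d (n + 3) = step3_coeff"
  proof -
    have "degree V' \<le> 3" using e degree_monom_le[of "2 * a * real e" "e - 1"] by (auto simp: V'_eq)
    then have 1: "degree (monic_poly n * V') \<le> n + 3"
      by (intro order.trans[OF degree_mult_le]) simp
    show "degree d \<le> n + 3" unfolding d_def adj_deriv_def using dp 1 by (intro degree_diff_le) auto
    have "coeff (pderiv (monic_poly n)) (n + 3) = 0" using dp by (intro coeff_eq_0) simp
    moreover have "coeff (V' * monic_poly n) (n + 3) = step3_coeff"
    proof (cases "e = 4")
      case True
      have "coeff (monom (8 * a) 3 * monic_poly n) (n + 3) = 8 * a" by (simp add: coeff_monom_mult)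
      moreover have "step3_coeff = 8 * a" unfolding step3_coeff_def by (simp add: True)
      ultimately show ?thesis unfolding V'_4[OF True] by (simp only:)
    next
      case False
      then have e2: "e = 2" using e by auto
      have "coeff (monom (4 * a) 1 * monic_poly n) (n + 3) = 0" by (simp add: coeff_monom_mult coeff_eq_0)
      moreover have "step3_coeff = 0" using False by (simp add: step3_coeff_def)
      ultimately show ?thesis unfolding V'_2[OF e2] by (simp only:)
    qed
    ultimately show "coeff d (n + 3) = step3_coeff" by (simp only: d_def adj_deriv_def mult.commute[of "monic_poly n" V'] coeff_diff diff_zero)
  qed
  \<comment> \<open>The coefficients at \<open>n + 3\<close> cancel, so \<open>r\<close> has degree
    at most \<open>n + 2\<close> and orthogonality need only be tested up to that index.\<close>
  define r where "r = d - (smult (step1_coeff (Suc n)) (monic_poly (Suc n)) + smult step3_coeff (monic_poly (n + 3)))"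
  have "r = 0"
  proof (rule I_ortho_imp_0)
    have "degree r \<le> n + 3" unfolding r_def using deg
      by (intro degree_diff_le degree_add_le) (auto intro: order.trans[OF degree_smult_le])
    moreover have "coeff r (n + 3) = 0" by (simp add: r_def co coeff_eq_0)
    ultimately show "degree r \<le> n + 2" using degree_le_predI[of r "n + 2"] by (simp add: eval_nat_numeral)
    fix m assume "m \<le> n + 2"
    then consider "m \<le> n" | "m = Suc n" | "m = n + 2" by linarith
    moreover have "I (r * monic_poly m) = I (d * monic_poly m) -
        (step1_coeff (Suc n) * (if Suc n = m then h m else 0) + step3_coeff * (if n + 3 = m then h m else 0))"
      unfolding r_def left_diff_distrib distrib_right I_diff I_add mult_smult_left I_smult I_monic_poly by (rule refl)
    ultimately show "I (r * monic_poly m) = 0"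
      by cases (simp_all only: low one odd, simp_all)
  qed
  then show ?thesis by (simp add: r_def d_def)
qed

text \<open>The inner product of \<open>adj_deriv (monic_poly n)\<close> with
  \<open>monic_poly (Suc n)\<close> is computed twice: by adjointness, and by multiplying with
  \<open>V'\<close> through the three-term recurrence.\<close>

lemma rec_coeff_2: "e = 2 \<Longrightarrow> 4 * a * rec_coeff (Suc n) = real (Suc n)"
proof -
  assume "e = 2"
  have V: "V' = smult (4 * a) [:0, 1:]"
    unfolding V'_2[OF \<open>e = 2\<close>] by (simp add: monom_altdef)
  have "adj_deriv (monic_poly n) * monic_poly (Suc n) = smult (4 * a) (([:0, 1:] * monic_poly n) * monic_poly (Suc n)) - pderiv (monic_poly n) * monic_poly (Suc n)"
    by (simp add: adj_deriv_def V algebra_simps)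
  then have "I (adj_deriv (monic_poly n) * monic_poly (Suc n)) = 4 * a * I (monic_poly (Suc n) * ([:0, 1:] * monic_poly n)) - I (pderiv (monic_poly n) * monic_poly (Suc n))"
    by (simp only: I_diff I_smult mult_ac)
  moreover have "I (pderiv (monic_poly n) * monic_poly (Suc n)) = 0"
    by (intro I_monic_poly_low_degree) (simp add: degree_pderiv)
  moreover have "I (adj_deriv (monic_poly n) * monic_poly (Suc n)) = real (Suc n) * h n"
    by (simp add: I_adj_deriv I_monic_poly_pderiv_Suc)
  moreover have "I (monic_poly (Suc n) * ([:0, 1:] * monic_poly n)) = h (Suc n)"
    by (simp only: I_monic_poly_X I_monic_poly) auto
  ultimately have "real (Suc n) * h n = 4 * a * rec_coeff (Suc n) * h n"
    by (simp add: h_Suc)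
  then show ?thesis by simp
qed

text \<open>Freud's equation for the recurrence coefficients.\<close>

lemma rec_coeff_4: "e = 4 \<Longrightarrow> 8 * a * rec_coeff (Suc n) * (rec_coeff (n + 2) + rec_coeff (Suc n) + rec_coeff n) = real (Suc n)"
proof -
  assume "e = 4"
  let ?X = "[:0, 1::real:]"
  have V: "V' = smult (8 * a) (?X * (?X * ?X))"
    unfolding V'_4[OF \<open>e = 4\<close>] by (simp add: monom_altdef power3_eq_cube)
  have "adj_deriv (monic_poly n) * monic_poly (Suc n) = smult (8 * a) ((?X * (?X * monic_poly n)) * (?X * monic_poly (Suc n))) - pderiv (monic_poly n) * monic_poly (Suc n)"
    by (simp add: adj_deriv_def V left_diff_distrib right_diff_distrib mult_ac)
  then have "I (adj_deriv (monic_poly n) * monic_poly (Suc n)) = 8 * a * I ((?X * (?X * monic_poly n)) * (?X * monic_poly (Suc n))) - I (pderiv (monic_poly n) * monic_poly (Suc n))"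
    by (simp only: I_diff I_smult)
  moreover have "I (pderiv (monic_poly n) * monic_poly (Suc n)) = 0"
    by (intro I_monic_poly_low_degree) (simp add: degree_pderiv)
  moreover have "I (adj_deriv (monic_poly n) * monic_poly (Suc n)) = real (Suc n) * h n"
    by (simp add: I_adj_deriv I_monic_poly_pderiv_Suc)
  moreover have "I ((?X * (?X * monic_poly n)) * (?X * monic_poly (Suc n))) = h (Suc n) * (rec_coeff (n + 2) + rec_coeff (Suc n) + rec_coeff n)"
  proof -
    have "?X * (?X * monic_poly n) = ?X * monic_poly (Suc n) + smult (rec_coeff n) (?X * monic_poly (n - 1))"
      by (simp only: X_monic_poly[of n] distrib_left mult_smult_right)
    also have "smult (rec_coeff n) (?X * monic_poly (n - 1)) = smult (rec_coeff n) (monic_poly n + smult (rec_coeff (n - 1)) (monic_poly (n - 2)))"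
      by (cases n) (auto simp: X_monic_poly rec_coeff_def[of 0] simp del: mult_pCons_left)
    finally have 1: "?X * (?X * monic_poly n) = monic_poly (n + 2) + smult (rec_coeff (Suc n) + rec_coeff n) (monic_poly n) + smult (rec_coeff n * rec_coeff (n - 1)) (monic_poly (n - 2))"
      by (simp add: X_monic_poly smult_add_left smult_add_right algebra_simps del: mult_pCons_left)
    have 2: "?X * monic_poly (Suc n) = monic_poly (n + 2) + smult (rec_coeff (Suc n)) (monic_poly n)" by (simp add: X_monic_poly del: mult_pCons_left)
    have expand: "I ((p + smult c q + smult d r) * (p + smult f q)) =
        I (p * p) + f * I (p * q) + c * I (q * p) + c * f * I (q * q) + d * I (r * p) + d * f * I (r * q)"
      for p q r c d f
      by (simp add: distrib_left distrib_right I_add I_smult)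
    \<comment> \<open>Truncated subtraction: for \<open>n = 0\<close> the two indices coincide and
      the inner product does not vanish, but then \<open>rec_coeff 0 = 0\<close>. For
      \<open>n = 1\<close> they are 0 and 1, which is harmless.\<close>
    have 3: "rec_coeff n * I (monic_poly (n - 2) * monic_poly n) = 0"
      by (cases "n = 0") (auto simp: I_monic_poly rec_coeff_def)
    have "I ((?X * (?X * monic_poly n)) * (?X * monic_poly (Suc n))) = h (n + 2) + (rec_coeff (Suc n) + rec_coeff n) * rec_coeff (Suc n) * h n
        + rec_coeff (n - 1) * rec_coeff (Suc n) * (rec_coeff n * I (monic_poly (n - 2) * monic_poly n))"
      unfolding 1 2 expand by (simp add: I_monic_poly)
    also have "\<dots> = h (n + 2) + (rec_coeff (Suc n) + rec_coeff n) * rec_coeff (Suc n) * h n"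
      unfolding 3 by simp
    also have "\<dots> = h (Suc n) * (rec_coeff (n + 2) + rec_coeff (Suc n) + rec_coeff n)"
      by (simp add: h_Suc algebra_simps)
    finally show ?thesis .
  qed
  ultimately have "real (Suc n) * h n = 8 * a * rec_coeff (Suc n) * (rec_coeff (n + 2) + rec_coeff (Suc n) + rec_coeff n) * h n"
    by (simp add: h_Suc mult_ac)
  then show ?thesis by simp
qed

definition sigma :: real where "sigma = 1 - 1 / real e"

text \<open>\<open>alpha\<close> and \<open>beta\<close> are the coefficients of \<open>p \<mapsto> V' p - p'\<close> in the
  normalized basis, see \<open>adj_deriv_orth_poly\<close>.\<close>

definition orth_poly :: "nat \<Rightarrow> real poly" where "orth_poly n = smult (1 / sqrt (h n)) (monic_poly n)"

definition alpha :: "nat \<Rightarrow> real" where "alpha n = step1_coeff n * sqrt (h n / h (n - 1))"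

definition beta :: "nat \<Rightarrow> real" where "beta n = step3_coeff * sqrt (h n / h (n - 3))"

lemma I_orth_poly: "I (orth_poly m * orth_poly n) = (if m = n then 1 else 0)"
proof -
  have "I (orth_poly m * orth_poly n) = 1 / sqrt (h m) * (1 / sqrt (h n)) * I (monic_poly m * monic_poly n)"
    by (simp add: orth_poly_def I_smult)
  then show ?thesis using less_imp_le[OF h_pos[of n]] by (simp add: I_monic_poly)
qed

lemma degree_orth_poly [simp]: "degree (orth_poly n) = n"
  using h_pos[of n] by (simp add: orth_poly_def)

lemma adj_deriv_smult: "adj_deriv (smult c p) = smult c (adj_deriv p)"
  by (simp add: adj_deriv_def pderiv_smult smult_diff_right)

lemma adj_deriv_orth_poly: "adj_deriv (orth_poly n) = smult (alpha (n + 1)) (orth_poly (n + 1)) + smult (beta (n + 3)) (orth_poly (n + 3))"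
proof -
  have *: "1 / sqrt (h n) = sqrt (h m / h n) * (1 / sqrt (h m))" for m
    using h_pos[of m] by (simp add: real_sqrt_divide)
  have "adj_deriv (orth_poly n) = smult (step1_coeff (Suc n) * (1 / sqrt (h n))) (monic_poly (Suc n)) + smult (step3_coeff * (1 / sqrt (h n))) (monic_poly (n + 3))"
    by (simp add: orth_poly_def adj_deriv_smult adj_deriv_monic_poly smult_add_right mult.commute)
  also have "smult (step1_coeff (Suc n) * (1 / sqrt (h n))) (monic_poly (Suc n)) = smult (alpha (n + 1)) (orth_poly (n + 1))"
    unfolding orth_poly_def smult_smult alpha_def by (subst *[of "Suc n"]) simp
  also have "smult (step3_coeff * (1 / sqrt (h n))) (monic_poly (n + 3)) = smult (beta (n + 3)) (orth_poly (n + 3))"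
    unfolding orth_poly_def smult_smult beta_def by (subst *[of "n + 3"]) simp
  finally show ?thesis .
qed

section \<open>Growth of the recurrence coefficients and the contraction constant\<close>

lemma alpha_Suc: "alpha (Suc n) = real (Suc n) / sqrt (rec_coeff (Suc n))"
proof -
  have "alpha (Suc n) = real (Suc n) / rec_coeff (Suc n) * sqrt (rec_coeff (Suc n))"
    using h_pos[of n] by (simp add: alpha_def step1_coeff_def rec_coeff_def)
  moreover have "x / y * sqrt y = x / sqrt y" if "y > 0" for x y :: real
    using that by (simp add: divide_eq_eq eq_divide_eq mult.assoc)
  ultimately show ?thesis using rec_coeff_pos[of "Suc n"] by simp
qed

lemma beta_add3: "beta (n + 3) = step3_coeff * sqrt (rec_coeff (n + 3) * rec_coeff (n + 2) * rec_coeff (n + 1))"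
proof -
  have "rec_coeff (n + 3) * rec_coeff (n + 2) * rec_coeff (n + 1) = h (n + 3) / h n"
    using h_pos[of "n + 2"] h_pos[of "n + 1"] by (simp add: rec_coeff_def numeral_3_eq_3)
  then show ?thesis by (simp add: beta_def)
qed

lemma beta_nonneg: "beta (n + 3) \<ge> 0"
  using a_pos by (simp add: beta_add3 step3_coeff_def rec_coeff_nonneg)

lemma alpha_nonneg: "alpha n \<ge> 0"
  by (simp add: alpha_def step1_coeff_def less_imp_le)

lemma sigma_bounds: "sigma = (if e = 2 then 1/2 else 3/4)"
  using e by (auto simp: sigma_def)

text \<open>Freud's equation is used twice. Its terms are nonnegative, so dropping the neighbours
  gives the upper bound. That bound at three consecutive indices makes the bracket at most
  \<open>4 * s\<close>, where \<open>n + 2 <= 4 * (n + 1)\<close> accounts for a share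
  \<open>2 * s\<close>, and the equation then yields \<open>s / 4\<close> from below.\<close>

lemma rec_coeff_bounds_4:
  assumes "e = 4"
  shows "8 * a * (rec_coeff (Suc n))\<^sup>2 \<le> real (Suc n)"
    and "rec_coeff (Suc n) \<ge> sqrt (real (Suc n) / (8 * a)) / 4"
proof -
  have upper: "8 * a * (rec_coeff (Suc n))\<^sup>2 \<le> real (Suc n)" for n
  proof -
    have "8 * a * rec_coeff (Suc n) * rec_coeff (Suc n) \<le> 8 * a * rec_coeff (Suc n) * (rec_coeff (n + 2) + rec_coeff (Suc n) + rec_coeff n)"
      using a_pos rec_coeff_nonneg[of n] rec_coeff_nonneg[of "n + 2"] by (intro mult_left_mono) (auto simp: rec_coeff_nonneg)
    then show ?thesis unfolding rec_coeff_4[OF assms] by (simp add: power2_eq_square mult_ac)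
  qed
  then show "8 * a * (rec_coeff (Suc n))\<^sup>2 \<le> real (Suc n)" .
  define s where "s = sqrt (real (Suc n) / (8 * a))"
  have s: "s > 0" "s\<^sup>2 = real (Suc n) / (8 * a)" using a_pos by (auto simp: s_def)
  have ub: "rec_coeff m \<le> sqrt (real m / (8 * a))" for m
  proof (cases m)
    case (Suc k)
    then show ?thesis using upper[of k] a_pos by (intro real_le_rsqrt) (simp add: field_simps)
  qed (simp add: rec_coeff_def)
  have "rec_coeff (Suc n) \<le> s" using ub[of "Suc n"] by (simp add: s_def)
  moreover have "rec_coeff n \<le> s"
    using a_pos by (intro order.trans[OF ub]) (simp add: s_def divide_right_mono)
  moreover have "rec_coeff (n + 2) \<le> 2 * s"
  proof (intro order.trans[OF ub] real_le_lsqrt)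
    have "real (n + 2) / (8 * a) \<le> 4 * s\<^sup>2"
      unfolding s(2) using a_pos by (simp add: field_simps)
    then show "real (n + 2) / (8 * a) \<le> (2 * s)\<^sup>2" by (simp add: power_mult_distrib)
  qed (use s in auto)
  ultimately have "rec_coeff (n + 2) + rec_coeff (Suc n) + rec_coeff n \<le> 4 * s" by simp
  then have "rec_coeff (Suc n) * (rec_coeff (n + 2) + rec_coeff (Suc n) + rec_coeff n) \<le> rec_coeff (Suc n) * (4 * s)"
    by (intro mult_left_mono rec_coeff_nonneg)
  moreover have "rec_coeff (Suc n) * (rec_coeff (n + 2) + rec_coeff (Suc n) + rec_coeff n) = s\<^sup>2"
    unfolding s(2) using rec_coeff_4[OF assms, of n] a_pos by (simp add: field_simps)
  ultimately have "s * s \<le> (rec_coeff (Suc n) * 4) * s" by (simp add: power2_eq_square mult_ac)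
  then have "s \<le> rec_coeff (Suc n) * 4" using s(1) by simp
  then show "rec_coeff (Suc n) \<ge> sqrt (real (Suc n) / (8 * a)) / 4" by (simp add: s_def)
qed

text \<open>By \<open>alpha_Suc\<close>, \<open>(alpha m)^2\<close> is
  \<open>m^2 / rec_coeff m\<close>, and \<open>rec_coeff m\<close> is of order \<open>m\<close> to
  the power \<open>2 / e\<close>: exactly linear for \<open>e = 2\<close>, of order
  \<open>sqrt m\<close> for \<open>e = 4\<close>.\<close>

lemma alpha_sq_bounds:
  shows "\<exists>c>0. \<exists>C>0. \<forall>n. c * real (Suc n) powr (2 * sigma) \<le> (alpha (Suc n))\<^sup>2 \<and> (alpha (Suc n))\<^sup>2 \<le> C * real (Suc n) powr (2 * sigma)"
proof (cases "e = 2")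
  case True
  have "(alpha (Suc n))\<^sup>2 = 4 * a * real (Suc n) powr (2 * sigma)" for n
  proof -
    have rec_coeff: "rec_coeff (Suc n) = real (Suc n) / (4 * a)" using rec_coeff_2[OF True, of n] a_pos by (simp add: field_simps)
    have "(alpha (Suc n))\<^sup>2 = (real (Suc n))\<^sup>2 / rec_coeff (Suc n)"
      by (simp add: alpha_Suc power_divide rec_coeff_nonneg)
    also have "\<dots> = 4 * a * real (Suc n)" unfolding rec_coeff using a_pos by (simp add: power2_eq_square)
    finally show ?thesis unfolding sigma_bounds by (simp add: True)
  qed
  then show ?thesis using a_pos by (intro exI[of _ "4 * a"] conjI) auto
next
  case False
  then have e4: "e = 4" using e by auto
  define s where "s n = sqrt (real (Suc n) / (8 * a))" for n
  have s: "s n > 0" for n using a_pos by (auto simp: s_def)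
  have "(real (Suc n))\<^sup>2 / s n = sqrt (8 * a) * real (Suc n) powr (2 * sigma)" for n
  proof -
    have "(real (Suc n))\<^sup>2 = real (Suc n) powr 2" by (simp add: powr_numeral)
    moreover have "s n = real (Suc n) powr (1/2) / sqrt (8 * a)"
      by (simp only: s_def real_sqrt_divide powr_half_sqrt)
    ultimately have "(real (Suc n))\<^sup>2 / s n = sqrt (8 * a) * (real (Suc n) powr 2 / real (Suc n) powr (1/2))"
      by simp
    also have "real (Suc n) powr 2 / real (Suc n) powr (1/2) = real (Suc n) powr (2 * sigma)"
      proof -
      have s2: "2 * sigma = 2 - 1 / 2" unfolding sigma_bounds by (simp add: e4)
      show ?thesis unfolding s2 by (rule powr_diff[symmetric])
    qed
    finally show ?thesis .
  qed
  moreover have "(real (Suc n))\<^sup>2 / s n \<le> (alpha (Suc n))\<^sup>2 \<and> (alpha (Suc n))\<^sup>2 \<le> 4 * ((real (Suc n))\<^sup>2 / s n)" for n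
  proof -
    have alpha: "(alpha (Suc n))\<^sup>2 = (real (Suc n))\<^sup>2 / rec_coeff (Suc n)"
      by (simp add: alpha_Suc power_divide rec_coeff_nonneg)
    have "rec_coeff (Suc n) \<le> s n" unfolding s_def
      using rec_coeff_bounds_4(1)[OF e4, of n] a_pos by (intro real_le_rsqrt) (simp add: field_simps)
    then have 1: "(real (Suc n))\<^sup>2 / s n \<le> (alpha (Suc n))\<^sup>2"
      unfolding alpha using rec_coeff_pos[of "Suc n"] by (intro divide_left_mono) (auto intro: mult_pos_pos s)
    have "s n / 4 \<le> rec_coeff (Suc n)" using rec_coeff_bounds_4(2)[OF e4, of n] by (simp add: s_def)
    then have "(alpha (Suc n))\<^sup>2 \<le> (real (Suc n))\<^sup>2 / (s n / 4)"
      unfolding alpha using rec_coeff_pos[of "Suc n"] s[of n] by (intro divide_left_mono) auto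
    with 1 show ?thesis by (simp add: mult.commute)
  qed
  ultimately have "sqrt (8 * a) * real (Suc n) powr (2 * sigma) \<le> (alpha (Suc n))\<^sup>2 \<and>
      (alpha (Suc n))\<^sup>2 \<le> (4 * sqrt (8 * a)) * real (Suc n) powr (2 * sigma)" for n
    by (simp only: mult.assoc)
  moreover have "sqrt (8 * a) > 0" "4 * sqrt (8 * a) > 0" using a_pos by auto
  ultimately show ?thesis by blast
qed

text \<open>For \<open>e = 4\<close> the claim reads
  \<open>8 * a * x * sqrt (y * z) <= q * (n + 3)\<close>. Merely dropping terms in Freud's equation
  leaves no uniform gap below 1. The gap comes from \<open>y^2 >= (n + 2) * t / 16\<close>, the
  lower bound for \<open>rec_coeff\<close>, which pushes \<open>y * z\<close> down to
  \<open>15/16\<close> of \<open>(n + 2) * t\<close>. Any \<open>q^2\<close> from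
  \<open>15/16\<close> up to but excluding 1 would do; \<open>31/32\<close> is taken.\<close>

lemma beta_le_alpha: "\<exists>q\<ge>0. q < 1 \<and> (\<forall>n. beta (n + 3) \<le> q * alpha (n + 3))"
proof (cases "e = 2")
  case True
  have "beta n = 0" for n unfolding beta_def step3_coeff_def by (simp add: True)
  then show ?thesis by (intro exI[of _ 0]) simp
next
  case False
  then have e4: "e = 4" using e by auto
  define q where "q = sqrt (31/32 :: real)"
  have "beta (n + 3) \<le> q * alpha (n + 3)" for n
  proof -
    define x y z w where "x = rec_coeff (n + 3)" and "y = rec_coeff (n + 2)" and "z = rec_coeff (n + 1)" and "w = rec_coeff (n + 4)"
    have pos: "x > 0" "y > 0" "z > 0" "w > 0" by (auto simp: x_def y_def z_def w_def intro!: rec_coeff_pos)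
    define t where "t = 1 / (8 * a)"
    have t: "t > 0" using a_pos by (simp add: t_def)
    have F1: "x * (w + x + y) = real (n + 3) * t"
      using rec_coeff_4[OF e4, of "n + 2"] a_pos by (simp add: x_def y_def w_def t_def field_simps numeral_3_eq_3 eval_nat_numeral)
    have F2: "y * (x + y + z) = real (n + 2) * t"
      using rec_coeff_4[OF e4, of "n + 1"] a_pos by (simp add: x_def y_def z_def t_def field_simps eval_nat_numeral)
    have x2: "x\<^sup>2 \<le> real (n + 3) * t"
      using rec_coeff_bounds_4(1)[OF e4, of "n + 2"] a_pos by (simp add: x_def t_def field_simps numeral_3_eq_3)
    have "(sqrt (real (n + 2) * t) / 4)\<^sup>2 \<le> y\<^sup>2"
      using rec_coeff_bounds_4(2)[OF e4, of "n + 1"] t by (intro power_mono) (simp_all add: y_def t_def)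
    then have y2: "real (n + 2) * t / 16 \<le> y\<^sup>2" using t by (simp add: power_divide)
    have "y * z = real (n + 2) * t - y\<^sup>2 - x * y" using F2 by (simp add: power2_eq_square algebra_simps)
    also have "\<dots> \<le> real (n + 2) * t * (15/16)"
    proof -
      have "p - y\<^sup>2 - x * y \<le> p * (15/16)" if "p / 16 \<le> y\<^sup>2" for p
        using that mult_pos_pos[OF pos(1,2)] by linarith
      then show ?thesis using y2 by blast
    qed
    also have "\<dots> \<le> (31/32) * (real (n + 3) * t)" using t by (simp add: field_simps)
    finally have yz: "y * z \<le> (31/32) * (real (n + 3) * t)" .
    have "x * y * z * x = x\<^sup>2 * (y * z)" by (simp add: power2_eq_square)
    also have "\<dots> \<le> (real (n + 3) * t) * ((31/32) * (real (n + 3) * t))"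
      by (rule mult_mono[OF x2 yz]) (use pos t in auto)
    finally have "sqrt (x * y * z * x) \<le> sqrt ((31/32) * (real (n + 3) * t)\<^sup>2)"
      by (simp add: power2_eq_square mult_ac)
    also have "\<dots> = q * (real (n + 3) * t)" unfolding q_def real_sqrt_mult real_sqrt_abs using t by simp
    finally have 1: "sqrt (x * y * z) * sqrt x \<le> q * (real (n + 3) * t)"
      by (simp only: real_sqrt_mult)
    have "beta (n + 3) = 8 * a * sqrt (x * y * z)"
      unfolding beta_add3 step3_coeff_def by (simp add: e4 x_def y_def z_def)
    moreover have "alpha (n + 3) = real (n + 3) / sqrt x"
      using alpha_Suc[of "n + 2"] by (simp add: x_def numeral_3_eq_3)
    moreover have "8 * a * sqrt (x * y * z) \<le> q * (real (n + 3) / sqrt x)"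
      using 1 pos a_pos by (simp add: t_def field_simps)
    ultimately show ?thesis by simp
  qed
  moreover have "q \<ge> 0" "q < 1" by (auto simp: q_def)
  ultimately show ?thesis by blast
qed

end

subsection \<open>Banded operators on sequences\<close>

text \<open>Convexity of the square for the weights \<open>1 - q\<close> and \<open>q\<close>, since
  \<open>x + q * y = (1 - q) * (x / (1 - q)) + q * y\<close>. The factor \<open>q\<close> in front
  of \<open>y^2\<close> is kept because the estimate is iterated.\<close>

lemma sq_add_le_convex:
  fixes x y q :: real
  assumes "0 \<le> q" "q < 1"
  shows "(x + q * y)\<^sup>2 \<le> x\<^sup>2 / (1 - q) + q * y\<^sup>2"
proof -
  have "x\<^sup>2 / (1 - q) + q * y\<^sup>2 - (x + q * y)\<^sup>2 = q * (x - (1 - q) * y)\<^sup>2 / (1 - q)"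
    using assms by (simp add: power2_eq_square field_simps)
  also have "\<dots> \<ge> 0" using assms by simp
  finally show ?thesis by simp
qed

lemma power_times_square_tendsto_0:
  fixes q c :: real
  assumes "0 \<le> q" "q < 1"
  shows "(\<lambda>n. q ^ n * (2 * real n + c)\<^sup>2) \<longlonglongrightarrow> 0"
proof -
  define s where "s = sqrt q"
  have s: "0 \<le> s" "s < 1" "q = s * s" using assms by (auto simp: s_def)
  have "(\<lambda>n. s ^ n * real n) \<longlonglongrightarrow> 0"
    using powser_times_n_limit_0[of s] s by (simp add: mult.commute)
  moreover have "(\<lambda>n. s ^ n) \<longlonglongrightarrow> 0" using s by (intro LIMSEQ_power_zero) simp
  ultimately have "(\<lambda>n. (2 * (s ^ n * real n) + c * s ^ n)\<^sup>2) \<longlonglongrightarrow> (2 * 0 + c * 0)\<^sup>2"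
    by (intro tendsto_power tendsto_add tendsto_mult tendsto_const)
  moreover have "(2 * (s ^ n * real n) + c * s ^ n)\<^sup>2 = q ^ n * (2 * real n + c)\<^sup>2" for n
    by (simp add: s(3) power_mult_distrib power2_eq_square algebra_simps)
  ultimately show ?thesis by simp
qed

text \<open>The recurrence is solved for \<open>v (m + 1)\<close> in terms of the values \<open>g (m + 2 * i)\<close>; the
  remainder disappears since \<open>v\<close> grows at most linearly.\<close>

lemma backward_recurrence_bound:
  fixes v g \<rho> :: "nat \<Rightarrow> real"
  assumes q: "0 \<le> q" "q < 1" and \<rho>: "\<And>m. 0 \<le> \<rho> m" "\<And>m. \<rho> m \<le> q"
    and rec: "\<And>m. v (m + 1) + \<rho> m * v (m + 3) = g m"
    and growth: "\<And>m. \<bar>v m\<bar> \<le> K * (real m + 1)"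
  shows "ennreal ((v (m + 1))\<^sup>2) \<le> (\<Sum>i. ennreal (q ^ i / (1 - q) * (g (m + 2 * i))\<^sup>2))"
proof -
  have step: "(v (m + 1))\<^sup>2 \<le> (g m)\<^sup>2 / (1 - q) + q * (v (m + 3))\<^sup>2" for m
  proof -
    have "\<bar>v (m + 1)\<bar> \<le> \<bar>g m\<bar> + \<rho> m * \<bar>v (m + 3)\<bar>"
      using rec[of m] \<rho>(1)[of m] abs_triangle_ineq4[of "g m" "\<rho> m * v (m + 3)"]
      by (simp add: abs_mult algebra_simps)
    also have "\<dots> \<le> \<bar>g m\<bar> + q * \<bar>v (m + 3)\<bar>" using \<rho>(2)[of m] by (intro add_left_mono mult_right_mono) auto
    finally have "(\<bar>v (m + 1)\<bar>)\<^sup>2 \<le> (\<bar>g m\<bar> + q * \<bar>v (m + 3)\<bar>)\<^sup>2" by (intro power_mono) auto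
    also have "\<dots> \<le> \<bar>g m\<bar>\<^sup>2 / (1 - q) + q * \<bar>v (m + 3)\<bar>\<^sup>2" using q by (rule sq_add_le_convex)
    finally show ?thesis by simp
  qed
  have iter: "(v (m + 1))\<^sup>2 \<le> (\<Sum>i<n. q ^ i / (1 - q) * (g (m + 2 * i))\<^sup>2) + q ^ n * (v (m + 2 * n + 1))\<^sup>2" for n
  proof (induction n)
    case (Suc n)
    have "q ^ n * (v (m + 2 * n + 1))\<^sup>2 \<le> q ^ n * ((g (m + 2 * n))\<^sup>2 / (1 - q) + q * (v (m + 2 * n + 3))\<^sup>2)"
      using q step[of "m + 2 * n"] by (intro mult_left_mono) auto
    also have "\<dots> = q ^ n / (1 - q) * (g (m + 2 * n))\<^sup>2 + q ^ Suc n * (v (m + 2 * Suc n + 1))\<^sup>2"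
      by (simp add: algebra_simps numeral_3_eq_3)
    finally show ?case using Suc by simp
  qed simp
  define r where "r n = q ^ n * (v (m + 2 * n + 1))\<^sup>2" for n
  have "r \<longlonglongrightarrow> 0"
  proof (rule Lim_null_comparison)
    show "(\<lambda>n. K\<^sup>2 * (q ^ n * (2 * real n + (real m + 2))\<^sup>2)) \<longlonglongrightarrow> 0"
      using tendsto_mult[OF tendsto_const power_times_square_tendsto_0[OF q]] by simp
    show "\<forall>\<^sub>F n in sequentially. norm (r n) \<le> K\<^sup>2 * (q ^ n * (2 * real n + (real m + 2))\<^sup>2)"
    proof (intro always_eventually allI)
      fix n
      have "(\<bar>v (m + 2 * n + 1)\<bar>)\<^sup>2 \<le> (K * (real (m + 2 * n + 1) + 1))\<^sup>2"
        by (intro power_mono growth) simp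
      then have "q ^ n * (v (m + 2 * n + 1))\<^sup>2 \<le> q ^ n * (K * (real (m + 2 * n + 1) + 1))\<^sup>2"
        using q by (intro mult_left_mono) auto
      then show "norm (r n) \<le> K\<^sup>2 * (q ^ n * (2 * real n + (real m + 2))\<^sup>2)"
        using q by (simp add: r_def power_mult_distrib mult_ac add_ac)
    qed
  qed
  then have lim: "(\<lambda>n. S + ennreal (r n)) \<longlonglongrightarrow> S + ennreal 0" for S
    by (intro tendsto_add tendsto_const tendsto_ennrealI)
  let ?S = "\<Sum>i. ennreal (q ^ i / (1 - q) * (g (m + 2 * i))\<^sup>2)"
  have "ennreal ((v (m + 1))\<^sup>2) \<le> ?S + ennreal (r n)" for n
  proof -
    have "ennreal ((v (m + 1))\<^sup>2) \<le> ennreal ((\<Sum>i<n. q ^ i / (1 - q) * (g (m + 2 * i))\<^sup>2) + r n)"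
      using iter[of n] by (intro ennreal_leI) (simp add: r_def)
    also have "\<dots> = (\<Sum>i<n. ennreal (q ^ i / (1 - q) * (g (m + 2 * i))\<^sup>2)) + ennreal (r n)"
      using q by (subst ennreal_plus) (auto simp: r_def intro!: sum_nonneg)
    also have "\<dots> \<le> ?S + ennreal (r n)"
      by (intro add_right_mono sum_le_suminf) auto
    finally show ?thesis .
  qed
  then show ?thesis using LIMSEQ_le_const[OF lim[of ?S]] by auto
qed

lemma ennreal_le_lincomb:
  "x \<le> c * y + c * z \<Longrightarrow> 0 \<le> c \<Longrightarrow> 0 \<le> y \<Longrightarrow> 0 \<le> z \<Longrightarrow>
    ennreal x \<le> ennreal c * ennreal y + ennreal c * ennreal z"
  by (simp add: ennreal_mult[symmetric] ennreal_plus[symmetric] ennreal_leI del: ennreal_plus)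

lemma ennreal_mult_le:
  "x * y \<le> z * w \<Longrightarrow> 0 \<le> x \<Longrightarrow> 0 \<le> y \<Longrightarrow> 0 \<le> z \<Longrightarrow> 0 \<le> w \<Longrightarrow>
    ennreal x * ennreal y \<le> ennreal z * ennreal w"
  by (simp add: ennreal_mult[symmetric] ennreal_leI)

text \<open>Serves two kinds of multi-indices: positions \<open>k\<close> in a coefficient array,
  and derivative orders \<open>l\<close> or weight exponents \<open>s\<close>.\<close>

definition shift :: "'d \<Rightarrow> nat \<Rightarrow> ('d \<Rightarrow> nat) \<Rightarrow> 'd \<Rightarrow> nat" where
  "shift j n k = k(j := k j + n)"

lemma inj_shift: "inj (shift j n)"
proof (rule injI)
  fix k l assume *: "shift j n k = shift j n l"
  show "k = l"
  proof
    fix i show "k i = l i" using fun_cong[OF *, of i] by (auto simp: shift_def split: if_splits)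
  qed
qed

lemma shift_apply: "shift j n k i = (if i = j then k j + n else k i)"
  by (simp add: shift_def)

lemma shift_shift [simp]: "shift j m (shift j n k) = shift j (n + m) k"
  by (auto simp: shift_def)

lemma shift_0 [simp]: "shift j 0 k = k"
  by (simp add: shift_def)

lemma nn_integral_shift_le:
  "(\<integral>\<^sup>+k. f (shift j n k) \<partial>count_space UNIV) \<le> (\<integral>\<^sup>+k. f k \<partial>count_space UNIV)"
proof -
  have "(\<integral>\<^sup>+k. f (shift j n k) \<partial>count_space UNIV) = (\<integral>\<^sup>+k. f k \<partial>count_space (range (shift j n)))"
    by (rule nn_integral_bij_count_space) (simp add: bij_betw_def inj_shift)
  also have "\<dots> \<le> (\<integral>\<^sup>+k. f k \<partial>count_space UNIV)"
    by (subst nn_integral_count_space_indicator) (auto intro!: nn_integral_mono split: split_indicator)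
  finally show ?thesis .
qed

lemma nn_integral_shift_1:
  "(\<integral>\<^sup>+k. f k \<partial>count_space UNIV) =
    (\<integral>\<^sup>+k. f k * indicator {k. k j = 0} k \<partial>count_space UNIV) + (\<integral>\<^sup>+k. f (shift j 1 k) \<partial>count_space UNIV)"
proof -
  have r: "range (shift j 1) = {k. k j \<noteq> 0}"
  proof safe
    fix k :: "'a \<Rightarrow> nat" assume "k j > 0"
    then show "k \<in> range (shift j 1)" by (intro image_eqI[of _ _ "k(j := k j - 1)"]) (auto simp: shift_def)
  qed (auto simp: shift_def)
  have "(\<integral>\<^sup>+k. f (shift j 1 k) \<partial>count_space UNIV) = (\<integral>\<^sup>+k. f k \<partial>count_space (range (shift j 1)))"
    by (rule nn_integral_bij_count_space) (simp add: bij_betw_def inj_shift)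
  also have "\<dots> = (\<integral>\<^sup>+k. f k * indicator {k. k j \<noteq> 0} k \<partial>count_space UNIV)"
    unfolding r by (subst nn_integral_count_space_indicator) auto
  finally have 1: "(\<integral>\<^sup>+k. f (shift j 1 k) \<partial>count_space UNIV) = \<dots>" .
  show ?thesis unfolding 1
    by (subst nn_integral_add[symmetric]) (auto intro!: nn_integral_cong split: split_indicator)
qed

text \<open>The squared weighted \<open>\<ell>\<^sub>2\<close> norm, in the extended reals so that no summability assumption is needed.\<close>

definition wsum :: "(nat \<Rightarrow> real) \<Rightarrow> ('d::finite \<Rightarrow> nat) \<Rightarrow> (('d \<Rightarrow> nat) \<Rightarrow> real) \<Rightarrow> ennreal" where
  "wsum \<omega> s u = (\<integral>\<^sup>+k. ennreal ((\<Prod>i\<in>UNIV. \<omega> (k i) ^ s i) * (u k)\<^sup>2) \<partial>count_space UNIV)"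

text \<open>The arithmetic of a perturbed weighted shift, detached from polynomials.
  \<open>\<omega> m\<close> models the square of \<open>alpha (m + 1)\<close>.
  \<open>\<omega>_Suc\<close> permits moving a weight by one index, \<open>\<omega>_le\<close> keeps
  \<open>alpha\<close> of at most linear growth as the backward recurrence requires, and
  \<open>beta <= q * alpha\<close> makes the shift by 3 a perturbation of the shift by 1.\<close>

locale banded =
  fixes \<omega> alpha beta :: "nat \<Rightarrow> real" and q c1 c2 :: real
  assumes \<omega>0: "\<omega> 0 = 1" and \<omega>_mono: "\<And>m n. m \<le> n \<Longrightarrow> \<omega> m \<le> \<omega> n"
    and \<omega>_Suc: "\<And>m. \<omega> (Suc m) \<le> 4 * \<omega> m" and \<omega>_le: "\<And>m. \<omega> m \<le> (real m + 1)\<^sup>2"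
    and q: "0 \<le> q" "q < 1" and beta: "\<And>m. 0 \<le> beta (m + 3)" "\<And>m. beta (m + 3) \<le> q * alpha (m + 3)"
    and al0: "alpha 0 = 0" and alpha_nonneg: "\<And>m. alpha m \<ge> 0"
    and c1: "c1 > 0" and alpha_lower: "\<And>m. c1 * \<omega> m \<le> (alpha (m + 1))\<^sup>2"
    and c2: "c2 > 0" and alpha_upper: "\<And>m. (alpha (m + 1))\<^sup>2 \<le> c2 * \<omega> m"
begin

lemma \<omega>_ge1: "\<omega> m \<ge> 1"
  using \<omega>_mono[of 0 m] \<omega>0 by simp

lemma \<omega>_pos: "\<omega> m > 0" using \<omega>_ge1[of m] by linarith

lemma alpha_pos: "alpha (m + 1) > 0"
proof -
  have "(alpha (m + 1))\<^sup>2 > 0" by (rule less_le_trans[OF mult_pos_pos[OF c1 \<omega>_pos] alpha_lower])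
  then show ?thesis using alpha_nonneg[of "m + 1"] by (simp add: less_le)
qed

definition wt :: "('d::finite \<Rightarrow> nat) \<Rightarrow> ('d \<Rightarrow> nat) \<Rightarrow> real" where
  "wt s k = (\<Prod>i\<in>UNIV. \<omega> (k i) ^ s i)"

lemma wsum_wt: "wsum \<omega> s u = (\<integral>\<^sup>+k. ennreal (wt s k * (u k)\<^sup>2) \<partial>count_space UNIV)"
  by (simp add: wsum_def wt_def)

lemma wt_nonneg: "wt s k \<ge> 0"
  unfolding wt_def by (intro prod_nonneg ballI zero_le_power less_imp_le \<omega>_pos)

lemma wt_shift_mono: "wt s k \<le> wt s (shift j n k)"
  unfolding wt_def shift_apply
  by (intro prod_mono conjI zero_le_power less_imp_le[OF \<omega>_pos] power_mono \<omega>_mono) auto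

text \<open>Here \<open>shift\<close> acts on the exponents: one more unit of weight in direction
  \<open>j\<close> is the factor \<open>\<omega> (k j)\<close>, comparable to the square of one
  derivative in that direction.\<close>

lemma wt_Suc: "wt (shift j 1 s) k = \<omega> (k j) * wt s k"
proof -
  have "wt (shift j 1 s) k = (\<Prod>i\<in>UNIV. (if i = j then \<omega> (k i) else 1) * \<omega> (k i) ^ s i)"
    unfolding wt_def by (intro prod.cong) (auto simp: shift_apply)
  also have "\<dots> = \<omega> (k j) * wt s k" by (simp add: prod.distrib wt_def)
  finally show ?thesis .
qed

lemma wt_shift_le: "wt s (shift j 1 k) \<le> 4 ^ s j * wt s k"
proof -
  have "wt s (shift j 1 k) \<le> (\<Prod>i\<in>UNIV. (if i = j then 4 ^ s i else 1) * \<omega> (k i) ^ s i)"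
    unfolding wt_def
  proof (intro prod_mono conjI)
    fix i
    show "\<omega> (shift j 1 k i) ^ s i \<le> (if i = j then 4 ^ s i else 1) * \<omega> (k i) ^ s i"
    proof (cases "i = j")
      case True
      have "\<omega> (Suc (k j)) ^ s j \<le> (4 * \<omega> (k j)) ^ s j"
        by (intro power_mono \<omega>_Suc less_imp_le[OF \<omega>_pos])
      then show ?thesis using True by (simp add: shift_apply power_mult_distrib)
    qed (simp add: shift_apply)
  qed (intro zero_le_power less_imp_le[OF \<omega>_pos])
  also have "\<dots> = 4 ^ s j * wt s k" by (simp add: prod.distrib wt_def)
  finally show ?thesis .
qed

lemma wsum_mono:
  assumes "\<And>i. s i \<le> t i"
  shows "wsum \<omega> s u \<le> wsum \<omega> t u"
proof -
  have "wt s k \<le> wt t k" for k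
    unfolding wt_def using assms
    by (intro prod_mono conjI zero_le_power less_imp_le[OF \<omega>_pos] power_increasing \<omega>_ge1) auto
  then show ?thesis unfolding wsum_wt by (intro nn_integral_mono ennreal_leI mult_right_mono) auto
qed

text \<open>The map that a weak derivative in direction \<open>j\<close> induces on coefficient
  arrays. The adjoint raises a basis index by 1 or 3, so the entries at raised positions are
  read.\<close>

definition band :: "'d::finite \<Rightarrow> (('d \<Rightarrow> nat) \<Rightarrow> real) \<Rightarrow> ('d \<Rightarrow> nat) \<Rightarrow> real" where
  "band j u k = alpha (k j + 1) * u (shift j 1 k) + beta (k j + 3) * u (shift j 3 k)"

text \<open>\<open>beta <= alpha\<close> and \<open>alpha_upper\<close> bound both squared
  coefficients by \<open>c2 * \<omega>\<close> at the position that is read, and weights grow along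
  shifts. The constant is \<open>c2\<close> times 2 from the square of a sum times 2 for its two
  terms.\<close>

lemma band_upper: "wsum \<omega> s (band j u) \<le> ennreal (4 * c2) * wsum \<omega> (shift j 1 s) u"
proof -
  have alpha: "(alpha (k j + 1))\<^sup>2 * wt s k \<le> c2 * wt (shift j 1 s) (shift j 1 k)" for k
  proof -
    have "(alpha (k j + 1))\<^sup>2 * wt s k \<le> (c2 * \<omega> (k j + 1)) * wt s (shift j 1 k)"
      using alpha_upper[of "k j"] \<omega>_mono[of "k j" "k j + 1"] c2
      by (intro mult_mono wt_nonneg wt_shift_mono) (auto intro: order.trans simp: less_imp_le[OF \<omega>_pos])
    then show ?thesis by (simp add: wt_Suc wt_Suc[unfolded One_nat_def] shift_apply mult_ac)
  qed
  have beta: "(beta (k j + 3))\<^sup>2 * wt s k \<le> c2 * wt (shift j 1 s) (shift j 3 k)" for k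
  proof -
    have "beta (k j + 3) \<le> alpha (k j + 3)"
      using beta(2)[of "k j"] q alpha_nonneg[of "k j + 3"] by (meson less_imp_le mult_left_le_one_le order_trans)
    then have "(beta (k j + 3))\<^sup>2 \<le> (alpha (k j + 3))\<^sup>2" using beta(1) by (intro power_mono) auto
    also have "\<dots> \<le> c2 * \<omega> (k j + 2)" using alpha_upper[of "k j + 2"] by (simp add: numeral_3_eq_3)
    also have "\<dots> \<le> c2 * \<omega> (k j + 3)" using c2 by (intro mult_left_mono \<omega>_mono) auto
    finally have "(beta (k j + 3))\<^sup>2 * wt s k \<le> (c2 * \<omega> (k j + 3)) * wt s (shift j 3 k)"
      using c2 by (intro mult_mono wt_nonneg wt_shift_mono) (auto simp: less_imp_le[OF \<omega>_pos])
    then show ?thesis by (simp add: wt_Suc wt_Suc[unfolded One_nat_def] shift_apply mult_ac)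
  qed
  let ?t = "shift j 1 s"
  have pw: "wt s k * (band j u k)\<^sup>2 \<le> 2 * c2 * (wt ?t (shift j 1 k) * (u (shift j 1 k))\<^sup>2) + 2 * c2 * (wt ?t (shift j 3 k) * (u (shift j 3 k))\<^sup>2)" for k
  proof -
    define x y where "x = alpha (k j + 1) * u (shift j 1 k)" and "y = beta (k j + 3) * u (shift j 3 k)"
    have "(x + y)\<^sup>2 \<le> 2 * x\<^sup>2 + 2 * y\<^sup>2" using zero_le_power2[of "x - y"]
      by (simp add: power2_eq_square algebra_simps)
    then have "wt s k * (band j u k)\<^sup>2 \<le> wt s k * (2 * x\<^sup>2 + 2 * y\<^sup>2)"
      unfolding band_def x_def[symmetric] y_def[symmetric] by (intro mult_left_mono wt_nonneg)
    also have "\<dots> = 2 * (((alpha (k j + 1))\<^sup>2 * wt s k) * (u (shift j 1 k))\<^sup>2) + 2 * (((beta (k j + 3))\<^sup>2 * wt s k) * (u (shift j 3 k))\<^sup>2)"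
      by (simp add: x_def y_def power_mult_distrib algebra_simps)
    also have "\<dots> \<le> 2 * ((c2 * wt ?t (shift j 1 k)) * (u (shift j 1 k))\<^sup>2) + 2 * ((c2 * wt ?t (shift j 3 k)) * (u (shift j 3 k))\<^sup>2)"
      by (intro add_mono mult_left_mono mult_right_mono alpha beta) auto
    finally show ?thesis by (simp add: mult_ac)
  qed
  have "wsum \<omega> s (band j u) \<le> (\<integral>\<^sup>+k. ennreal (2 * c2) * ennreal (wt ?t (shift j 1 k) * (u (shift j 1 k))\<^sup>2)
      + ennreal (2 * c2) * ennreal (wt ?t (shift j 3 k) * (u (shift j 3 k))\<^sup>2) \<partial>count_space UNIV)"
    unfolding wsum_wt using c2
    by (intro nn_integral_mono ennreal_le_lincomb pw mult_nonneg_nonneg wt_nonneg) auto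
  also have "\<dots> = ennreal (2 * c2) * (\<integral>\<^sup>+k. ennreal (wt ?t (shift j 1 k) * (u (shift j 1 k))\<^sup>2) \<partial>count_space UNIV)
      + ennreal (2 * c2) * (\<integral>\<^sup>+k. ennreal (wt ?t (shift j 3 k) * (u (shift j 3 k))\<^sup>2) \<partial>count_space UNIV)"
    by (subst nn_integral_add) (auto simp: nn_integral_cmult)
  also have "\<dots> \<le> ennreal (2 * c2) * wsum \<omega> ?t u + ennreal (2 * c2) * wsum \<omega> ?t u"
    unfolding wsum_wt by (intro add_mono mult_left_mono nn_integral_shift_le) auto
  also have "\<dots> = ennreal (4 * c2) * wsum \<omega> ?t u"
    using c2 by (simp flip: distrib_right ennreal_plus)
  finally show ?thesis .
qed

text \<open>Along each line in direction \<open>j\<close>, \<open>v = alpha * u\<close> satisfies a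
  recurrence with the band entries on the right, and \<open>backward_recurrence_bound\<close>
  controls it by a geometric series; summing \<open>q ^ i / (1 - q)\<close> gives
  \<open>1 / (1 - q)^2\<close>. Entries with \<open>k j = 0\<close> are not seen by
  \<open>band\<close> and are paid for by \<open>wsum \<omega> s u\<close>, as
  \<open>\<omega> 0 = 1\<close>. Boundedness of \<open>u\<close> supplies the growth
  hypothesis.\<close>

lemma band_lower:
  assumes bdd: "\<And>k. \<bar>u k\<bar> \<le> B"
  shows "wsum \<omega> (shift j 1 s) u \<le> wsum \<omega> s u + ennreal (4 * 4 ^ s j / (c1 * (1 - q)\<^sup>2)) * wsum \<omega> s (band j u)"
proof -
  let ?t = "shift j 1 s"
  define v where "v k = alpha (k j) * u k" for k
  have B: "B \<ge> 0" using bdd[of undefined] by linarith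
  have v: "ennreal ((v (shift j 1 k))\<^sup>2) \<le> (\<Sum>i. ennreal (q ^ i / (1 - q) * (band j u (shift j (2 * i) k))\<^sup>2))" for k
  proof -
    define K where "K = sqrt c2 * B"
    \<comment> \<open>Clearing coordinate \<open>j\<close> turns the whole line through
      \<open>k\<close> into one sequence indexed from 0, to which the recurrence bound is applied at
      \<open>m = k j\<close>.\<close>
    let ?k = "k(j := 0)"
    have alpha_le: "alpha m \<le> sqrt c2 * (real m + 1)" for m
    proof (cases m)
      case 0

      then show ?thesis using al0 c2 by simp
    next
      case (Suc n)
      have "(alpha m)\<^sup>2 \<le> c2 * (real n + 1)\<^sup>2"
        using order.trans[OF alpha_upper[of n] mult_left_mono[OF \<omega>_le[of n], of c2]] c2 Suc by simp
      then have "alpha m \<le> sqrt (c2 * (real n + 1)\<^sup>2)" by (rule real_le_rsqrt)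
      also have "\<dots> = sqrt c2 * (real n + 1)" by (simp add: real_sqrt_mult)
      also have "\<dots> \<le> sqrt c2 * (real m + 1)" using c2 Suc by (intro mult_left_mono) auto
      finally show ?thesis .
    qed
    have "ennreal ((v (shift j (k j + 1) ?k))\<^sup>2) \<le> (\<Sum>i. ennreal (q ^ i / (1 - q) * (band j u (shift j (k j + 2 * i) ?k))\<^sup>2))"
    proof (rule backward_recurrence_bound[where v = "\<lambda>m. v (shift j m ?k)" and \<rho> = "\<lambda>m. beta (m + 3) / alpha (m + 3)"
          and K = K, OF q])
      fix m
      show "0 \<le> beta (m + 3) / alpha (m + 3)" using beta(1) alpha_nonneg by simp
      have al3: "alpha (m + 3) > 0" using alpha_pos[of "m + 2"] by (simp add: numeral_3_eq_3)
      show "beta (m + 3) / alpha (m + 3) \<le> q" using beta(2)[of m] al3 by (simp add: field_simps)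
      show "v (shift j (m + 1) ?k) + beta (m + 3) / alpha (m + 3) * v (shift j (m + 3) ?k) = band j u (shift j m ?k)"
        using al3 by (simp add: v_def band_def shift_apply)
      have "\<bar>v (shift j m ?k)\<bar> = alpha m * \<bar>u (shift j m ?k)\<bar>"
        using alpha_nonneg[of m] by (simp add: v_def shift_apply abs_mult)
      also have "\<dots> \<le> sqrt c2 * (real m + 1) * B"
        using alpha_le[of m] c2 alpha_nonneg by (intro mult_mono bdd) auto
      finally show "\<bar>v (shift j m ?k)\<bar> \<le> K * (real m + 1)" by (simp add: K_def mult_ac)
    qed
    moreover have "shift j (k j + n) ?k = shift j n k" for n by (auto simp: shift_def)
    ultimately show ?thesis by (simp only:)
  qed
  have pw: "ennreal (wt ?t (shift j 1 k) * (u (shift j 1 k))\<^sup>2) \<le> ennreal (4 * 4 ^ s j / c1) * (ennreal (wt s k) * ennreal ((v (shift j 1 k))\<^sup>2))" for k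
  proof -
    \<comment> \<open>The weight sits at \<open>k j + 1\<close>, whereas
      \<open>alpha (k j + 1)\<close> is comparable to \<open>\<omega> (k j)\<close>; bridging this
      off-by-one costs the factor 4, and likewise \<open>4 ^ s j\<close> for
      \<open>wt s\<close>.\<close>
    have "\<omega> (k j + 1) * c1 \<le> 4 * (alpha (k j + 1))\<^sup>2"
    proof -
      have "\<omega> (k j + 1) * c1 \<le> (4 * \<omega> (k j)) * c1"
        using \<omega>_Suc[of "k j"] c1 by (intro mult_right_mono) auto
      then show ?thesis using alpha_lower[of "k j"] by (simp only: mult_ac)
    qed
    then have "\<omega> (k j + 1) \<le> 4 / c1 * (alpha (k j + 1))\<^sup>2" using c1 by (simp add: field_simps)
    then have "\<omega> (k j + 1) * wt s (shift j 1 k) \<le> (4 / c1 * (alpha (k j + 1))\<^sup>2) * (4 ^ s j * wt s k)"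
      using c1 by (intro mult_mono wt_shift_le wt_nonneg) auto
    then have "wt ?t (shift j 1 k) * (u (shift j 1 k))\<^sup>2 \<le> (4 / c1 * (alpha (k j + 1))\<^sup>2) * (4 ^ s j * wt s k) * (u (shift j 1 k))\<^sup>2"
      by (intro mult_right_mono) (auto simp: wt_Suc wt_Suc[unfolded One_nat_def] shift_apply)
    also have "\<dots> = 4 * 4 ^ s j / c1 * (wt s k * (v (shift j 1 k))\<^sup>2)"
      by (simp add: v_def shift_apply power_mult_distrib)
    finally show ?thesis using c1 wt_nonneg[of s k] by (simp flip: ennreal_mult)
  qed
  have "(\<integral>\<^sup>+k. ennreal (wt s k) * ennreal ((v (shift j 1 k))\<^sup>2) \<partial>count_space UNIV) \<le>
     (\<integral>\<^sup>+k. (\<Sum>i. ennreal (wt s k) * ennreal (q ^ i / (1 - q) * (band j u (shift j (2 * i) k))\<^sup>2)) \<partial>count_space UNIV)"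
    by (intro nn_integral_mono) (simp only: ennreal_suminf_cmult, rule mult_left_mono[OF v], simp)
  also have "\<dots> = (\<Sum>i. \<integral>\<^sup>+k. ennreal (wt s k) * ennreal (q ^ i / (1 - q) * (band j u (shift j (2 * i) k))\<^sup>2) \<partial>count_space UNIV)"
    by (intro nn_integral_suminf) auto
  also have "\<dots> \<le> (\<Sum>i. ennreal (q ^ i / (1 - q)) * wsum \<omega> s (band j u))"
  proof (intro suminf_le allI)
    fix i
    have "(\<integral>\<^sup>+k. ennreal (wt s k) * ennreal (q ^ i / (1 - q) * (band j u (shift j (2 * i) k))\<^sup>2) \<partial>count_space UNIV)
      \<le> (\<integral>\<^sup>+k. ennreal (q ^ i / (1 - q)) * ennreal (wt s (shift j (2 * i) k) * (band j u (shift j (2 * i) k))\<^sup>2) \<partial>count_space UNIV)"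
    proof (intro nn_integral_mono)
      fix k
      \<comment> \<open>Weights do not decrease along shifts, so the weight can be moved to the
        shifted position before the sum is enlarged to all positions.\<close>
      have "wt s k * (q ^ i / (1 - q) * (band j u (shift j (2 * i) k))\<^sup>2) \<le> wt s (shift j (2 * i) k) * (q ^ i / (1 - q) * (band j u (shift j (2 * i) k))\<^sup>2)"
        using q by (intro mult_right_mono wt_shift_mono) auto
      then show "ennreal (wt s k) * ennreal (q ^ i / (1 - q) * (band j u (shift j (2 * i) k))\<^sup>2)
        \<le> ennreal (q ^ i / (1 - q)) * ennreal (wt s (shift j (2 * i) k) * (band j u (shift j (2 * i) k))\<^sup>2)"
        using q by (intro ennreal_mult_le) (auto simp: mult_ac wt_nonneg)
    qed
    also have "\<dots> = ennreal (q ^ i / (1 - q)) * (\<integral>\<^sup>+k. ennreal (wt s (shift j (2 * i) k) * (band j u (shift j (2 * i) k))\<^sup>2) \<partial>count_space UNIV)"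
      by (rule nn_integral_cmult) auto
    also have "\<dots> \<le> ennreal (q ^ i / (1 - q)) * wsum \<omega> s (band j u)"
      unfolding wsum_wt by (intro mult_left_mono nn_integral_shift_le) auto
    finally show "(\<integral>\<^sup>+k. ennreal (wt s k) * ennreal (q ^ i / (1 - q) * (band j u (shift j (2 * i) k))\<^sup>2) \<partial>count_space UNIV)
      \<le> ennreal (q ^ i / (1 - q)) * wsum \<omega> s (band j u)" .
  qed auto
  also have "\<dots> = (\<Sum>i. ennreal (q ^ i / (1 - q))) * wsum \<omega> s (band j u)"
    by simp
  also have "(\<Sum>i. ennreal (q ^ i / (1 - q))) = ennreal (1 / (1 - q)\<^sup>2)"
  proof -
    have "(\<lambda>i. q ^ i / (1 - q)) sums (1 / (1 - q) / (1 - q))"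
      using q by (intro sums_divide geometric_sums) auto
    then show ?thesis using q by (intro suminf_ennreal_eq) (auto simp: power2_eq_square)
  qed
  finally have main: "(\<integral>\<^sup>+k. ennreal (wt s k) * ennreal ((v (shift j 1 k))\<^sup>2) \<partial>count_space UNIV) \<le> ennreal (1 / (1 - q)\<^sup>2) * wsum \<omega> s (band j u)" .
  have "wsum \<omega> ?t u = (\<integral>\<^sup>+k. ennreal (wt ?t k * (u k)\<^sup>2) * indicator {k. k j = 0} k \<partial>count_space UNIV)
      + (\<integral>\<^sup>+k. ennreal (wt ?t (shift j 1 k) * (u (shift j 1 k))\<^sup>2) \<partial>count_space UNIV)"
    unfolding wsum_wt by (rule nn_integral_shift_1)
  also have "\<dots> \<le> wsum \<omega> s u + (\<integral>\<^sup>+k. ennreal (4 * 4 ^ s j / c1) * (ennreal (wt s k) * ennreal ((v (shift j 1 k))\<^sup>2)) \<partial>count_space UNIV)"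
    unfolding wsum_wt
    by (intro add_mono nn_integral_mono pw) (auto simp: wt_Suc wt_Suc[unfolded One_nat_def] \<omega>0 split: split_indicator)
  also have "\<dots> \<le> wsum \<omega> s u + ennreal (4 * 4 ^ s j / c1) * (ennreal (1 / (1 - q)\<^sup>2) * wsum \<omega> s (band j u))"
    using main by (subst nn_integral_cmult) (auto intro!: add_left_mono mult_left_mono)
  also have "\<dots> = wsum \<omega> s u + ennreal (4 * 4 ^ s j / (c1 * (1 - q)\<^sup>2)) * wsum \<omega> s (band j u)"
    using c1 by (simp add: mult.assoc[symmetric] ennreal_mult[symmetric])
  finally show ?thesis .
qed

text \<open>\<open>c l\<close> stands for the coefficients of the derivative of order
  \<open>l\<close>. For the lower estimate, units of weight are traded one by one for derivatives by
  \<open>band_lower\<close>; the undifferentiated term it keeps is the summand 1 in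
  \<open>A\<close>. For the upper estimate, \<open>band_upper\<close> trades derivatives back for
  weight. Either way there are at most \<open>r * CARD('d)\<close> trades.\<close>

lemma band_family:
  fixes c :: "('d::finite \<Rightarrow> nat) \<Rightarrow> ('d \<Rightarrow> nat) \<Rightarrow> real"
  assumes rec: "\<And>l j. (\<And>i. shift j 1 l i \<le> r) \<Longrightarrow> c (shift j 1 l) = band j (c l)"
    and bdd: "\<And>l. (\<And>i. l i \<le> r) \<Longrightarrow> \<exists>B. \<forall>k. \<bar>c l k\<bar> \<le> B"
  defines "A \<equiv> 1 + 4 * 4 ^ r / (c1 * (1 - q)\<^sup>2)"
  shows "wsum \<omega> (\<lambda>_. r) (c (\<lambda>_. 0)) \<le>
      ennreal (A ^ (r * CARD('d))) * (\<Sum>l | \<forall>i. l i \<le> r. wsum \<omega> (\<lambda>_. 0) (c l))" (is ?lower)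
    and "(\<Sum>l | \<forall>i. l i \<le> r. wsum \<omega> (\<lambda>_. 0) (c l)) \<le>
      ennreal ((r + 1) ^ CARD('d) * (1 + 4 * c2) ^ (r * CARD('d))) * wsum \<omega> (\<lambda>_. r) (c (\<lambda>_. 0))" (is ?upper)
proof -
  let ?L = "{l :: 'd \<Rightarrow> nat. \<forall>i. l i \<le> r}"
  define T where "T = (\<Sum>l\<in>?L. wsum \<omega> (\<lambda>_. 0) (c l))"
  have "?L = (PiE UNIV (\<lambda>_. {..r}))" by auto
  then have fin: "finite ?L" and card: "card ?L = (r + 1) ^ CARD('d)"
    by (simp_all add: finite_PiE card_PiE)
  have A: "A \<ge> 1" using c1 by (simp add: A_def)
  have dec: "\<exists>j s'. s = shift j 1 s' \<and> (\<Sum>i\<in>UNIV. s i) = Suc (\<Sum>i\<in>UNIV. s' i)"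
    if "(\<Sum>i\<in>UNIV. s i) > 0" for s :: "'d \<Rightarrow> nat"
  proof -
    have "\<exists>j. s j > 0"
    proof (rule ccontr)
      assume "\<not> (\<exists>j. s j > 0)"
      then have "s j = 0" for j by auto
      then show False using that by simp
    qed
    then obtain j where j: "s j > 0" by auto
    define s' where "s' = s(j := s j - 1)"
    have s: "s = shift j 1 s'" using j by (auto simp: s'_def shift_def)
    have "(\<Sum>i\<in>UNIV. s i) = (\<Sum>i\<in>UNIV. s' i + (if i = j then 1 else 0))"
      by (subst s, intro sum.cong) (auto simp: shift_apply)
    also have "\<dots> = Suc (\<Sum>i\<in>UNIV. s' i)" by (simp add: sum.distrib)
    finally show ?thesis using s by blast
  qed
  \<comment> \<open>The invariant \<open>s i + l i <= r\<close> keeps every derivative created by a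
    trade inside the family.\<close>
  have low: "wsum \<omega> s (c l) \<le> ennreal (A ^ n) * T" if "(\<Sum>i\<in>UNIV. s i) = n" "\<And>i. s i + l i \<le> r" for n s l
    using that
  proof (induction n arbitrary: s l)
    case 0
    then have s: "s = (\<lambda>_. 0)" by auto
    have "wsum \<omega> s (c l) \<le> T"
      unfolding s T_def using 0 fin by (intro member_le_sum) auto
    then show ?case by simp
  next
    case (Suc n)
    obtain j s' where s: "s = shift j 1 s'" and n: "(\<Sum>i\<in>UNIV. s' i) = n" using dec[of s] Suc.prems by auto
    have sl: "s' i + l i \<le> r" "s' i + shift j 1 l i \<le> r" for i
      using Suc.prems(2)[of i] by (auto simp: s shift_apply split: if_splits)
    have lr: "shift j 1 l i \<le> r" "l i \<le> r" for i using sl(2)[of i] sl(1)[of i] by linarith+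
    obtain B where B: "\<And>k. \<bar>c l k\<bar> \<le> B" using bdd[of l, OF lr(2)] by blast
    have "4 ^ s' j \<le> (4::real) ^ r" using sl(1)[of j] by (intro power_increasing) auto
    then have K: "4 * 4 ^ s' j / (c1 * (1 - q)\<^sup>2) \<le> A - 1"
      using c1 q by (simp add: A_def divide_right_mono)
    have "wsum \<omega> s (c l) \<le> wsum \<omega> s' (c l) + ennreal (4 * 4 ^ s' j / (c1 * (1 - q)\<^sup>2)) * wsum \<omega> s' (band j (c l))"
      unfolding s by (rule band_lower[OF B])
    also have "\<dots> \<le> wsum \<omega> s' (c l) + ennreal (A - 1) * wsum \<omega> s' (c (shift j 1 l))"
      unfolding rec[of j l, OF lr(1)] by (intro add_left_mono mult_right_mono ennreal_leI K) simp
    also have "\<dots> \<le> ennreal (A ^ n) * T + ennreal (A - 1) * (ennreal (A ^ n) * T)"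
      by (intro add_mono mult_left_mono Suc.IH n sl) auto
    also have "\<dots> = ennreal 1 * (ennreal (A ^ n) * T) + ennreal (A - 1) * (ennreal (A ^ n) * T)" by simp
    also have "\<dots> = ennreal (1 + (A - 1)) * (ennreal (A ^ n) * T)"
      using A by (subst ennreal_plus) (auto simp: distrib_right)
    also have "\<dots> = ennreal (A ^ Suc n) * T"
      using A by (simp add: mult.assoc[symmetric] ennreal_mult[symmetric])
    finally show ?case .
  qed
  have "(\<Sum>i\<in>(UNIV::'d set). r) = r * CARD('d)" by simp
  from low[OF this, of "\<lambda>_. 0"] show ?lower by (simp add: T_def)
  have upp: "wsum \<omega> s (c l) \<le> ennreal ((1 + 4 * c2) ^ n) * wsum \<omega> (\<lambda>i. s i + l i) (c (\<lambda>_. 0))"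
    if "(\<Sum>i\<in>UNIV. l i) = n" "\<And>i. l i \<le> r" for n s l
    using that
  proof (induction n arbitrary: s l)
    case 0
    then have "l = (\<lambda>_. 0)" by auto
    then show ?case by simp
  next
    case (Suc n)
    obtain j l' where l: "l = shift j 1 l'" and n: "(\<Sum>i\<in>UNIV. l' i) = n" using dec[of l] Suc.prems by auto
    have lr: "l' i \<le> r" for i using Suc.prems(2)[of i] by (auto simp: l shift_apply split: if_splits)
    have "wsum \<omega> s (c l) \<le> ennreal (4 * c2) * wsum \<omega> (shift j 1 s) (c l')"
      using band_upper[of s j "c l'"] rec[of j l'] Suc.prems(2) by (simp add: l)
    also have "\<dots> \<le> ennreal (1 + 4 * c2) * (ennreal ((1 + 4 * c2) ^ n) * wsum \<omega> (\<lambda>i. shift j 1 s i + l' i) (c (\<lambda>_. 0)))"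
      by (intro mult_mono Suc.IH n lr ennreal_leI) auto
    also have "(\<lambda>i. shift j 1 s i + l' i) = (\<lambda>i. s i + l i)" by (auto simp: l shift_apply)
    also have "ennreal (1 + 4 * c2) * (ennreal ((1 + 4 * c2) ^ n) * wsum \<omega> (\<lambda>i. s i + l i) (c (\<lambda>_. 0))) =
        ennreal ((1 + 4 * c2) ^ Suc n) * wsum \<omega> (\<lambda>i. s i + l i) (c (\<lambda>_. 0))"
      using c2 by (simp add: mult.assoc[symmetric] ennreal_mult[symmetric] del: ennreal_plus)
    finally show ?case .
  qed
  have "wsum \<omega> (\<lambda>_. 0) (c l) \<le> ennreal ((1 + 4 * c2) ^ (r * CARD('d))) * wsum \<omega> (\<lambda>_. r) (c (\<lambda>_. 0))" if l: "l \<in> ?L" for l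
  proof -
    have "(\<Sum>i\<in>UNIV. l i) \<le> (\<Sum>i\<in>(UNIV::'d set). r)" using l by (intro sum_mono) auto
    then have "(1 + 4 * c2) ^ (\<Sum>i\<in>UNIV. l i) \<le> (1 + 4 * c2) ^ (r * CARD('d))"
      using c2 by (intro power_increasing) (auto simp: mult.commute)
    moreover have "wsum \<omega> (\<lambda>_. 0) (c l) \<le> ennreal ((1 + 4 * c2) ^ (\<Sum>i\<in>UNIV. l i)) * wsum \<omega> l (c (\<lambda>_. 0))"
      using upp[OF refl, of l "\<lambda>_. 0"] l by simp
    moreover have "wsum \<omega> l (c (\<lambda>_. 0)) \<le> wsum \<omega> (\<lambda>_. r) (c (\<lambda>_. 0))" using l by (intro wsum_mono) auto
    ultimately show ?thesis by (meson ennreal_leI mult_mono order_trans zero_le)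
  qed
  then have "T \<le> (\<Sum>l\<in>?L. ennreal ((1 + 4 * c2) ^ (r * CARD('d))) * wsum \<omega> (\<lambda>_. r) (c (\<lambda>_. 0)))"
    unfolding T_def by (rule sum_mono)
  also have "\<dots> = of_nat (card ?L) * (ennreal ((1 + 4 * c2) ^ (r * CARD('d))) * wsum \<omega> (\<lambda>_. r) (c (\<lambda>_. 0)))"
    by simp
  also have "of_nat (card ?L) = ennreal ((r + 1) ^ CARD('d))"
    unfolding card by (simp add: ennreal_of_nat_eq_real_of_nat)
  finally show ?upper
    using c2 by (simp add: add.commute[of 1 "real r"] T_def mult.assoc[symmetric] ennreal_mult[symmetric] del: ennreal_plus)
qed

end

subsection \<open>Tensor products and test functions\<close>

definition tensor :: "('d::finite \<Rightarrow> real \<Rightarrow> real) \<Rightarrow> real ^ 'd \<Rightarrow> real" where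
  "tensor u x = (\<Prod>i\<in>UNIV. u i (x $ i))"

lemma tensor_mult: "tensor u x * tensor v x = tensor (\<lambda>i y. u i y * v i y) x"
  by (simp add: tensor_def prod.distrib)

lemma measurable_tensor [measurable (raw)]:
  assumes "\<And>i. u i \<in> borel_measurable borel"
  shows "tensor u \<in> borel_measurable borel"
proof -
  have [measurable]: "u i \<in> borel_measurable borel" for i by fact
  show ?thesis unfolding tensor_def by measurable
qed

lemma tensor_fun_upd: "tensor (u(j := v)) x = v (x $ j) * (\<Prod>i\<in>UNIV - {j}. u i (x $ i))"
proof -
  have "tensor (u(j := v)) x = (u(j := v)) j (x $ j) * (\<Prod>i\<in>UNIV - {j}. (u(j := v)) i (x $ i))"
    unfolding tensor_def by (intro prod.remove) auto
  also have "(\<Prod>i\<in>UNIV - {j}. (u(j := v)) i (x $ i)) = (\<Prod>i\<in>UNIV - {j}. u i (x $ i))"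
    by (intro prod.cong) auto
  finally show ?thesis by (simp only: fun_upd_same)
qed

lemma tensor_integral:
  fixes u :: "'d::finite \<Rightarrow> real \<Rightarrow> real"
  assumes int: "\<And>i. integrable lborel (u i)"
  shows "integrable lborel (tensor u)" and "integral\<^sup>L lborel (tensor u) = (\<Prod>i\<in>UNIV. integral\<^sup>L lborel (u i))"
proof -
  interpret product_sigma_finite "\<lambda>_::real^'d. lborel :: real measure" ..
  \<comment> \<open>\<open>lborel\<close> on vectors is available as a product over
    \<open>Basis\<close>; \<open>idx\<close> recovers the coordinate of a basis vector, so that the
    factors can be reindexed.\<close>
  define idx where "idx b = (THE i::'d. b = axis i (1::real))" for b
  have idx [simp]: "idx (axis i 1) = i" for i by (auto simp: idx_def axis_eq_axis)
  have bij: "bij_betw (\<lambda>i. axis i (1::real)) (UNIV :: 'd set) Basis"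
    by (auto simp: bij_betw_def inj_on_def axis_eq_axis Basis_vec_def)
  let ?S = "\<lambda>f. \<Sum>b\<in>Basis. f b *\<^sub>R b :: real ^ 'd"
  have comp: "?S f $ i = f (axis i 1)" for f i
  proof -
    have "?S f $ i = ?S f \<bullet> axis i 1" by (simp add: cart_eq_inner_axis)
    also have "\<dots> = f (axis i 1)" by (simp add: inner_sum_left_Basis)
    finally show ?thesis .
  qed
  have T: "tensor u (?S f) = (\<Prod>b\<in>Basis. u (idx b) (f b))" for f
    unfolding tensor_def comp by (subst prod.reindex_bij_betw[OF bij, symmetric]) simp
  have m [measurable]: "u i \<in> borel_measurable borel" for i using int[of i] by auto
  have mS: "?S \<in> measurable (\<Pi>\<^sub>M b\<in>Basis. lborel) borel"
    by measurable
  have lb: "(lborel :: (real ^ 'd) measure) = distr (\<Pi>\<^sub>M b\<in>Basis. lborel) borel ?S" by (rule lborel_eq)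
  have "integrable (\<Pi>\<^sub>M b\<in>Basis. lborel) (\<lambda>f. \<Prod>b\<in>Basis. u (idx b) (f (b::real^'d)))"
    by (intro product_integrable_prod int) auto
  then show "integrable lborel (tensor u)"
    by (subst lb, subst integrable_distr_eq[OF mS]) (auto simp: T)
  have "integral\<^sup>L lborel (tensor u) = (\<integral>f. (\<Prod>b\<in>Basis. u (idx b) (f (b::real^'d))) \<partial>(\<Pi>\<^sub>M b\<in>Basis. lborel))"
    by (subst lb, subst integral_distr[OF mS]) (auto simp: T)
  also have "\<dots> = (\<Prod>b\<in>Basis. integral\<^sup>L lborel (u (idx (b::real^'d))))"
    by (intro product_integral_prod int) auto
  also have "\<dots> = (\<Prod>i\<in>UNIV. integral\<^sup>L lborel (u i))"
    by (subst prod.reindex_bij_betw[OF bij, symmetric]) simp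
  finally show "integral\<^sup>L lborel (tensor u) = (\<Prod>i\<in>UNIV. integral\<^sup>L lborel (u i))" .
qed

lemma enn2real_inject_finite: "x \<noteq> \<infinity> \<Longrightarrow> y \<noteq> \<infinity> \<Longrightarrow> enn2real x = enn2real y \<Longrightarrow> x = y"
  by (cases x; cases y) auto

text \<open>The positive and the negative part of \<open>h\<close> are densities of two measures
  that agree and are finite on open boxes. Boxes generate the Borel sets and are stable under
  intersection, so the measures coincide, and with them the densities almost everywhere.\<close>

lemma AE_zero_if_box_integrals_zero:
  fixes h :: "'a::euclidean_space \<Rightarrow> real"
  assumes h [measurable]: "h \<in> borel_measurable borel"
    and int: "\<And>a b. integrable lborel (\<lambda>x. indicator (box a b) x * h x)"
    and zero: "\<And>a b. (\<integral>x. indicator (box a b) x * h x \<partial>lborel) = 0"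
  shows "AE x in lborel. h x = 0"
proof -
  let ?P = "\<lambda>x. ennreal (h x)" and ?N = "\<lambda>x. ennreal (- h x)"
  have eq: "emeasure (density lborel ?P) (box a b) = emeasure (density lborel ?N) (box a b) \<and>
      emeasure (density lborel ?P) (box a b) \<noteq> \<infinity>" for a b
  proof -
    let ?g = "\<lambda>x. indicator (box a b) x * h x"
    have fin: "(\<integral>\<^sup>+x. ennreal (?g x) \<partial>lborel) \<noteq> \<infinity>" "(\<integral>\<^sup>+x. ennreal (- ?g x) \<partial>lborel) \<noteq> \<infinity>"
      using int[of a b] by (auto simp: real_integrable_def)
    have "enn2real (\<integral>\<^sup>+x. ennreal (?g x) \<partial>lborel) = enn2real (\<integral>\<^sup>+x. ennreal (- ?g x) \<partial>lborel)"
      using zero[of a b] real_lebesgue_integral_def[OF int[of a b]] by simp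
    then have 1: "(\<integral>\<^sup>+x. ennreal (?g x) \<partial>lborel) = (\<integral>\<^sup>+x. ennreal (- ?g x) \<partial>lborel)"
      by (rule enn2real_inject_finite[OF fin])
    have "emeasure (density lborel ?P) (box a b) = (\<integral>\<^sup>+x. ennreal (?g x) \<partial>lborel)"
      "emeasure (density lborel ?N) (box a b) = (\<integral>\<^sup>+x. ennreal (- ?g x) \<partial>lborel)"
      by (auto simp: emeasure_density split: split_indicator intro!: nn_integral_cong)
    with 1 fin show ?thesis by simp
  qed
  have "emeasure (density lborel ?N) (box a b) \<noteq> \<infinity>" for a b
    using eq[of a b] by metis
  note fin = this
  have "density lborel ?P = density lborel ?N"
  proof (rule measure_eqI_generator_eq[where A = "\<lambda>n. box (- real n *\<^sub>R One) (real n *\<^sub>R One)"])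
    let ?E = "range (\<lambda>(a, b). box a b :: 'a set)"
    show "Int_stable ?E" by (auto simp: Int_stable_def box_Int_box)
    show "sets (density lborel ?P) = sigma_sets UNIV ?E" "sets (density lborel ?N) = sigma_sets UNIV ?E"
      by (simp_all add: borel_eq_box)
    show "(\<Union>n. box (- real n *\<^sub>R One) (real n *\<^sub>R One)) = (UNIV :: 'a set)"
      unfolding UN_box_eq_UNIV[symmetric] by simp
  qed (use eq fin in auto)
  then have "AE x in lborel. ?P x = ?N x"
    by (intro sigma_finite_measure.density_unique) (auto intro: sigma_finite_lborel)
  then show ?thesis
  proof eventually_elim
    case (elim x)
    then show "h x = 0" by (cases "0 \<le> h x") (auto simp: ennreal_neg)
  qed
qed

section \<open>Smooth functions of one variable, their products, and bump functions\<close>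

definition smooth1 :: "(real \<Rightarrow> real) \<Rightarrow> bool" where
  "smooth1 u \<longleftrightarrow> (\<forall>n x. ((deriv ^^ n) u has_real_derivative (deriv ^^ Suc n) u x) (at x))"

lemma smooth1D: "smooth1 u \<Longrightarrow> ((deriv ^^ n) u has_real_derivative (deriv ^^ Suc n) u x) (at x)"
  by (auto simp: smooth1_def)

lemma smooth1_measurable: "smooth1 u \<Longrightarrow> (deriv ^^ n) u \<in> borel_measurable borel"
  by (intro borel_measurable_continuous_onI DERIV_continuous_on) (auto intro: has_field_derivative_at_within smooth1D)

text \<open>A family closed under differentiation contains all iterated derivatives of its members.
  This spares formulas for the higher derivatives of bumps.\<close>

lemma smooth1_coinduct:
  assumes "u \<in> F" and F: "\<And>v. v \<in> F \<Longrightarrow> \<exists>v'\<in>F. \<forall>x. (v has_real_derivative v' x) (at x)"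
  shows "smooth1 u"
proof -
  have F': "deriv v \<in> F \<and> (\<forall>x. (v has_real_derivative deriv v x) (at x))" if v: "v \<in> F" for v
  proof -
    obtain v' where v': "v' \<in> F" "\<And>x. (v has_real_derivative v' x) (at x)" using F[OF v] by blast
    then have "deriv v = v'" by (auto intro: DERIV_imp_deriv)
    then show ?thesis using v' by simp
  qed
  have "(deriv ^^ n) u \<in> F" for n using assms(1) by (induction n) (auto simp: F')
  then show ?thesis unfolding smooth1_def using F' by simp
qed

lemma tensor_has_derivative:
  fixes u :: "'d::finite \<Rightarrow> real \<Rightarrow> real"
  assumes "\<And>i. (u i has_real_derivative u' i) (at (x $ i))"
  shows "(tensor u has_derivative (\<lambda>h. \<Sum>i\<in>UNIV. (u' i * h $ i) * (\<Prod>l\<in>UNIV - {i}. u l (x $ l)))) (at x)"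
proof -
  have "((\<lambda>y. u i (y $ i)) has_derivative (\<lambda>h. u' i * h $ i)) (at x)" for i
  proof -
    have "(u i has_derivative (\<lambda>h. u' i * h)) (at (x $ i))"
      using assms[of i] by (simp add: has_field_derivative_def)
    moreover have "((\<lambda>y. y $ i) has_derivative (\<lambda>h. h $ i)) (at x)"
      by (rule bounded_linear_imp_has_derivative) (rule bounded_linear_vec_nth)
    ultimately show ?thesis
      using has_derivative_compose[of "\<lambda>y. y $ i" "\<lambda>h. h $ i" x UNIV "u i" "\<lambda>h. u' i * h"] by simp
  qed
  then show ?thesis unfolding tensor_def[abs_def] by (intro has_derivative_prod)
qed

lemma partial_deriv_tensor:
  fixes u :: "'d::finite \<Rightarrow> real \<Rightarrow> real"
  assumes "\<And>i x. (u i has_real_derivative u' i x) (at x)"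
  shows "tensor u differentiable (at x)" and "partial_deriv j (tensor u) = tensor (u(j := u' j))"
proof -
  have d: "(tensor u has_derivative (\<lambda>h. \<Sum>i\<in>UNIV. (u' i (x $ i) * h $ i) * (\<Prod>l\<in>UNIV - {i}. u l (x $ l)))) (at x)" for x
    using assms by (intro tensor_has_derivative)
  show "tensor u differentiable (at x)" using d unfolding differentiable_def by blast
  show "partial_deriv j (tensor u) = tensor (u(j := u' j))"
  proof
    fix x :: "real ^ 'd"
    have "partial_deriv j (tensor u) x = (\<Sum>i\<in>UNIV. (u' i (x $ i) * axis j 1 $ i) * (\<Prod>l\<in>UNIV - {i}. u l (x $ l)))"
      unfolding partial_deriv_def frechet_derivative_at[OF d, symmetric] by (rule refl)
    also have "\<dots> = (\<Sum>i\<in>UNIV. if i = j then u' j (x $ j) * (\<Prod>l\<in>UNIV - {j}. u l (x $ l)) else 0)"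
      by (intro sum.cong) (auto simp: axis_def)
    also have "\<dots> = tensor (u(j := u' j)) x" by (simp add: tensor_fun_upd)
    finally show "partial_deriv j (tensor u) x = tensor (u(j := u' j)) x" .
  qed
qed

text \<open>Each partial derivative acts on a single factor, so of \<open>js\<close> only the number
  of occurrences of each direction survives, whichever list \<open>multi_deriv\<close>
  picks.\<close>

lemma partials_tensor:
  assumes "\<And>i. smooth1 (u i)"
  shows "partials js (tensor u) = tensor (\<lambda>i. (deriv ^^ count_list js i) (u i))"
proof (induction js)
  case Nil
  show ?case by (simp add: partials_def)
next
  case (Cons j js)
  have "partials (j # js) (tensor u) = partial_deriv j (tensor (\<lambda>i. (deriv ^^ count_list js i) (u i)))"
    using Cons by (simp add: partials_def)
  also have "\<dots> = tensor ((\<lambda>i. (deriv ^^ count_list js i) (u i))(j := (deriv ^^ Suc (count_list js j)) (u j)))"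
    using assms by (intro partial_deriv_tensor(2)[where u' = "\<lambda>i. (deriv ^^ Suc (count_list js i)) (u i)"] smooth1D)
  also have "(\<lambda>i. (deriv ^^ count_list js i) (u i))(j := (deriv ^^ Suc (count_list js j)) (u j)) =
     (\<lambda>i. (deriv ^^ count_list (j # js) i) (u i))" by auto
  finally show ?case .
qed

lemma ex_count_list:
  fixes k :: "'d::finite \<Rightarrow> nat"
  shows "\<exists>js. \<forall>j. count_list js j = k j"
proof -
  obtain xs :: "'d list" where xs: "set xs = UNIV" "distinct xs" using finite_distinct_list[OF finite] by blast
  have "count_list (concat (map (\<lambda>i. replicate (k i) i) ys)) j = (if j \<in> set ys then k j else 0)" if "distinct ys" for ys j
    using that
  proof (induction ys)
    case (Cons y ys)
    have "count_list (replicate n y) j = (if j = y then n else 0)" for n by (induction n) auto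
    then show ?case using Cons by auto
  qed simp
  then show ?thesis using xs by (metis UNIV_I)
qed

lemma count_list_SOME:
  fixes k :: "'d::finite \<Rightarrow> nat"
  shows "count_list (SOME js. \<forall>j. count_list js j = k j) j = k j"
  using someI_ex[OF ex_count_list[of k]] by blast

lemma multi_deriv_tensor:
  assumes "\<And>i. smooth1 (u i)"
  shows "multi_deriv k (tensor u) = tensor (\<lambda>i. (deriv ^^ k i) (u i))"
  unfolding multi_deriv_def by (simp add: partials_tensor assms count_list_SOME)

lemma test_function_tensor:
  fixes u :: "'d::finite \<Rightarrow> real \<Rightarrow> real" and lo hi :: "real ^ 'd"
  assumes s: "\<And>i. smooth1 (u i)" and supp: "\<And>i x. u i x \<noteq> 0 \<Longrightarrow> lo $ i \<le> x \<and> x \<le> hi $ i"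
  shows "test_function (tensor u)"
proof -
  have "smooth (tensor u)"
    unfolding smooth_def partials_tensor[of u, OF s]
    using smooth1D[OF s] by (auto intro!: partial_deriv_tensor(1)[where u' = "\<lambda>i. (deriv ^^ Suc (count_list _ i)) (u i)"])
  moreover have "{x. tensor u x \<noteq> 0} \<subseteq> cbox lo hi"
    using supp by (auto simp: tensor_def mem_box_cart)
  then have "bounded {x. tensor u x \<noteq> 0}" using bounded_cbox bounded_subset by blast
  then have "compact (closure {x. tensor u x \<noteq> 0})" by (simp add: compact_closure)
  ultimately show ?thesis by (simp add: test_function_def)
qed

text \<open>With \<open>Q = (x - lo) * (hi - x)\<close> this is
  \<open>p * Q^(-m) * exp (- c / Q + S)\<close> on the interval. The free \<open>p\<close> and
  \<open>m\<close> make the family closed under differentiation, \<open>S\<close> accommodates the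
  factor \<open>W\<close>, and small \<open>c\<close> makes \<open>exp (- c / Q)\<close> close to 1
  inside.\<close>

definition bump :: "real poly \<Rightarrow> real \<Rightarrow> real \<Rightarrow> real \<Rightarrow> real poly \<Rightarrow> nat \<Rightarrow> real \<Rightarrow> real" where
  "bump S lo hi c p m x = (if lo < x \<and> x < hi
     then poly p x * (1 / ((x - lo) * (hi - x))) ^ m * exp (- c / ((x - lo) * (hi - x)) + poly S x) else 0)"

text \<open>\<open>exp (- c / Q)\<close> beats every power of \<open>1 / Q\<close>. Keeping two
  powers in reserve gives a bound by \<open>Q^2\<close>, which forces the derivative 0 at both end
  points.\<close>

lemma bump_quadratic_bound:
  assumes c: "c > 0"
  shows "\<exists>C. \<forall>x. \<bar>bump S lo hi c p m x\<bar> \<le> C * ((x - lo) * (hi - x))\<^sup>2"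
proof -
  have "continuous_on {lo..hi} (\<lambda>x. poly p x * exp (poly S x))" by (intro continuous_intros)
  then have "bounded ((\<lambda>x. poly p x * exp (poly S x)) ` {lo..hi})"
    by (intro compact_imp_bounded compact_continuous_image compact_Icc)
  then obtain B where "\<forall>x\<in>{lo..hi}. \<bar>poly p x * exp (poly S x)\<bar> \<le> B"
    unfolding bounded_iff by auto
  then have B: "\<bar>poly p x * exp (poly S x)\<bar> \<le> B" if "x \<in> {lo..hi}" for x using that by blast
  define C where "C = B * (fact (m + 2) / c ^ (m + 2))"
  have "\<bar>bump S lo hi c p m x\<bar> \<le> C * ((x - lo) * (hi - x))\<^sup>2" if x: "lo < x" "x < hi" for x
  proof -
    define Q where "Q = (x - lo) * (hi - x)"
    have Q: "Q > 0" using x by (simp add: Q_def)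
    have "(1 / Q) ^ (m + 2) \<le> fact (m + 2) / c ^ (m + 2) * exp (c * (1 / Q))"
      using c Q by (intro power_le_exp_real) auto
    then have E: "(1 / Q) ^ m * exp (- c / Q) \<le> fact (m + 2) / c ^ (m + 2) * Q\<^sup>2"
      using Q by (simp add: exp_minus field_simps power2_eq_square)
    have "\<bar>poly p x * exp (poly S x)\<bar> * ((1 / Q) ^ m * exp (- c / Q)) \<le> B * (fact (m + 2) / c ^ (m + 2) * Q\<^sup>2)"
      by (rule mult_mono[OF B E]) (use B[of x] x Q in \<open>auto intro: order.trans[OF abs_ge_zero]\<close>)
    moreover have "\<bar>bump S lo hi c p m x\<bar> = \<bar>poly p x * exp (poly S x)\<bar> * ((1 / Q) ^ m * exp (- c / Q))"
    proof -
      have "exp (- c / Q + poly S x) = exp (poly S x) * exp (- c / Q)" by (simp only: exp_add mult.commute)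
      then show ?thesis using x Q unfolding bump_def Q_def[symmetric] by (simp add: abs_mult)
    qed
    ultimately show ?thesis by (simp add: C_def Q_def mult_ac)
  qed
  moreover have "\<bar>bump S lo hi c p m x\<bar> \<le> \<bar>C\<bar> * ((x - lo) * (hi - x))\<^sup>2" if "\<not> (lo < x \<and> x < hi)" for x
    unfolding bump_def if_not_P[OF that] by simp
  ultimately have "\<bar>bump S lo hi c p m x\<bar> \<le> \<bar>C\<bar> * ((x - lo) * (hi - x))\<^sup>2" for x
    by (smt (verit) mult_right_mono zero_le_power2)
  then show ?thesis by blast
qed

lemma DERIV_zero_if_quadratic:
  fixes f :: "real \<Rightarrow> real"
  assumes "\<And>x. \<bar>f x\<bar> \<le> g x * (x - x0)\<^sup>2" "isCont g x0"
  shows "(f has_real_derivative 0) (at x0)"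
proof -
  have f0: "f x0 = 0" using assms(1)[of x0] by simp
  have "((\<lambda>x. (f x - f x0) / (x - x0)) \<longlongrightarrow> 0) (at x0)"
  proof (rule Lim_null_comparison)
    show "\<forall>\<^sub>F x in at x0. norm ((f x - f x0) / (x - x0)) \<le> g x * \<bar>x - x0\<bar>"
    proof (intro eventually_at_filter[THEN iffD2] always_eventually allI impI)
      fix x assume "x \<noteq> x0"
      then show "norm ((f x - f x0) / (x - x0)) \<le> g x * \<bar>x - x0\<bar>"
        using assms(1)[of x] by (simp add: f0 abs_divide pos_divide_le_eq power2_eq_square mult.assoc)
    qed
    have "((\<lambda>x. g x * \<bar>x - x0\<bar>) \<longlongrightarrow> g x0 * \<bar>x0 - x0\<bar>) (at x0)"
      using assms(2) by (intro tendsto_intros) (simp add: isCont_def)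
    then show "((\<lambda>x. g x * \<bar>x - x0\<bar>) \<longlongrightarrow> 0) (at x0)" by simp
  qed
  then show ?thesis by (simp add: has_field_derivative_iff)
qed

text \<open>Numerator of the derivative over \<open>Q ^ (m + 2)\<close>. The three terms come from
  \<open>p * exp S\<close>, from \<open>Q^(-m)\<close> and from
  \<open>exp (- c / Q)\<close>.\<close>

definition bump_deriv :: "real poly \<Rightarrow> real \<Rightarrow> real \<Rightarrow> real \<Rightarrow> real poly \<Rightarrow> nat \<Rightarrow> real poly" where
  "bump_deriv S lo hi c p m =
     (let Q = [:- lo, 1:] * [:hi, - 1:]; Q' = [:lo + hi, - 2:]
      in (pderiv p + p * pderiv S) * Q\<^sup>2 - smult (real m) (p * Q' * Q) + smult c (p * Q'))"

lemma bump_has_derivative: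
  assumes c: "c > 0"
  shows "(bump S lo hi c p m has_real_derivative bump S lo hi c (bump_deriv S lo hi c p m) (m + 2) x) (at x)"
proof (cases "lo < x \<and> x < hi")
  case True
  let ?f = "\<lambda>x. poly p x * (1 / ((x - lo) * (hi - x))) ^ m * exp (- c / ((x - lo) * (hi - x)) + poly S x)"
  define Q Q' where "Q = (x - lo) * (hi - x)" and "Q' = lo + hi - 2 * x"
  have Q: "Q > 0" using True by (simp add: Q_def)
  define E where "E = exp (- c / Q + poly S x)"
  have dQ: "((\<lambda>x. (x - lo) * (hi - x)) has_real_derivative Q') (at x)"
    by (auto intro!: derivative_eq_intros simp: Q'_def algebra_simps)
  have dy: "((\<lambda>x. 1 / ((x - lo) * (hi - x))) has_real_derivative - Q' * (1 / Q)\<^sup>2) (at x)"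
    using Q by (auto intro!: derivative_eq_intros simp: Q_def[symmetric] power2_eq_square Q'_def minus_divide_left)
  have dE: "((\<lambda>x. exp (- c / ((x - lo) * (hi - x)) + poly S x)) has_real_derivative
      E * (c * Q' * (1 / Q)\<^sup>2 + poly (pderiv S) x)) (at x)"
  proof -
    have "((\<lambda>x. exp (- c * (1 / ((x - lo) * (hi - x))) + poly S x)) has_real_derivative
        exp (- c * (1 / ((x - lo) * (hi - x))) + poly S x) * (- c * (- Q' * (1 / Q)\<^sup>2) + poly (pderiv S) x)) (at x)"
      by (intro DERIV_fun_exp DERIV_add DERIV_cmult dy poly_DERIV)
    moreover have "- c * (- Q' * (1 / Q)\<^sup>2) = c * Q' * (1 / Q)\<^sup>2" by simp
    moreover have "- c * (1 / z) = - c / z" for z by simp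
    ultimately show ?thesis by (simp only: E_def Q_def)
  qed
  have "(?f has_real_derivative
      (poly (pderiv p) x * (1 / Q) ^ m + real m * (- Q' * (1 / Q)\<^sup>2 * (1 / Q) ^ (m - Suc 0)) * poly p x) * E
       + E * (c * Q' * (1 / Q)\<^sup>2 + poly (pderiv S) x) * (poly p x * (1 / Q) ^ m)) (at x)"
    unfolding E_def Q_def
    by (rule DERIV_mult[OF DERIV_mult[OF poly_DERIV DERIV_power[OF dy[unfolded Q_def]]] dE[unfolded E_def Q_def]])
  moreover have "(poly (pderiv p) x * (1 / Q) ^ m + real m * (- Q' * (1 / Q)\<^sup>2 * (1 / Q) ^ (m - Suc 0)) * poly p x) * E
       + E * (c * Q' * (1 / Q)\<^sup>2 + poly (pderiv S) x) * (poly p x * (1 / Q) ^ m) =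
      bump S lo hi c (bump_deriv S lo hi c p m) (m + 2) x"
  proof -
    have b: "bump S lo hi c (bump_deriv S lo hi c p m) (m + 2) x =
       ((poly (pderiv p) x + poly p x * poly (pderiv S) x) * Q\<^sup>2 - real m * (poly p x * Q' * Q) + c * (poly p x * Q'))
         * (1 / Q) ^ (m + 2) * E"
    proof -
      have "poly ([:- lo, 1:] * [:hi, - 1:]) x = Q" "poly [:lo + hi, - 2:] x = Q'"
        by (simp_all add: Q_def Q'_def algebra_simps)
      then have "poly (bump_deriv S lo hi c p m) x =
          ((poly (pderiv p) x + poly p x * poly (pderiv S) x) * Q\<^sup>2 - real m * (poly p x * Q' * Q) + c * (poly p x * Q'))"
        unfolding bump_deriv_def Let_def poly_add poly_diff poly_smult poly_mult[of _ "[:lo + hi, - 2:]"]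
        by (simp only: poly_mult poly_add poly_power)
      then show ?thesis using True by (simp add: bump_def Q_def[symmetric] E_def)
    qed
    define y where "y = 1 / Q"
    have yQ: "y * Q = 1" using Q by (simp add: y_def)
    \<comment> \<open>The power rule produces the truncated exponent \<open>m - 1\<close>; for
      \<open>m = 0\<close> the factor \<open>real m\<close> makes both sides vanish.\<close>
    have 1: "real m * (y\<^sup>2 * y ^ (m - Suc 0)) = real m * (Q * y ^ (m + 2))"
    proof (cases m)
      case (Suc n)
      have "Q * y ^ (m + 2) = (y * Q) * (y\<^sup>2 * y ^ n)" by (simp add: Suc power2_eq_square mult_ac)
      then have e: "Q * y ^ (m + 2) = y\<^sup>2 * y ^ n" unfolding yQ by simp
      show ?thesis unfolding e by (simp add: Suc)
    qed simp
    have 2: "y ^ m = Q\<^sup>2 * y ^ (m + 2)"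
    proof -
      have "Q\<^sup>2 * y ^ (m + 2) = (y * Q)\<^sup>2 * y ^ m" by (simp add: power2_eq_square mult_ac)
      then show ?thesis by (simp add: yQ)
    qed
    have 3: "y\<^sup>2 * y ^ m = y ^ (m + 2)" by (simp add: power2_eq_square mult_ac)
    have "(a0 * Y + N * (- Q' * y2 * z) * p0) * E + E * (c * Q' * y2 + s0) * (p0 * Y) =
        ((a0 + p0 * s0) * Q\<^sup>2 - N * (p0 * Q' * Q) + c * (p0 * Q')) * k * E"
      if "N * (y2 * z) = N * (Q * k)" "Y = Q\<^sup>2 * k" "y2 * Y = k" for a0 p0 s0 Y N y2 z k :: real
      using that by algebra
    from this[OF 1 2 3] show ?thesis unfolding b y_def[symmetric] .
  qed
  ultimately have "(?f has_real_derivative bump S lo hi c (bump_deriv S lo hi c p m) (m + 2) x) (at x)" by simp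
  then show ?thesis
    by (rule has_field_derivative_transform_within_open[where S = "{lo<..<hi}"]) (use True in \<open>auto simp: bump_def\<close>)
next
  case False
  then have 0: "bump S lo hi c (bump_deriv S lo hi c p m) (m + 2) x = 0" unfolding bump_def by (rule if_not_P)
  obtain C where C: "\<And>y. \<bar>bump S lo hi c p m y\<bar> \<le> C * ((y - lo) * (hi - y))\<^sup>2"
    using bump_quadratic_bound[OF c] by blast
  consider "x = lo" | "x = hi" | "x < lo" | "x > hi" using False by linarith
  then have "(bump S lo hi c p m has_real_derivative 0) (at x)"
  proof cases
    case 1
    then show ?thesis using C
      by (intro DERIV_zero_if_quadratic[where g = "\<lambda>y. C * (hi - y)\<^sup>2"]) (auto simp: power_mult_distrib mult_ac)
  next
    case 2
    then show ?thesis using C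
      by (intro DERIV_zero_if_quadratic[where g = "\<lambda>y. C * (y - lo)\<^sup>2"])
         (auto simp: power_mult_distrib mult_ac power2_commute[of _ hi])
  next
    case 3
    show ?thesis
      by (rule has_field_derivative_transform_within_open[where f = "\<lambda>_. 0" and S = "{..<lo}"])
         (use 3 in \<open>auto simp: bump_def\<close>)
  next
    case 4
    show ?thesis
      by (rule has_field_derivative_transform_within_open[where f = "\<lambda>_. 0" and S = "{hi<..}"])
         (use 4 in \<open>auto simp: bump_def\<close>)
  qed
  then show ?thesis unfolding 0 .
qed

lemma smooth1_bump: "c > 0 \<Longrightarrow> smooth1 (bump S lo hi c p m)"
  by (rule smooth1_coinduct[where F = "{v. \<exists>p m. v = bump S lo hi c p m}"]) (auto intro: bump_has_derivative)

lemma deriv_bump: "c > 0 \<Longrightarrow> deriv (bump S lo hi c p m) = bump S lo hi c (bump_deriv S lo hi c p m) (m + 2)"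
  by (intro ext DERIV_imp_deriv bump_has_derivative)

lemma bump_support: "bump S lo hi c p m x \<noteq> 0 \<Longrightarrow> lo \<le> x \<and> x \<le> hi"
  by (auto simp: bump_def split: if_splits)

lemma borel_measurable_bump [measurable]: "bump S lo hi c p m \<in> borel_measurable borel"
  unfolding bump_def[abs_def] by measurable

section \<open>The fundamental lemma of the calculus of variations and uniqueness of weak
  derivatives\<close>

lemma abs_prod_le_1:
  fixes f :: "'i \<Rightarrow> real"
  assumes "\<And>i. i \<in> A \<Longrightarrow> \<bar>f i\<bar> \<le> 1"
  shows "\<bar>prod f A\<bar> \<le> 1"
  unfolding abs_prod using assms by (intro prod_le_1) auto

text \<open>Bumps on a box tend boundedly to its indicator, so all box integrals of \<open>g\<close>
  vanish. Product test functions suffice because boxes are products.\<close>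

lemma AE_zero_if_test_integrals_zero:
  fixes g :: "real ^ 'd::finite \<Rightarrow> real"
  assumes [measurable]: "g \<in> borel_measurable borel" and loc: "locally_integrable g"
    and zero: "\<And>u. (\<And>i. smooth1 (u i)) \<Longrightarrow> test_function (tensor u) \<Longrightarrow> (\<integral>x. g x * tensor u x \<partial>lborel) = 0"
  shows "AE x in lborel. g x = 0"
proof (rule AE_zero_if_box_integrals_zero)
  show "g \<in> borel_measurable borel" by fact
  fix a b :: "real ^ 'd"
  have c: "integrable lborel (\<lambda>x. indicator (cbox a b) x * g x)"
    using loc by (simp add: locally_integrable_def set_integrable_def)
  show "integrable lborel (\<lambda>x. indicator (box a b) x * g x)"
    by (rule Bochner_Integration.integrable_bound[OF c])
      (auto split: split_indicator intro!: always_eventually dest: subsetD[OF box_subset_cbox])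
  \<comment> \<open>With numerator 1, \<open>m = 0\<close> and \<open>S = 0\<close> this is
    \<open>exp (- c / Q)\<close> with \<open>c = 1 / (n + 1)\<close>: bounded by 1 and convergent to
    1 inside the interval.\<close>
  define u where "u n i = bump 0 (a $ i) (b $ i) (1 / (real n + 1)) 1 0" for n :: nat and i
  have s: "smooth1 (u n i)" for n i unfolding u_def by (intro smooth1_bump) auto
  have sup: "u n i x \<noteq> 0 \<Longrightarrow> a $ i \<le> x \<and> x \<le> b $ i" for n i x
    unfolding u_def by (rule bump_support)
  have le1: "\<bar>u n i x\<bar> \<le> 1" for n i x
    by (auto simp: u_def bump_def)
  have z: "(\<integral>x. g x * tensor (u n) x \<partial>lborel) = 0" for n
    by (intro zero s test_function_tensor[where lo = a and hi = b] sup)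
  have "(\<lambda>n. \<integral>x. g x * tensor (u n) x \<partial>lborel) \<longlonglongrightarrow> (\<integral>x. indicator (box a b) x * g x \<partial>lborel)"
  proof (rule integral_dominated_convergence[where w = "\<lambda>x. \<bar>indicator (cbox a b) x * g x\<bar>"])
    have [measurable]: "u n i \<in> borel_measurable borel" for n i unfolding u_def by measurable
    show "(\<lambda>x. g x * tensor (u n) x) \<in> borel_measurable lborel" for n by measurable
    show "(\<lambda>x. indicator (box a b) x * g x) \<in> borel_measurable lborel" by measurable
    show "integrable lborel (\<lambda>x. \<bar>indicator (cbox a b) x * g x\<bar>)" using c by (rule integrable_abs)
    show "AE x in lborel. (\<lambda>n. g x * tensor (u n) x) \<longlonglongrightarrow> indicator (box a b) x * g x"
    proof (intro always_eventually allI)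
      fix x
      have "(\<lambda>n. tensor (u n) x) \<longlonglongrightarrow> indicator (box a b) x"
      proof (cases "x \<in> box a b")
        case True
        then have x: "a $ i < x $ i" "x $ i < b $ i" for i by (auto simp: mem_box_cart)
        have "(\<lambda>n. u n i (x $ i)) \<longlonglongrightarrow> 1" for i
        proof -
          define Q where "Q = (x $ i - a $ i) * (b $ i - x $ i)"
          have "Q \<noteq> 0" using x[of i] by (simp add: Q_def)
          moreover have "(\<lambda>n. 1 / (real n + 1)) \<longlonglongrightarrow> 0" by real_asymp
          ultimately have "(\<lambda>n. exp (- (1 / (real n + 1)) / Q)) \<longlonglongrightarrow> exp (- 0 / Q)"
            by (intro tendsto_exp tendsto_divide tendsto_minus tendsto_const)
          moreover have "u n i (x $ i) = exp (- (1 / (real n + 1)) / Q)" for n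
            using x[of i] by (simp add: u_def bump_def Q_def)
          ultimately show ?thesis by simp
        qed
        then have "(\<lambda>n. tensor (u n) x) \<longlonglongrightarrow> (\<Prod>i\<in>(UNIV::'d set). 1)"
          unfolding tensor_def by (intro tendsto_prod)
        then show ?thesis using True by simp
      next
        case False
        then obtain i where "\<not> (a $ i < x $ i \<and> x $ i < b $ i)" by (auto simp: mem_box_cart)
        then have "u n i (x $ i) = 0" for n unfolding u_def bump_def by (simp only: if_False)
        then have "tensor (u n) x = 0" for n unfolding tensor_def by (intro prod_zero) auto
        then show ?thesis using False by simp
      qed
      then have "(\<lambda>n. g x * tensor (u n) x) \<longlonglongrightarrow> g x * indicator (box a b) x"
        by (intro tendsto_mult tendsto_const)
      then show "(\<lambda>n. g x * tensor (u n) x) \<longlonglongrightarrow> indicator (box a b) x * g x"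
        by (simp only: mult.commute)
    qed
    show "AE x in lborel. norm (g x * tensor (u n) x) \<le> \<bar>indicator (cbox a b) x * g x\<bar>" for n
    proof (intro always_eventually allI)
      fix x
      have "\<bar>tensor (u n) x\<bar> \<le> 1" unfolding tensor_def by (intro abs_prod_le_1 le1)
      moreover have "tensor (u n) x = 0" if "x \<notin> cbox a b"
        using that sup unfolding tensor_def by (force simp: mem_box_cart)
      ultimately show "norm (g x * tensor (u n) x) \<le> \<bar>indicator (cbox a b) x * g x\<bar>"
        by (cases "x \<in> cbox a b") (auto simp: abs_mult mult_left_le)
    qed
  qed
  then show "(\<integral>x. indicator (box a b) x * g x \<partial>lborel) = 0"
    unfolding z by (simp add: LIMSEQ_const_iff)
qed

lemma locally_integrable_diff:
  "locally_integrable f \<Longrightarrow> locally_integrable g \<Longrightarrow> locally_integrable (\<lambda>x. f x - g x)"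
  by (auto simp: locally_integrable_def)

lemma continuous_partials:
  assumes "smooth \<phi>"
  shows "continuous_on UNIV (partials js \<phi>)"
  using assms unfolding smooth_def
  by (intro differentiable_imp_continuous_on) (auto simp: differentiable_on_def)

lemma locally_integrable_mult:
  fixes f \<phi> :: "'a::euclidean_space \<Rightarrow> real"
  assumes f: "locally_integrable f" "f \<in> borel_measurable borel" and c: "continuous_on UNIV \<phi>"
    and K: "compact K" "\<And>x. x \<notin> K \<Longrightarrow> \<phi> x = 0"
  shows "integrable lborel (\<lambda>x. f x * \<phi> x)"
proof -
  have [measurable]: "f \<in> borel_measurable borel" by fact
  have [measurable]: "\<phi> \<in> borel_measurable borel" by (rule borel_measurable_continuous_onI[OF c])
  have "compact (\<phi> ` K)" using K c by (intro compact_continuous_image continuous_on_subset[OF c]) auto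
  then have "bounded (\<phi> ` K)" by (rule compact_imp_bounded)
  then obtain B where B: "\<forall>x\<in>K. \<bar>\<phi> x\<bar> \<le> B" unfolding bounded_iff by auto
  have "integrable lborel (\<lambda>x. indicator K x * f x)"
    using f K by (simp add: locally_integrable_def set_integrable_def)
  then have "integrable lborel (\<lambda>x. B * \<bar>indicator K x * f x\<bar>)" by (intro integrable_mult_right integrable_abs)
  then show ?thesis
  proof (rule Bochner_Integration.integrable_bound)
    show "AE x in lborel. norm (f x * \<phi> x) \<le> norm (B * \<bar>indicator K x * f x\<bar>)"
    proof (intro always_eventually allI)
      fix x
      show "norm (f x * \<phi> x) \<le> norm (B * \<bar>indicator K x * f x\<bar>)"
      proof (cases "x \<in> K")
        case True
        then have "\<bar>\<phi> x\<bar> \<le> \<bar>B\<bar>" using B by force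
        then have "\<bar>f x\<bar> * \<bar>\<phi> x\<bar> \<le> \<bar>f x\<bar> * \<bar>B\<bar>" by (intro mult_left_mono) auto
        then show ?thesis using True by (simp add: abs_mult mult.commute)
      qed (use K in auto)
    qed
  qed measurable
qed

lemma test_function_compact:
  "test_function \<phi> \<Longrightarrow> compact (closure {x. \<phi> x \<noteq> 0}) \<and> (\<forall>x. x \<notin> closure {x. \<phi> x \<noteq> 0} \<longrightarrow> \<phi> x = 0)"
  using closure_subset[of "{x. \<phi> x \<noteq> 0}"] by (auto simp: test_function_def)

lemma is_weak_deriv_unique:
  assumes "ae_eq g g" "ae_eq g' g'" "is_weak_deriv k f g" "is_weak_deriv k f g'"
  shows "ae_eq g g'"
proof -
  have [measurable]: "g \<in> borel_measurable borel" "g' \<in> borel_measurable borel"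
    using assms(1,2) by (auto simp: ae_eq_def)
  have loc: "locally_integrable g" "locally_integrable g'" using assms by (auto simp: is_weak_deriv_def)
  have "AE x in lborel. g x - g' x = 0"
  proof (rule AE_zero_if_test_integrals_zero)
    show "(\<lambda>x. g x - g' x) \<in> borel_measurable borel" by measurable
    show "locally_integrable (\<lambda>x. g x - g' x)" using loc by (rule locally_integrable_diff)
    fix u :: "'a \<Rightarrow> real \<Rightarrow> real" assume t: "test_function (tensor u)"
    define K where "K = closure {x. tensor u x \<noteq> 0}"
    have c: "continuous_on UNIV (tensor u)"
      using t continuous_partials[of "tensor u" "[]"] by (simp add: test_function_def partials_def)
    have K: "compact K" "\<And>x. x \<notin> K \<Longrightarrow> tensor u x = 0"
      unfolding K_def using test_function_compact[OF t] by blast+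
    have "integrable lborel (\<lambda>x. g x * tensor u x)" "integrable lborel (\<lambda>x. g' x * tensor u x)"
      using locally_integrable_mult[OF loc(1) _ c K] locally_integrable_mult[OF loc(2) _ c K] by simp_all
    then have "(\<integral>x. (g x - g' x) * tensor u x \<partial>lborel) = (\<integral>x. g x * tensor u x \<partial>lborel) - (\<integral>x. g' x * tensor u x \<partial>lborel)"
      by (simp add: left_diff_distrib)
    also have "\<dots> = 0"
    proof -
      let ?s = "(- 1::real) ^ (\<Sum>j\<in>UNIV. k j)"
      have "?s * (\<integral>x. g x * tensor u x \<partial>lborel) = ?s * (\<integral>x. g' x * tensor u x \<partial>lborel)"
      proof -
        have "?s * (\<integral>x. g x * tensor u x \<partial>lborel) = (\<integral>x. f x * multi_deriv k (tensor u) x \<partial>lborel)"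
          using assms(3) t unfolding is_weak_deriv_def by (simp only:)
        also have "\<dots> = ?s * (\<integral>x. g' x * tensor u x \<partial>lborel)"
          using assms(4) t unfolding is_weak_deriv_def by (simp only:)
        finally show ?thesis .
      qed
      then show ?thesis by simp
    qed
    finally show "(\<integral>x. (g x - g' x) * tensor u x \<partial>lborel) = 0" .
  qed
  then show ?thesis by (simp add: ae_eq_def)
qed

lemma has_weak_deriv_unique:
  "has_weak_deriv k f g \<Longrightarrow> has_weak_deriv k f g' \<Longrightarrow> g = g'"
  by transfer (rule is_weak_deriv_unique)

lemma weak_deriv_eqI: "has_weak_deriv k f g \<Longrightarrow> weak_deriv k f = g"
  unfolding weak_deriv_def by (rule the_equality) (auto intro: has_weak_deriv_unique)

subsection \<open>Fourier coefficients of weak derivatives\<close>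

lemma abs_tensor_le:
  assumes "\<And>i. \<bar>u i (x $ i)\<bar> \<le> v i (x $ i)"
  shows "\<bar>tensor u x\<bar> \<le> tensor v x"
  unfolding tensor_def abs_prod using assms by (intro prod_mono) auto

lemma smooth1_deriv: "smooth1 u \<Longrightarrow> smooth1 (deriv u)"
  unfolding smooth1_def by (metis funpow_Suc_right o_apply)

context freud_weight
begin

section \<open>The weighted inner product, the tensor basis and cut-offs\<close>

definition WW :: "real ^ 'd::finite \<Rightarrow> real" where
  "WW = tensor (\<lambda>_. W)"

lemma WW_pos [simp]: "WW x > 0"
  by (simp add: WW_def tensor_def prod_pos)

lemma WW_nonzero [simp]: "WW x \<noteq> 0"
  using WW_pos[of x] by linarith

lemma WW_nonneg [simp]: "WW x \<ge> 0"
  by (simp add: less_imp_le)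

lemma WW_measurable [measurable]: "WW \<in> borel_measurable borel"
  unfolding WW_def by measurable

lemma weight_sq: "(weight (real e) a b x)\<^sup>2 = WW x"
  by (simp add: weight_def WW_def tensor_def weight1_sq prod_power_distrib)

definition sq_int :: "(real ^ 'd::finite \<Rightarrow> real) \<Rightarrow> bool" where
  "sq_int f \<longleftrightarrow> f \<in> borel_measurable borel \<and> integrable lborel (\<lambda>x. (f x)\<^sup>2 * WW x)"

definition ip :: "(real ^ 'd::finite \<Rightarrow> real) \<Rightarrow> (real ^ 'd \<Rightarrow> real) \<Rightarrow> real" where
  "ip f g = (LBINT x. f x * g x * WW x)"

lemma sq_int_measurable: "sq_int f \<Longrightarrow> f \<in> borel_measurable borel"
  by (simp add: sq_int_def)

lemma sq_int_mult:
  assumes "sq_int f" "sq_int g"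
  shows "integrable lborel (\<lambda>x. f x * g x * WW x)"
proof -
  have [measurable]: "f \<in> borel_measurable borel" "g \<in> borel_measurable borel"
    using assms by (auto simp: sq_int_def)
  have "integrable lborel (\<lambda>x. (f x)\<^sup>2 * WW x + (g x)\<^sup>2 * WW x)"
    using assms by (simp add: sq_int_def)
  then show ?thesis
  proof (rule Bochner_Integration.integrable_bound)
    show "AE x in lborel. norm (f x * g x * WW x) \<le> norm ((f x)\<^sup>2 * WW x + (g x)\<^sup>2 * WW x)"
    proof (intro always_eventually allI)
      fix x
      have "2 * (\<bar>f x\<bar> * \<bar>g x\<bar>) \<le> (f x)\<^sup>2 + (g x)\<^sup>2"
        using zero_le_power2[of "\<bar>f x\<bar> - \<bar>g x\<bar>"] by (simp add: power2_eq_square algebra_simps)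
      then have "\<bar>f x * g x\<bar> \<le> (f x)\<^sup>2 + (g x)\<^sup>2"
        using mult_nonneg_nonneg[OF abs_ge_zero abs_ge_zero, of "f x" "g x"] unfolding abs_mult by linarith
      then have "\<bar>f x * g x\<bar> * WW x \<le> ((f x)\<^sup>2 + (g x)\<^sup>2) * WW x"
        by (intro mult_right_mono) auto
      then show "norm (f x * g x * WW x) \<le> norm ((f x)\<^sup>2 * WW x + (g x)\<^sup>2 * WW x)"
        by (simp add: abs_mult distrib_right)
    qed
  qed measurable
qed

lemma sq_int_add:
  assumes "sq_int f" "sq_int g"
  shows "sq_int (\<lambda>x. f x + g x)"
proof -
  have "integrable lborel (\<lambda>x. (f x)\<^sup>2 * WW x + (g x)\<^sup>2 * WW x + 2 * (f x * g x * WW x))"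
    using assms sq_int_mult[OF assms] by (simp add: sq_int_def)
  moreover have "(f x + g x)\<^sup>2 * WW x = (f x)\<^sup>2 * WW x + (g x)\<^sup>2 * WW x + 2 * (f x * g x * WW x)" for x
    by (simp add: power2_eq_square algebra_simps)
  ultimately show ?thesis using assms by (auto simp: sq_int_def)
qed

lemma sq_int_cmult: "sq_int f \<Longrightarrow> sq_int (\<lambda>x. c * f x)"
  by (auto simp: sq_int_def power_mult_distrib mult.assoc)

lemma sq_int_diff: "sq_int f \<Longrightarrow> sq_int g \<Longrightarrow> sq_int (\<lambda>x. f x - g x)"
  using sq_int_add[of f "\<lambda>x. - 1 * g x"] sq_int_cmult[of g "- 1"] by simp

lemma sq_int_zero: "sq_int (\<lambda>_. 0)"
  by (simp add: sq_int_def)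

lemma sq_int_sum: "(\<And>k. k \<in> A \<Longrightarrow> sq_int (f k)) \<Longrightarrow> sq_int (\<lambda>x. \<Sum>k\<in>A. f k x)"
  by (induction A rule: infinite_finite_induct) (simp_all add: sq_int_add sq_int_zero)

lemma ip_commute: "ip f g = ip g f"
  by (simp add: ip_def mult.commute mult.left_commute)

lemma ip_add: "sq_int f \<Longrightarrow> sq_int g \<Longrightarrow> sq_int f' \<Longrightarrow> ip (\<lambda>x. f x + g x) f' = ip f f' + ip g f'"
  by (simp add: ip_def distrib_right sq_int_mult)

lemma ip_cmult: "ip (\<lambda>x. c * f x) g = c * ip f g"
  by (simp add: ip_def mult.assoc)

lemma ip_self_nonneg: "ip f f \<ge> 0"
  unfolding ip_def by (intro integral_nonneg_AE) auto

text \<open>Pointwise \<open>|f| <= f^2 * WW + 1 / WW\<close>, and the continuous function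
  \<open>1 / WW\<close> is integrable over compact sets.\<close>

lemma sq_int_locally_integrable:
  fixes f :: "real ^ 'd::finite \<Rightarrow> real"
  assumes f: "sq_int f"
  shows "locally_integrable f"
  unfolding locally_integrable_def
proof (intro allI impI)
  fix K :: "(real ^ 'd) set" assume K: "compact K"
  have [measurable]: "f \<in> borel_measurable borel" using f by (simp add: sq_int_def)
  have [measurable]: "K \<in> sets borel" using K by (simp add: borel_compact)
  have "continuous_on K (\<lambda>x. 1 / WW x)"
    unfolding WW_def tensor_def W_def
    by (intro continuous_intros) (auto simp: prod_zero_iff)
  then have "set_integrable lborel K (\<lambda>x. 1 / WW x)"
    unfolding set_integrable_def using K by (intro borel_integrable_compact)
  then have "integrable lborel (\<lambda>x. (f x)\<^sup>2 * WW x + indicator K x * (1 / WW x))"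
    using f by (simp add: sq_int_def set_integrable_def)
  then show "set_integrable lborel K f"
    unfolding set_integrable_def
  proof (rule Bochner_Integration.integrable_bound)
    show "AE x in lborel. norm (indicator K x *\<^sub>R f x) \<le> norm ((f x)\<^sup>2 * WW x + indicator K x * (1 / WW x))"
    proof (intro always_eventually allI)
      fix x :: "real ^ 'd"
      have w: "WW x > 0" by simp
      have "2 * (\<bar>f x\<bar> * WW x) \<le> (f x)\<^sup>2 * (WW x)\<^sup>2 + 1"
        using zero_le_power2[of "\<bar>f x\<bar> * WW x - 1"] by (simp add: power2_eq_square algebra_simps)
      moreover have "0 \<le> \<bar>f x\<bar> * WW x" by simp
      ultimately have "\<bar>f x\<bar> * WW x \<le> (f x)\<^sup>2 * (WW x)\<^sup>2 + 1" by linarith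
      then have "\<bar>f x\<bar> \<le> (f x)\<^sup>2 * WW x + 1 / WW x"
      proof -
        have "((f x)\<^sup>2 * WW x + 1 / WW x) * WW x = (f x)\<^sup>2 * (WW x)\<^sup>2 + 1"
          using w by (simp add: power2_eq_square distrib_right)
        then have "\<bar>f x\<bar> * WW x \<le> ((f x)\<^sup>2 * WW x + 1 / WW x) * WW x"
          using \<open>\<bar>f x\<bar> * WW x \<le> (f x)\<^sup>2 * (WW x)\<^sup>2 + 1\<close> by simp
        then show ?thesis using w by (rule mult_right_le_imp_le)
      qed
      then show "norm (indicator K x *\<^sub>R f x) \<le> norm ((f x)\<^sup>2 * WW x + indicator K x * (1 / WW x))"
        by (auto split: split_indicator)
    qed
  qed measurable
qed

definition sq_int1 :: "(real \<Rightarrow> real) \<Rightarrow> bool" where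
  "sq_int1 u \<longleftrightarrow> u \<in> borel_measurable borel \<and> integrable lborel (\<lambda>x. (u x)\<^sup>2 * W x)"

lemma sq_int1_poly: "sq_int1 (poly p)"
  using integrable_poly_W[of "p * p"] by (simp add: sq_int1_def power2_eq_square)

lemma sq_int1_bounded_by_poly:
  assumes "u \<in> borel_measurable borel" "\<And>x. (u x)\<^sup>2 \<le> poly p x"
  shows "sq_int1 u"
  unfolding sq_int1_def
proof
  have [measurable]: "u \<in> borel_measurable borel" by fact
  show "integrable lborel (\<lambda>x. (u x)\<^sup>2 * W x)"
  proof (rule Bochner_Integration.integrable_bound[OF integrable_poly_W[of p]])
    show "AE x in lborel. norm ((u x)\<^sup>2 * W x) \<le> norm (poly p x * W x)"
    proof (intro always_eventually allI)
      fix x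
      have "(u x)\<^sup>2 * W x \<le> poly p x * W x" using assms(2) by (intro mult_right_mono) (auto simp: less_imp_le)
      moreover have "0 \<le> (u x)\<^sup>2 * W x" by (simp add: less_imp_le)
      ultimately show "norm ((u x)\<^sup>2 * W x) \<le> norm (poly p x * W x)"
        unfolding real_norm_def by linarith
    qed
  qed measurable
qed fact

lemma sq_int_tensor:
  assumes "\<And>i. sq_int1 (u i)"
  shows "sq_int (tensor u)"
proof -
  have "(\<lambda>x. (tensor u x)\<^sup>2 * WW x) = tensor (\<lambda>i y. (u i y)\<^sup>2 * W y)"
    by (simp add: fun_eq_iff WW_def power2_eq_square tensor_mult)
  then show ?thesis
    using assms tensor_integral(1)[of "\<lambda>i y. (u i y)\<^sup>2 * W y"] by (auto simp: sq_int_def sq_int1_def intro!: measurable_tensor)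
qed

definition P :: "('d::finite \<Rightarrow> nat) \<Rightarrow> real ^ 'd \<Rightarrow> real" where
  "P k = tensor (\<lambda>i. poly (orth_poly (k i)))"

lemma sq_int_P: "sq_int (P k)"
  unfolding P_def by (intro sq_int_tensor sq_int1_poly)

lemma ip_P: "ip (P k) (P l) = (if k = l then 1 else 0)"
proof -
  have "(\<lambda>x. P k x * P l x * WW x) = tensor (\<lambda>i y. poly (orth_poly (k i) * orth_poly (l i)) y * W y)"
    by (simp add: P_def WW_def tensor_mult)
  then have "ip (P k) (P l) = integral\<^sup>L lborel (tensor (\<lambda>i y. poly (orth_poly (k i) * orth_poly (l i)) y * W y))"
    by (simp add: ip_def)
  also have "\<dots> = (\<Prod>i\<in>UNIV. I (orth_poly (k i) * orth_poly (l i)))"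
    unfolding I_def by (intro tensor_integral(2) integrable_poly_W)
  also have "\<dots> = (if k = l then 1 else 0)"
    by (auto simp: I_orth_poly fun_eq_iff)
  finally show ?thesis .
qed

text \<open>Dominated convergence with the weight distributed over the factors: each
  \<open>u n i\<close> carries its own factor \<open>W\<close>, and the majorant is integrable as a
  product of two square integrable functions.\<close>

lemma tensor_lim:
  fixes u :: "nat \<Rightarrow> 'd::finite \<Rightarrow> real \<Rightarrow> real"
  assumes f: "sq_int f" and meas: "\<And>n i. u n i \<in> borel_measurable borel" "\<And>i. w i \<in> borel_measurable borel"
    and bound: "\<And>n i x. \<bar>u n i x\<bar> \<le> v i x * W x" and v: "\<And>i. sq_int1 (v i)"
    and lim: "\<And>i x. (\<lambda>n. u n i x) \<longlonglongrightarrow> w i x * W x"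
  shows "(\<lambda>n. LBINT x. f x * tensor (u n) x) \<longlonglongrightarrow> ip f (tensor w)"
  unfolding ip_def
proof (rule integral_dominated_convergence[where w = "\<lambda>x. \<bar>f x * tensor v x * WW x\<bar>"])
  have [measurable]: "f \<in> borel_measurable borel" using f by (rule sq_int_measurable)
  have [measurable]: "tensor (u n) \<in> borel_measurable borel" "tensor w \<in> borel_measurable borel" for n
    using meas by (auto intro: measurable_tensor)
  show "(\<lambda>x. f x * tensor w x * WW x) \<in> borel_measurable lborel" by measurable
  show "(\<lambda>x. f x * tensor (u n) x) \<in> borel_measurable lborel" for n by measurable
  show "integrable lborel (\<lambda>x. \<bar>f x * tensor v x * WW x\<bar>)"
    by (intro integrable_abs sq_int_mult f sq_int_tensor v)
  show "AE x in lborel. (\<lambda>n. f x * tensor (u n) x) \<longlonglongrightarrow> f x * tensor w x * WW x"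
  proof (intro always_eventually allI)
    fix x
    have "(\<lambda>n. tensor (u n) x) \<longlonglongrightarrow> tensor (\<lambda>i y. w i y * W y) x"
      unfolding tensor_def by (intro tendsto_prod lim)
    then have "(\<lambda>n. f x * tensor (u n) x) \<longlonglongrightarrow> f x * tensor (\<lambda>i y. w i y * W y) x"
      by (intro tendsto_mult tendsto_const)
    then show "(\<lambda>n. f x * tensor (u n) x) \<longlonglongrightarrow> f x * tensor w x * WW x"
      by (simp add: WW_def tensor_mult mult.assoc)
  qed
  show "AE x in lborel. norm (f x * tensor (u n) x) \<le> \<bar>f x * tensor v x * WW x\<bar>" for n
  proof (intro always_eventually allI)
    fix x
    have "\<bar>tensor (u n) x\<bar> \<le> tensor (\<lambda>i y. v i y * W y) x" by (intro abs_tensor_le bound)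
    then have "\<bar>f x\<bar> * \<bar>tensor (u n) x\<bar> \<le> \<bar>f x\<bar> * \<bar>tensor v x * WW x\<bar>"
      unfolding WW_def tensor_mult by (intro mult_left_mono) auto
    then show "norm (f x * tensor (u n) x) \<le> \<bar>f x * tensor v x * WW x\<bar>"
      by (simp add: abs_mult mult.assoc)
  qed
qed

text \<open>Since \<open>W = exp R\<close>, this is \<open>p W\<close> times a bump that tends to 1 as \<open>n\<close> grows.\<close>

definition cut :: "nat \<Rightarrow> real poly \<Rightarrow> real \<Rightarrow> real" where
  "cut n p = bump R (- real (Suc n)) (real (Suc n)) 1 p 0"

lemma smooth1_cut: "smooth1 (cut n p)"
  by (simp add: cut_def smooth1_bump)

lemma cut_support: "cut n p x \<noteq> 0 \<Longrightarrow> - real (Suc n) \<le> x \<and> x \<le> real (Suc n)"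
  unfolding cut_def by (rule bump_support)

lemma deriv_cut_support: "deriv (cut n p) x \<noteq> 0 \<Longrightarrow> - real (Suc n) \<le> x \<and> x \<le> real (Suc n)"
  unfolding cut_def by (subst (asm) deriv_bump) (auto dest: bump_support)

text \<open>\<open>cut n p\<close> is \<open>p * W * exp (- 1 / Q)\<close> with
  \<open>Q = N^2 - x^2\<close> and \<open>N = n + 1\<close>. Differentiating \<open>p * W\<close>
  gives \<open>- adj_deriv p * W\<close>; the other summand comes from the derivative
  \<open>- 2 * x\<close> of \<open>Q\<close>.\<close>

lemma cut_eq:
  assumes "\<bar>x\<bar> < real (Suc n)"
  shows "cut n p x = poly p x * W x * exp (- (1 / ((real (Suc n))\<^sup>2 - x\<^sup>2)))"
    and "deriv (cut n p) x = - (poly (adj_deriv p) x + 2 * x * poly p x * (1 / ((real (Suc n))\<^sup>2 - x\<^sup>2))\<^sup>2)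
        * W x * exp (- (1 / ((real (Suc n))\<^sup>2 - x\<^sup>2)))"
proof -
  define N where "N = real (Suc n)"
  have x: "- N < x" "x < N" using assms by (auto simp: N_def)
  define Q where "Q = N\<^sup>2 - x\<^sup>2"
  have Q: "(x - - N) * (N - x) = Q" by (simp add: Q_def power2_eq_square algebra_simps)
  have Qpos: "Q > 0" unfolding Q[symmetric] using x by simp
  have E: "exp (- 1 / Q + poly R x) = W x * exp (- (1 / Q))"
    by (simp add: W_def exp_add[symmetric] add.commute)
  have bump: "bump R (- N) N 1 p' m x = poly p' x * (1 / Q) ^ m * (W x * exp (- (1 / Q)))" for p' m
    unfolding bump_def Q E using x by simp
  show "cut n p x = poly p x * W x * exp (- (1 / ((real (Suc n))\<^sup>2 - x\<^sup>2)))"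
    unfolding cut_def N_def[symmetric] bump by (simp add: Q_def)
  have "poly ([:- (- N), 1:] * [:N, - 1:]) x = Q" by (simp add: Q_def power2_eq_square algebra_simps)
  moreover have "poly [:- N + N, - 2:] x = - 2 * x" by simp
  ultimately have bd: "poly (bump_deriv R (- N) N 1 p 0) x =
      (poly (pderiv p) x + poly p x * poly (pderiv R) x) * Q\<^sup>2 + poly p x * (- 2 * x)"
    unfolding bump_deriv_def Let_def poly_add poly_diff poly_smult poly_mult[of _ "[:- N + N, - 2:]"]
    by (simp only: poly_mult poly_add poly_power)
  have "deriv (cut n p) x = poly (bump_deriv R (- N) N 1 p 0) x * (1 / Q)\<^sup>2 * (W x * exp (- (1 / Q)))"
    unfolding cut_def N_def[symmetric] deriv_bump[OF zero_less_one] bump add_0 by (rule refl)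
  also have "poly (bump_deriv R (- N) N 1 p 0) x * (1 / Q)\<^sup>2 = - (poly (adj_deriv p) x + 2 * x * poly p x * (1 / Q)\<^sup>2)"
  proof -
    have D: "poly (adj_deriv p) x = - (poly (pderiv p) x + poly p x * poly (pderiv R) x)"
      by (simp add: adj_deriv_def V'_def)
    have Q2: "(s * Q\<^sup>2 + t) * (1 / Q)\<^sup>2 = s + t * (1 / Q)\<^sup>2" for s t
      using Qpos by (simp add: power2_eq_square field_simps)
    show ?thesis unfolding bd Q2 D by simp
  qed
  finally show "deriv (cut n p) x = - (poly (adj_deriv p) x + 2 * x * poly p x * (1 / ((real (Suc n))\<^sup>2 - x\<^sup>2))\<^sup>2)
        * W x * exp (- (1 / ((real (Suc n))\<^sup>2 - x\<^sup>2)))"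
    by (simp add: Q_def N_def)
qed

lemma cut_outside:
  assumes "\<not> \<bar>x\<bar> < real (Suc n)"
  shows "cut n p x = 0" "deriv (cut n p) x = 0"
proof -
  have x: "\<not> (- real (Suc n) < x \<and> x < real (Suc n))" using assms by auto
  show "cut n p x = 0" unfolding cut_def bump_def by (rule if_not_P[OF x])
  show "deriv (cut n p) x = 0"
    unfolding cut_def deriv_bump[OF zero_less_one] unfolding bump_def by (rule if_not_P[OF x])
qed

text \<open>The majorants must not depend on \<open>n\<close>: \<open>y^2 * exp (- y) <= 2\<close>
  for \<open>y = 1 / Q\<close> tames the singular factor, and the 4 is this 2 times the one in
  \<open>2 * x * p\<close>.\<close>

lemma cut_bounds:
  shows "\<bar>cut n p x\<bar> \<le> \<bar>poly p x\<bar> * W x"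
    and "\<bar>deriv (cut n p) x\<bar> \<le> (\<bar>poly (adj_deriv p) x\<bar> + 4 * (\<bar>x\<bar> * \<bar>poly p x\<bar>)) * W x"
proof -
  have "\<bar>cut n p x\<bar> \<le> \<bar>poly p x\<bar> * W x \<and> \<bar>deriv (cut n p) x\<bar> \<le> (\<bar>poly (adj_deriv p) x\<bar> + 4 * (\<bar>x\<bar> * \<bar>poly p x\<bar>)) * W x"
  proof (cases "\<bar>x\<bar> < real (Suc n)")
    case True
    define y where "y = 1 / ((real (Suc n))\<^sup>2 - x\<^sup>2)"
    have "x\<^sup>2 < (real (Suc n))\<^sup>2" using power_strict_mono[OF True, of 2] by simp
    then have y: "y > 0" by (simp add: y_def)
    then have e: "exp (- y) \<le> 1" by simp
    have "y ^ 2 \<le> fact 2 / 1 ^ 2 * exp (1 * y)" using y by (intro power_le_exp_real) auto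
    then have y2: "y\<^sup>2 * exp (- y) \<le> 2" by (simp add: exp_minus field_simps)
    have "\<bar>cut n p x\<bar> = \<bar>poly p x\<bar> * W x * exp (- y)"
      unfolding cut_eq[OF True] y_def by (simp add: abs_mult less_imp_le)
    also have "\<dots> \<le> \<bar>poly p x\<bar> * W x * 1" using e by (intro mult_left_mono) (auto simp: less_imp_le)
    finally have 1: "\<bar>cut n p x\<bar> \<le> \<bar>poly p x\<bar> * W x" by simp
    have "\<bar>deriv (cut n p) x\<bar> = \<bar>poly (adj_deriv p) x * exp (- y) + 2 * x * poly p x * (y\<^sup>2 * exp (- y))\<bar> * W x"
    proof -
      have "deriv (cut n p) x = - ((poly (adj_deriv p) x * exp (- y) + 2 * x * poly p x * (y\<^sup>2 * exp (- y))) * W x)"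
        unfolding cut_eq[OF True] y_def[symmetric] by (simp add: algebra_simps)
      then show ?thesis by (simp only: abs_minus_cancel abs_mult[of _ "W x"]) (simp add: less_imp_le)
    qed
    also have "\<dots> \<le> (\<bar>poly (adj_deriv p) x\<bar> * exp (- y) + 2 * (\<bar>x\<bar> * \<bar>poly p x\<bar>) * (y\<^sup>2 * exp (- y))) * W x"
      by (intro mult_right_mono order.trans[OF abs_triangle_ineq]) (auto simp: abs_mult less_imp_le mult_ac)
    also have "\<dots> \<le> (\<bar>poly (adj_deriv p) x\<bar> * 1 + 2 * (\<bar>x\<bar> * \<bar>poly p x\<bar>) * 2) * W x"
      by (intro mult_right_mono add_mono mult_left_mono e y2) (auto simp: less_imp_le)
    finally show ?thesis using 1 by simp
  next
    case False
    show ?thesis unfolding cut_outside[OF False] by (auto simp: less_imp_le)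
  qed
  then show "\<bar>cut n p x\<bar> \<le> \<bar>poly p x\<bar> * W x" "\<bar>deriv (cut n p) x\<bar> \<le> (\<bar>poly (adj_deriv p) x\<bar> + 4 * (\<bar>x\<bar> * \<bar>poly p x\<bar>)) * W x"
    by auto
qed

lemma cut_limits:
  shows "(\<lambda>n. cut n p x) \<longlonglongrightarrow> poly p x * W x"
    and "(\<lambda>n. deriv (cut n p) x) \<longlonglongrightarrow> - poly (adj_deriv p) x * W x"
proof -
  define y where "y n = 1 / ((real (Suc n))\<^sup>2 - x\<^sup>2)" for n
  have y: "y \<longlonglongrightarrow> 0" unfolding y_def by real_asymp
  have ev: "\<forall>\<^sub>F n in sequentially. \<bar>x\<bar> < real (Suc n)" by real_asymp
  have "(\<lambda>n. poly p x * W x * exp (- y n)) \<longlonglongrightarrow> poly p x * W x * exp (- 0)"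
    by (intro tendsto_intros y)
  moreover have "\<forall>\<^sub>F n in sequentially. poly p x * W x * exp (- y n) = cut n p x"
    using ev by eventually_elim (simp only: cut_eq y_def)
  ultimately have "(\<lambda>n. cut n p x) \<longlonglongrightarrow> poly p x * W x * exp (- 0)" by (rule Lim_transform_eventually)
  then show "(\<lambda>n. cut n p x) \<longlonglongrightarrow> poly p x * W x" by simp
  have "(\<lambda>n. - (poly (adj_deriv p) x + 2 * x * poly p x * (y n)\<^sup>2) * W x * exp (- y n)) \<longlonglongrightarrow>
      - (poly (adj_deriv p) x + 2 * x * poly p x * 0\<^sup>2) * W x * exp (- 0)"
    by (intro tendsto_intros y)
  moreover have "\<forall>\<^sub>F n in sequentially. - (poly (adj_deriv p) x + 2 * x * poly p x * (y n)\<^sup>2) * W x * exp (- y n) = deriv (cut n p) x"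
    using ev by eventually_elim (simp only: cut_eq y_def)
  ultimately have "(\<lambda>n. deriv (cut n p) x) \<longlonglongrightarrow> - (poly (adj_deriv p) x + 2 * x * poly p x * 0\<^sup>2) * W x * exp (- 0)"
    by (rule Lim_transform_eventually)
  then show "(\<lambda>n. deriv (cut n p) x) \<longlonglongrightarrow> - poly (adj_deriv p) x * W x" by simp
qed

text \<open>Cut-offs of \<open>P k * WW\<close> are admissible in \<open>parts\<close>. In the limit
  the derivative falls on the \<open>j\<close>-th factor and becomes, up to sign, the adjoint
  applied to \<open>orth_poly (k j)\<close>, which \<open>adj_deriv_orth_poly\<close> expands into
  the two raised indices.\<close>

lemma coefficient_relation:
  fixes f g :: "real ^ 'd::finite \<Rightarrow> real" and k :: "'d \<Rightarrow> nat"
  assumes f: "sq_int f" and g: "sq_int g"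
    and parts: "\<And>u. (\<And>i. smooth1 (u i)) \<Longrightarrow> test_function (tensor u) \<Longrightarrow>
      test_function (tensor (u(j := deriv (u j)))) \<Longrightarrow>
      (LBINT x. g x * tensor u x) = - (LBINT x. f x * tensor (u(j := deriv (u j))) x)"
  shows "ip g (P k) = alpha (k j + 1) * ip f (P (shift j 1 k)) + beta (k j + 3) * ip f (P (shift j 3 k))"
proof -
  define u where "u n i = cut n (orth_poly (k i))" for n i
  let ?u' = "\<lambda>n. (u n)(j := deriv (u n j))"
  let ?w = "(\<lambda>i. poly (orth_poly (k i)))(j := \<lambda>x. - poly (adj_deriv (orth_poly (k j))) x)"
  let ?v = "(\<lambda>i x. \<bar>poly (orth_poly (k i)) x\<bar>)(j := \<lambda>x. \<bar>poly (adj_deriv (orth_poly (k j))) x\<bar> + 4 * (\<bar>x\<bar> * \<bar>poly (orth_poly (k j)) x\<bar>))"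
  have s: "smooth1 (u n i)" for n i by (simp add: u_def smooth1_cut)
  have m: "u n i \<in> borel_measurable borel" "deriv (u n i) \<in> borel_measurable borel" for n i
    using smooth1_measurable[OF s[of n i], of 0] smooth1_measurable[OF s[of n i], of 1] by simp_all
  have t: "test_function (tensor (u n))" for n
    using cut_support
    by (intro test_function_tensor[where lo = "\<chi> i. - real (Suc n)" and hi = "\<chi> i. real (Suc n)"] s) (auto simp: u_def)
  have t': "test_function (tensor (?u' n))" for n
    using cut_support deriv_cut_support
    by (intro test_function_tensor[where lo = "\<chi> i. - real (Suc n)" and hi = "\<chi> i. real (Suc n)"])
      (auto simp: u_def smooth1_cut smooth1_deriv split: if_splits)
  have sq_int1_abs: "sq_int1 (\<lambda>x. \<bar>poly p x\<bar>)" for p using sq_int1_poly[of p] by (simp add: sq_int1_def)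
  have sq_int1_D: "sq_int1 (\<lambda>x. \<bar>poly (adj_deriv (orth_poly (k j))) x\<bar> + 4 * (\<bar>x\<bar> * \<bar>poly (orth_poly (k j)) x\<bar>))"
  proof (rule sq_int1_bounded_by_poly)
    let ?A = "adj_deriv (orth_poly (k j))" and ?B = "orth_poly (k j)"
    fix x
    have "(\<bar>s\<bar> + 4 * (\<bar>x\<bar> * \<bar>t\<bar>))\<^sup>2 \<le> 2 * s\<^sup>2 + 32 * (x\<^sup>2 * t\<^sup>2)" for s t :: real
    proof -
      have "(A + 4 * B)\<^sup>2 \<le> 2 * A\<^sup>2 + 32 * B\<^sup>2" for A B :: real
        using zero_le_power2[of "A - 4 * B"] by (simp add: power2_eq_square algebra_simps)
      from this[of "\<bar>s\<bar>" "\<bar>x\<bar> * \<bar>t\<bar>"] show ?thesis by (simp add: power_mult_distrib)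
    qed
    from this[of "poly ?A x" "poly ?B x"]
    show "(\<bar>poly ?A x\<bar> + 4 * (\<bar>x\<bar> * \<bar>poly ?B x\<bar>))\<^sup>2 \<le> poly (smult 2 (?A\<^sup>2) + smult 32 ([:0, 1:]\<^sup>2 * ?B\<^sup>2)) x"
      by (simp add: poly_power)
  qed measurable
  have "(\<lambda>n. LBINT x. g x * tensor (u n) x) \<longlonglongrightarrow> ip g (tensor (\<lambda>i. poly (orth_poly (k i))))"
    by (intro tensor_lim[where v = "\<lambda>i x. \<bar>poly (orth_poly (k i)) x\<bar>"] g m sq_int1_abs) (auto simp: u_def cut_bounds cut_limits)
  moreover have "(\<lambda>n. LBINT x. f x * tensor (?u' n) x) \<longlonglongrightarrow> ip f (tensor ?w)"
  proof (intro tensor_lim[where v = ?v] f)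
    show "?u' n i \<in> borel_measurable borel" for n i using m by simp
    show "?w i \<in> borel_measurable borel" for i by simp
    show "\<bar>?u' n i x\<bar> \<le> ?v i x * W x" for n i x using cut_bounds by (simp add: u_def)
    show "sq_int1 (?v i)" for i using sq_int1_abs sq_int1_D by simp
    show "(\<lambda>n. ?u' n i x) \<longlonglongrightarrow> ?w i x * W x" for i x using cut_limits[of _ x] by (simp add: u_def)
  qed
  then have "(\<lambda>n. - (LBINT x. f x * tensor (?u' n) x)) \<longlonglongrightarrow> - ip f (tensor ?w)" by (rule tendsto_minus)
  moreover have "(LBINT x. g x * tensor (u n) x) = - (LBINT x. f x * tensor (?u' n) x)" for n
    by (intro parts s t t')
  ultimately have "ip g (P k) = - ip f (tensor ?w)"
    unfolding P_def by (auto dest: LIMSEQ_unique)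
  moreover have "tensor ?w = (\<lambda>x. (- alpha (k j + 1)) * P (shift j 1 k) x + (- beta (k j + 3)) * P (shift j 3 k) x)"
  proof
    fix x
    let ?r = "\<Prod>i\<in>UNIV - {j}. poly (orth_poly (k i)) (x $ i)"
    have "P (shift j n k) x = poly (orth_poly (k j + n)) (x $ j) * ?r" for n
    proof -
      have "P (shift j n k) = tensor ((\<lambda>i. poly (orth_poly (k i)))(j := poly (orth_poly (k j + n))))"
        unfolding P_def by (rule arg_cong[of _ _ tensor]) (auto simp: shift_apply)
      then show ?thesis by (simp only: tensor_fun_upd)
    qed
    then show "tensor ?w x = (- alpha (k j + 1)) * P (shift j 1 k) x + (- beta (k j + 3)) * P (shift j 3 k) x"
      unfolding tensor_fun_upd adj_deriv_orth_poly by (simp add: algebra_simps)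
  qed
  ultimately have "ip g (P k) = - ip f (\<lambda>x. (- alpha (k j + 1)) * P (shift j 1 k) x + (- beta (k j + 3)) * P (shift j 3 k) x)"
    by (simp only:)
  also have "\<dots> = alpha (k j + 1) * ip f (P (shift j 1 k)) + beta (k j + 3) * ip f (P (shift j 3 k))"
    unfolding ip_commute[of f] ip_add[OF sq_int_cmult[OF sq_int_P] sq_int_cmult[OF sq_int_P] f] ip_cmult by simp
  finally show ?thesis .
qed

text \<open>Both functions are weak derivatives of the same \<open>f0\<close>, and on products,
  order \<open>l\<close> applied to the \<open>j\<close>-th partial derivative is order
  \<open>shift j 1 l\<close>. Comparing the pairings makes \<open>g\<close> the \<open>j\<close>-th
  derivative of \<open>f\<close> on product test functions; the sign stems from the order being
  larger by 1.\<close>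

lemma weak_deriv_coefficient_relation:
  fixes f g f0 :: "real ^ 'd::finite \<Rightarrow> real"
  assumes f: "sq_int f" "is_weak_deriv l f0 f" and g: "sq_int g" "is_weak_deriv (shift j 1 l) f0 g"
  shows "ip g (P k) = alpha (k j + 1) * ip f (P (shift j 1 k)) + beta (k j + 3) * ip f (P (shift j 3 k))"
proof (rule coefficient_relation[OF f(1) g(1)])
  fix u :: "'d \<Rightarrow> real \<Rightarrow> real"
  let ?u' = "u(j := deriv (u j))" and ?s = "(- 1::real) ^ (\<Sum>i\<in>UNIV. l i)"
  assume s: "\<And>i. smooth1 (u i)" and t: "test_function (tensor u)" "test_function (tensor ?u')"
  have s': "smooth1 (?u' i)" for i using s by (simp add: smooth1_deriv)
  have "multi_deriv l (tensor ?u') = multi_deriv (shift j 1 l) (tensor u)"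
    unfolding multi_deriv_tensor[of u, OF s] multi_deriv_tensor[of ?u', OF s']
    by (rule arg_cong[of _ _ tensor]) (auto simp: shift_apply fun_eq_iff funpow_swap1)
  moreover have "(LBINT x. f0 x * multi_deriv l (tensor ?u') x) = ?s * (LBINT x. f x * tensor ?u' x)"
    using f(2) t(2) by (simp only: is_weak_deriv_def)
  moreover have "(LBINT x. f0 x * multi_deriv (shift j 1 l) (tensor u) x) =
      (- 1) ^ (\<Sum>i\<in>UNIV. shift j 1 l i) * (LBINT x. g x * tensor u x)"
    using g(2) t(1) by (simp only: is_weak_deriv_def)
  moreover have "(\<Sum>i\<in>UNIV. shift j 1 l i) = Suc (\<Sum>i\<in>UNIV. l i)"
  proof -
    have "(\<Sum>i\<in>UNIV. shift j 1 l i) = (\<Sum>i\<in>UNIV. l i + (if i = j then 1 else 0))"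
      by (intro sum.cong) (auto simp: shift_apply)
    then show ?thesis by (simp add: sum.distrib)
  qed
  ultimately have "?s * (LBINT x. f x * tensor ?u' x) = ?s * (- (LBINT x. g x * tensor u x))" by simp
  then have "(LBINT x. f x * tensor ?u' x) = - (LBINT x. g x * tensor u x)"
    unfolding mult_cancel_left by simp
  then show "(LBINT x. g x * tensor u x) = - (LBINT x. f x * tensor ?u' x)" by simp
qed

end

text \<open>The difference quotients have integral 0 by translation invariance.\<close>

lemma integral_directional_derivative_zero:
  fixes F G :: "'a::euclidean_space \<Rightarrow> real" and v :: 'a
  assumes deriv: "\<And>x. ((\<lambda>t. F (x + t *\<^sub>R v)) has_real_derivative G x) (at 0)"
    and F: "continuous_on UNIV F" and G: "continuous_on UNIV G"
    and K: "compact K" "\<And>x. x \<notin> K \<Longrightarrow> F x = 0"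
  shows "integral\<^sup>L lborel G = 0"
proof -
  have [measurable]: "F \<in> borel_measurable borel" "G \<in> borel_measurable borel"
    using F G by (auto intro: borel_measurable_continuous_onI)
  define D where "D n x = (F (x + (1 / (real n + 1)) *\<^sub>R v) - F x) / (1 / (real n + 1))" for n x
  \<comment> \<open>\<open>K'\<close> contains every point from which a step of at most
    \<open>v\<close> lands in \<open>K\<close>: the difference quotients vanish outside it, and the
    mean value theorem bounds them on it.\<close>
  define K' where "K' = (\<lambda>(x, t). x - t *\<^sub>R v) ` (K \<times> {0..1})"
  have K': "compact K'"
    unfolding K'_def using K(1)
    by (intro compact_continuous_image compact_Times) (auto simp: case_prod_unfold intro!: continuous_intros)
  have sub: "x \<in> K'" if "x + t *\<^sub>R v \<in> K" "0 \<le> t" "t \<le> 1" for x t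
    unfolding K'_def by (rule image_eqI[of _ _ "(x + t *\<^sub>R v, t)"]) (use that in auto)
  have der: "((\<lambda>s. F (x + s *\<^sub>R v)) has_real_derivative G (x + t *\<^sub>R v)) (at t)" for x t
  proof -
    have "((\<lambda>s. F (x + (s + t) *\<^sub>R v)) has_real_derivative G (x + t *\<^sub>R v)) (at 0)"
      using deriv[of "x + t *\<^sub>R v"] by (simp add: scaleR_add_left add_ac)
    then show ?thesis using DERIV_shift[of "\<lambda>s. F (x + s *\<^sub>R v)" "G (x + t *\<^sub>R v)" 0 t] by simp
  qed
  have "continuous_on (K' \<union> (\<lambda>(x, t). x + t *\<^sub>R v) ` (K' \<times> {0..1})) G" using G by (rule continuous_on_subset) simp
  moreover have "compact (K' \<union> (\<lambda>(x, t). x + t *\<^sub>R v) ` (K' \<times> {0..1}))" using K'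
    by (intro compact_Un compact_continuous_image compact_Times) (auto simp: case_prod_unfold intro!: continuous_intros)
  ultimately have "bounded (G ` (K' \<union> (\<lambda>(x, t). x + t *\<^sub>R v) ` (K' \<times> {0..1})))"
    by (intro compact_imp_bounded compact_continuous_image)
  then obtain B where B: "\<And>x t. x \<in> K' \<Longrightarrow> 0 \<le> t \<Longrightarrow> t \<le> 1 \<Longrightarrow> \<bar>G (x + t *\<^sub>R v)\<bar> \<le> B"
    unfolding bounded_iff by fastforce
  have bound: "\<bar>D n x\<bar> \<le> B * indicator K' x" for n x
  proof -
    define t where "t = 1 / (real n + 1)"
    have t: "0 < t" "t \<le> 1" by (auto simp: t_def)
    show ?thesis
    proof (cases "x \<in> K'")
      case True
      obtain z where z: "0 < z" "z < t" "F (x + t *\<^sub>R v) - F (x + 0 *\<^sub>R v) = (t - 0) * G (x + z *\<^sub>R v)"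
        using MVT2[OF t(1), of "\<lambda>s. F (x + s *\<^sub>R v)" "\<lambda>s. G (x + s *\<^sub>R v)"] der by blast
      then have "D n x = G (x + z *\<^sub>R v)" using t by (simp add: D_def t_def[symmetric])
      then show ?thesis using B[OF True, of z] z t True by simp
    next
      case False
      then have "F x = 0" "F (x + t *\<^sub>R v) = 0" using sub[of x 0] sub[of x t] t K(2) by auto
      then show ?thesis using False by (simp add: D_def t_def[symmetric])
    qed
  qed
  have trans: "(\<integral>x. F (x + c) \<partial>lborel) = integral\<^sup>L lborel F" for c
  proof -
    have "integral\<^sup>L lborel F = integral\<^sup>L (distr lborel borel ((+) c)) F" by (simp add: lborel_distr_plus)
    also have "\<dots> = (\<integral>x. F (c + x) \<partial>lborel)" by (subst integral_distr) auto
    finally show ?thesis by (simp add: add.commute)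
  qed
  have iF: "integrable lborel F"
  proof -
    have "integrable lborel (\<lambda>x. indicator K x *\<^sub>R F x)"
      using K F by (intro borel_integrable_compact) (auto intro: continuous_on_subset)
    moreover have "(\<lambda>x. indicator K x *\<^sub>R F x) = F" using K(2) by (auto simp: fun_eq_iff split: split_indicator)
    ultimately show ?thesis by (simp only:)
  qed
  then have iFt: "integrable lborel (\<lambda>x. F (x + c))" for c
  proof -
    have "integrable (distr lborel borel ((+) c)) F" using iF by (simp add: lborel_distr_plus)
    then show ?thesis by (subst (asm) integrable_distr_eq) (auto simp: add.commute)
  qed
  have "(\<lambda>n. integral\<^sup>L lborel (D n)) \<longlonglongrightarrow> integral\<^sup>L lborel G"
  proof (rule integral_dominated_convergence[where w = "\<lambda>x. B * indicator K' x"])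
    show "integrable lborel (\<lambda>x. B * indicator K' x)"
    proof -
      have "integrable lborel (\<lambda>x. indicator K' x *\<^sub>R B)"
        using K' by (intro borel_integrable_compact) auto
      then show ?thesis by (simp add: mult.commute)
    qed
    show "AE x in lborel. (\<lambda>n. D n x) \<longlonglongrightarrow> G x"
    proof (intro always_eventually allI)
      fix x
      have "((\<lambda>t. (F (x + (0 + t) *\<^sub>R v) - F (x + 0 *\<^sub>R v)) / t) \<longlongrightarrow> G x) (at 0)"
        using deriv[of x] unfolding DERIV_def by simp
      moreover have "filterlim (\<lambda>n. 1 / (real n + 1)) (at 0) sequentially"
        unfolding filterlim_at by (auto intro: eventuallyI) real_asymp
      ultimately show "(\<lambda>n. D n x) \<longlonglongrightarrow> G x"
        unfolding D_def by (simp add: filterlim_compose[of "\<lambda>t. (F (x + (0 + t) *\<^sub>R v) - F (x + 0 *\<^sub>R v)) / t"])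
          (drule (1) filterlim_compose, simp)
    qed
    show "AE x in lborel. norm (D n x) \<le> B * indicator K' x" for n using bound by simp
  qed (auto simp: D_def[abs_def])
  moreover have "integral\<^sup>L lborel (D n) = 0" for n
    unfolding D_def by (simp add: trans iF iFt)
  ultimately show ?thesis by (simp add: LIMSEQ_const_iff)
qed

section \<open>Weak derivatives of polynomials\<close>

lemma partials_zero_outside:
  assumes "\<And>x. x \<in> U \<Longrightarrow> \<phi> x = 0" "open U" "x \<in> U"
  shows "partials js \<phi> x = 0"
  using assms(3)
proof (induction js arbitrary: x)
  case Nil
  then show ?case using assms(1) by (simp add: partials_def)
next
  case (Cons j js)
  have "(partials js \<phi> has_derivative (\<lambda>_. 0)) (at x)"
    by (rule has_derivative_transform_within_open[OF has_derivative_const[of 0] assms(2) Cons.prems])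
      (simp add: Cons.IH)
  then have "frechet_derivative (partials js \<phi>) (at x) = (\<lambda>_. 0)" by (rule frechet_derivative_at[symmetric])
  then show ?case by (simp add: partials_def partial_deriv_def)
qed

lemma line_derivative:
  assumes "f differentiable (at x)"
  shows "((\<lambda>t. f (x + t *\<^sub>R axis j 1)) has_real_derivative partial_deriv j f x) (at 0)"
proof -
  have f: "(f has_derivative frechet_derivative f (at x)) (at x)"
    using assms by (simp add: frechet_derivative_works)
  have "((\<lambda>t. x + t *\<^sub>R axis j 1) has_derivative (\<lambda>t. t *\<^sub>R axis j 1)) (at 0)"
    by (auto intro!: derivative_eq_intros)
  from has_derivative_compose[OF this, of f "frechet_derivative f (at x)"] f
  have "((\<lambda>t. f (x + t *\<^sub>R axis j 1)) has_derivative (\<lambda>t. frechet_derivative f (at x) (t *\<^sub>R axis j 1))) (at 0)"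
    by simp
  moreover have "(\<lambda>t. frechet_derivative f (at x) (t *\<^sub>R axis j 1)) = (\<lambda>t. partial_deriv j f x * t)"
    using linear_frechet_derivative[OF assms] by (auto simp: partial_deriv_def linear_cmul mult.commute)
  ultimately show ?thesis by (simp add: has_field_derivative_def)
qed

lemma continuous_tensor_poly: "continuous_on UNIV (tensor (\<lambda>i. poly (q i)))"
  unfolding tensor_def by (intro continuous_intros)

text \<open>The polynomial times \<open>partials js \<phi>\<close> is compactly supported, so its
  \<open>j\<close>-th derivative has integral 0. Through this, polynomials have their classical
  derivatives as weak ones, against arbitrary test functions and not only products.\<close>

lemma tensor_poly_parts:
  fixes q :: "'d::finite \<Rightarrow> real poly"
  assumes \<phi>: "test_function \<phi>"
  shows "(LBINT x. tensor (\<lambda>i. poly (q i)) x * partials (j # js) \<phi> x) =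
    - (LBINT x. tensor (\<lambda>i. poly ((q(j := pderiv (q j))) i)) x * partials js \<phi> x)"
proof -
  define A A' \<psi> \<psi>' where "A = tensor (\<lambda>i. poly (q i))" and "A' = tensor (\<lambda>i. poly ((q(j := pderiv (q j))) i))"
    and "\<psi> = partials js \<phi>" and "\<psi>' = partials (j # js) \<phi>"
  have s: "smooth \<phi>" and cK: "compact (closure {x. \<phi> x \<noteq> 0})" using \<phi> by (auto simp: test_function_def)
  define K where "K = closure {x. \<phi> x \<noteq> 0}"
  have K: "compact K" using cK by (simp add: K_def)
  have out: "x \<in> - K \<Longrightarrow> \<phi> x = 0" for x using closure_subset[of "{x. \<phi> x \<noteq> 0}"] by (auto simp: K_def)
  have oK: "open (- K)" by (simp add: K_def open_Compl)
  have z: "\<psi> x = 0" "\<psi>' x = 0" if "x \<notin> K" for x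
    unfolding \<psi>_def \<psi>'_def by (rule partials_zero_outside[of "- K"], use out oK that in auto)+
  have cont: "continuous_on UNIV A" "continuous_on UNIV A'" "continuous_on UNIV \<psi>" "continuous_on UNIV \<psi>'"
    unfolding A_def A'_def \<psi>_def \<psi>'_def by (intro continuous_tensor_poly continuous_partials s)+
  have dA: "A differentiable (at x)" "partial_deriv j A = A'" for x
  proof -
    have *: "(poly (q i) has_real_derivative poly (pderiv (q i)) x) (at x)" for i x by (rule poly_DERIV)
    show "A differentiable (at x)" unfolding A_def by (rule partial_deriv_tensor(1)[OF *])
    have "partial_deriv j A = tensor ((\<lambda>i. poly (q i))(j := poly (pderiv (q j))))"
      unfolding A_def by (rule partial_deriv_tensor(2)[OF *])
    also have "\<dots> = A'" unfolding A'_def by (rule arg_cong[of _ _ tensor]) auto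
    finally show "partial_deriv j A = A'" .
  qed
  have d\<psi>: "\<psi> differentiable (at x)" "partial_deriv j \<psi> = \<psi>'" for x
    using s by (auto simp: \<psi>_def \<psi>'_def smooth_def partials_def)
  have "integral\<^sup>L lborel (\<lambda>x. A' x * \<psi> x + A x * \<psi>' x) = 0"
  proof (rule integral_directional_derivative_zero[where F = "\<lambda>x. A x * \<psi> x" and v = "axis j 1" and K = K])
    fix x
    show "((\<lambda>t. A (x + t *\<^sub>R axis j 1) * \<psi> (x + t *\<^sub>R axis j 1)) has_real_derivative A' x * \<psi> x + A x * \<psi>' x) (at 0)"
      using DERIV_mult[OF line_derivative[OF dA(1)[of x], of j] line_derivative[OF d\<psi>(1)[of x], of j]]
      by (simp add: dA d\<psi> algebra_simps)
  qed (use cont K z in \<open>auto intro!: continuous_intros\<close>)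
  moreover have "integrable lborel (\<lambda>x. A' x * \<psi> x)" "integrable lborel (\<lambda>x. A x * \<psi>' x)"
  proof -
    have int: "integrable lborel (\<lambda>x. B x * C x)"
      if "continuous_on UNIV B" "continuous_on UNIV C" "\<And>x. x \<notin> K \<Longrightarrow> C x = 0" for B C :: "real ^ 'd \<Rightarrow> real"
    proof -
      have "integrable lborel (\<lambda>x. indicator K x *\<^sub>R (B x * C x))"
        using K that by (intro borel_integrable_compact continuous_on_mult) (auto intro: continuous_on_subset)
      moreover have "(\<lambda>x. indicator K x *\<^sub>R (B x * C x)) = (\<lambda>x. B x * C x)"
        using that(3) by (auto simp: fun_eq_iff split: split_indicator)
      ultimately show ?thesis by (simp only:)
    qed
    show "integrable lborel (\<lambda>x. A' x * \<psi> x)" "integrable lborel (\<lambda>x. A x * \<psi>' x)"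
      using cont z by (auto intro!: int)
  qed
  ultimately show ?thesis by (simp add: A_def A'_def \<psi>_def \<psi>'_def)
qed

lemma tensor_poly_partials:
  fixes q :: "'d::finite \<Rightarrow> real poly"
  assumes \<phi>: "test_function \<phi>"
  shows "(LBINT x. tensor (\<lambda>i. poly (q i)) x * partials js \<phi> x) =
    (- 1) ^ length js * (LBINT x. tensor (\<lambda>i. poly ((pderiv ^^ count_list js i) (q i))) x * \<phi> x)"
proof (induction js arbitrary: q)
  case Nil
  show ?case by (simp add: partials_def)
next
  case (Cons j js)
  have eq: "(pderiv ^^ count_list js i) ((q(j := pderiv (q j))) i) = (pderiv ^^ count_list (j # js) i) (q i)" for i
    by (simp add: funpow_swap1)
  show ?case unfolding tensor_poly_parts[OF \<phi>] Cons.IH eq by simp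
qed

lemma tensor_poly_multi_deriv:
  fixes q :: "'d::finite \<Rightarrow> real poly"
  assumes \<phi>: "test_function \<phi>"
  shows "(LBINT x. tensor (\<lambda>i. poly (q i)) x * multi_deriv l \<phi> x) =
    (- 1) ^ (\<Sum>i\<in>UNIV. l i) * (LBINT x. tensor (\<lambda>i. poly ((pderiv ^^ l i) (q i))) x * \<phi> x)"
proof -
  define js where "js = (SOME js. \<forall>j. count_list js j = l j)"
  have c: "count_list js i = l i" for i unfolding js_def by (rule count_list_SOME)
  have "length js = (\<Sum>i\<in>UNIV. count_list js i)" by (rule sum_count_set[symmetric]) auto
  then show ?thesis
    using tensor_poly_partials[OF \<phi>, of q js] by (simp add: multi_deriv_def js_def[symmetric] c)
qed

subsection \<open>Completeness and the Parseval identity\<close>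

text \<open>The exponential series may be integrated term by term: its partial sums are dominated by
  \<open>|u| * exp (|t| * |X|)\<close>, and every term is a multiple of a vanishing moment.\<close>

lemma integral_iexp_zero:
  fixes u X :: "'a \<Rightarrow> real"
  assumes [measurable]: "u \<in> borel_measurable M" "X \<in> borel_measurable M"
    and exp_int: "\<And>t. integrable M (\<lambda>x. \<bar>u x\<bar> * exp (t * \<bar>X x\<bar>))"
    and int: "\<And>n. integrable M (\<lambda>x. u x * X x ^ n)"
    and zero: "\<And>n. (\<integral>x. u x * X x ^ n \<partial>M) = 0"
  shows "(\<integral>x. u x *\<^sub>R iexp (t * X x) \<partial>M) = 0"
proof -
  define S where "S N x = (\<Sum>n<N. (u x * X x ^ n) *\<^sub>R ((\<i> * complex_of_real t) ^ n /\<^sub>R fact n))" for N x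
  have tm: "(u x * X x ^ n) *\<^sub>R ((\<i> * complex_of_real t) ^ n /\<^sub>R fact n) =
      u x *\<^sub>R ((\<i> * complex_of_real (t * X x)) ^ n /\<^sub>R fact n)" for x n
    by (simp add: power_mult_distrib scaleR_conv_of_real mult_ac)
  have "(\<lambda>N. \<integral>x. S N x \<partial>M) \<longlonglongrightarrow> (\<integral>x. u x *\<^sub>R iexp (t * X x) \<partial>M)"
  proof (rule integral_dominated_convergence[where w = "\<lambda>x. \<bar>u x\<bar> * exp (\<bar>t\<bar> * \<bar>X x\<bar>)"])
    show "AE x in M. (\<lambda>N. S N x) \<longlonglongrightarrow> u x *\<^sub>R iexp (t * X x)"
    proof (intro always_eventually allI)
      fix x
      have "(\<lambda>n. (\<i> * complex_of_real (t * X x)) ^ n /\<^sub>R fact n) sums exp (\<i> * complex_of_real (t * X x))"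
        by (rule exp_converges)
      then have "(\<lambda>n. u x *\<^sub>R ((\<i> * complex_of_real (t * X x)) ^ n /\<^sub>R fact n)) sums (u x *\<^sub>R iexp (t * X x))"
        by (rule sums_scaleR_right)
      then show "(\<lambda>N. S N x) \<longlonglongrightarrow> u x *\<^sub>R iexp (t * X x)"
        unfolding S_def tm sums_def .
    qed
    show "AE x in M. norm (S N x) \<le> \<bar>u x\<bar> * exp (\<bar>t\<bar> * \<bar>X x\<bar>)" for N
    proof (intro always_eventually allI)
      fix x
      define y where "y = \<bar>t\<bar> * \<bar>X x\<bar>"
      have "norm (S N x) \<le> (\<Sum>n<N. norm (u x *\<^sub>R ((\<i> * complex_of_real (t * X x)) ^ n /\<^sub>R fact n)))"
        unfolding S_def tm by (rule norm_sum)
      also have "\<dots> = \<bar>u x\<bar> * (\<Sum>n<N. y ^ n /\<^sub>R fact n)"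
        by (simp add: y_def norm_mult norm_power abs_mult sum_distrib_left mult.assoc)
      also have "(\<Sum>n<N. y ^ n /\<^sub>R fact n) \<le> exp y"
        unfolding exp_def by (intro sum_le_suminf summable_exp_generic) (auto simp: y_def)
      finally show "norm (S N x) \<le> \<bar>u x\<bar> * exp (\<bar>t\<bar> * \<bar>X x\<bar>)"
        by (simp add: y_def mult_left_mono)
    qed
  qed (auto simp: S_def exp_int)
  moreover have "(\<integral>x. S N x \<partial>M) = 0" for N
    unfolding S_def by (subst Bochner_Integration.integral_sum) (auto simp: int zero)
  ultimately show ?thesis by (simp add: LIMSEQ_const_iff)
qed

text \<open>The normalized positive and negative parts of \<open>u\<close> push forward under \<open>X\<close> to probability
  measures with the same characteristic function.\<close>

lemma moments_zero_imp_indicator_integral_zero: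
  fixes u X :: "'a \<Rightarrow> real"
  assumes [measurable]: "u \<in> borel_measurable M" "X \<in> borel_measurable M"
    and exp_int: "\<And>t. integrable M (\<lambda>x. \<bar>u x\<bar> * exp (t * \<bar>X x\<bar>))"
    and int: "\<And>n. integrable M (\<lambda>x. u x * X x ^ n)"
    and zero: "\<And>n. (\<integral>x. u x * X x ^ n \<partial>M) = 0"
    and B [measurable]: "B \<in> sets borel"
  shows "(\<integral>x. u x * indicator B (X x) \<partial>M) = 0"
proof -
  have u_int: "integrable M u" and u0: "integral\<^sup>L M u = 0" using int[of 0] zero[of 0] by simp_all
  \<comment> \<open>As \<open>u\<close> has integral 0, its positive and negative parts have the
    same mass \<open>c\<close>; dividing them by \<open>c\<close> gives the densities
    \<open>d 1\<close> and \<open>d (-1)\<close> below.\<close>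
  define c where "c = (\<integral>x. \<bar>u x\<bar> \<partial>M) / 2"
  show ?thesis
  proof (cases "c = 0")
    case True
    then have "AE x in M. u x = 0"
      using integral_nonneg_eq_0_iff_AE[of M "\<lambda>x. \<bar>u x\<bar>"] u_int by (simp add: c_def)
    then have "AE x in M. u x * indicator B (X x) = 0" by eventually_elim simp
    then have "(\<integral>x. u x * indicator B (X x) \<partial>M) = (\<integral>x. 0 \<partial>M)" by (intro integral_cong_AE) auto
    then show ?thesis by simp
  next
    case False
    moreover have "c \<ge> 0" unfolding c_def by (simp add: integral_nonneg_AE)
    ultimately have c: "c > 0" by simp
    define d where "d s x = max (s * u x) 0 / c" for s x
    have [measurable]: "d s \<in> borel_measurable M" for s unfolding d_def by measurable
    have d0: "d s x \<ge> 0" for s x using c by (simp add: d_def)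
    have dint: "integrable M (d s)" for s unfolding d_def using u_int
      by (intro integrable_divide integrable_max) auto
    have d_eq: "d s x = (\<bar>u x\<bar> + s * u x) / (2 * c)" if "s \<in> {1, -1}" for s x
      using that by (auto simp: d_def max_def field_simps)
    have d1: "integral\<^sup>L M (d s) = 1" if s: "s \<in> {1, -1}" for s
      unfolding d_eq[OF s] using u_int u0 c by (simp add: c_def[symmetric] Bochner_Integration.integral_add) (simp add: c_def)
    define \<mu> where "\<mu> s = distr (density M (\<lambda>x. ennreal (d s x))) borel X" for s
    have int_\<mu>: "integral\<^sup>L (\<mu> s) F = (\<integral>x. d s x *\<^sub>R F (X x) \<partial>M)"
      if [measurable]: "F \<in> borel_measurable borel" for F :: "real \<Rightarrow> 'b::{banach, second_countable_topology}" and s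
      unfolding \<mu>_def by (subst integral_distr) (auto simp: integral_density d0)
    have dist: "real_distribution (\<mu> s)" if s: "s \<in> {1, -1}" for s
    proof -
      have "emeasure (density M (\<lambda>x. ennreal (d s x))) (space M) = (\<integral>\<^sup>+x. ennreal (d s x) \<partial>M)"
        by (subst emeasure_density) (auto intro!: nn_integral_cong)
      also have "\<dots> = ennreal 1" using d1[OF s] by (subst nn_integral_eq_integral[OF dint]) (auto simp: d0)
      finally have "prob_space (density M (\<lambda>x. ennreal (d s x)))"
        by (intro prob_spaceI) simp
      then have "prob_space (\<mu> s)" unfolding \<mu>_def by (rule prob_space.prob_space_distr) simp
      then show ?thesis
        by (simp add: real_distribution_def real_distribution_axioms_def \<mu>_def)
    qed
    have diff: "d 1 x - d (-1) x = u x / c" for x by (simp add: d_eq diff_divide_distrib[symmetric] field_simps)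
    have sub: "(\<integral>x. d 1 x *\<^sub>R F (X x) \<partial>M) - (\<integral>x. d (-1) x *\<^sub>R F (X x) \<partial>M) = (1 / c) *\<^sub>R (\<integral>x. u x *\<^sub>R F (X x) \<partial>M)"
      if [measurable]: "F \<in> borel_measurable borel" and bd: "\<And>x. norm (F x) \<le> 1"
      for F :: "real \<Rightarrow> 'b::{banach, second_countable_topology}"
    proof -
      have i: "integrable M (\<lambda>x. d s x *\<^sub>R F (X x))" for s
        by (rule Bochner_Integration.integrable_bound[OF dint[of s]])
          (auto simp: d0 intro!: always_eventually mult_left_le bd)
      have "(\<integral>x. d 1 x *\<^sub>R F (X x) \<partial>M) - (\<integral>x. d (-1) x *\<^sub>R F (X x) \<partial>M) = (\<integral>x. (d 1 x - d (-1) x) *\<^sub>R F (X x) \<partial>M)"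
        using i by (simp add: scaleR_diff_left)
      also have "\<dots> = (\<integral>x. (1 / c) *\<^sub>R (u x *\<^sub>R F (X x)) \<partial>M)" by (simp add: diff)
      also have "\<dots> = (1 / c) *\<^sub>R (\<integral>x. u x *\<^sub>R F (X x) \<partial>M)" by (rule integral_scaleR_right)
      finally show ?thesis .
    qed
    have "\<mu> 1 = \<mu> (-1)"
    proof (rule Levy_uniqueness)
      show "char (\<mu> 1) = char (\<mu> (-1))"
      proof
        fix t
        have "char (\<mu> 1) t - char (\<mu> (-1)) t = (1 / c) *\<^sub>R (\<integral>x. u x *\<^sub>R iexp (t * X x) \<partial>M)"
          unfolding char_def by (subst (1 2) int_\<mu>) (auto intro!: sub)
        also have "\<dots> = 0" using integral_iexp_zero[OF assms(1-5)] by simp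
        finally show "char (\<mu> 1) t = char (\<mu> (-1)) t" by simp
      qed
    qed (simp_all add: dist)
    then have "integral\<^sup>L (\<mu> 1) (indicator B :: real \<Rightarrow> real) = integral\<^sup>L (\<mu> (-1)) (indicator B)" by simp
    then have "(\<integral>x. d 1 x *\<^sub>R (indicator B (X x) :: real) \<partial>M) = (\<integral>x. d (-1) x *\<^sub>R indicator B (X x) \<partial>M)"
      unfolding int_\<mu>[OF borel_measurable_indicator[OF B]] .
    moreover have "(\<integral>x. d 1 x *\<^sub>R (indicator B (X x) :: real) \<partial>M) - (\<integral>x. d (-1) x *\<^sub>R indicator B (X x) \<partial>M) =
        (1 / c) *\<^sub>R (\<integral>x. u x *\<^sub>R (indicator B (X x) :: real) \<partial>M)"
      by (rule sub) (simp_all add: indicator_def)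
    ultimately have "(1 / c) *\<^sub>R (\<integral>x. u x *\<^sub>R (indicator B (X x) :: real) \<partial>M) = 0" by simp
    then show ?thesis using c by simp
  qed
qed

context freud_weight
begin

lemma linear_functional_zero:
  fixes J :: "real poly \<Rightarrow> real"
  assumes add: "\<And>p q. J (p + q) = J p + J q" and smult: "\<And>c p. J (smult c p) = c * J p"
    and zero: "\<And>m. J (orth_poly m) = 0"
  shows "J p = 0"
proof (induction "degree p" arbitrary: p rule: less_induct)
  case less
  define c r where "c = lead_coeff p / lead_coeff (orth_poly (degree p))" and "r = p - smult c (orth_poly (degree p))"
  have J0: "J 0 = 0" using smult[of 0 0] by simp
  have p: "J p = J r + c * J (orth_poly (degree p))" using add[of r "smult c (orth_poly (degree p))"] by (simp add: r_def smult)
  have "orth_poly (degree p) \<noteq> 0" using h_pos[of "degree p"] by (simp add: orth_poly_def)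
  then have "coeff (orth_poly (degree p)) (degree p) \<noteq> 0" by (metis degree_orth_poly leading_coeff_0_iff)
  then have "coeff r (degree p) = 0" by (simp add: r_def c_def)
  moreover have "degree r \<le> degree p" unfolding r_def
    by (intro degree_diff_le) (auto intro: order.trans[OF degree_smult_le])
  ultimately have "r = 0 \<or> degree r < degree p" by (metis leading_coeff_0_iff order_le_imp_less_or_eq)
  then have "J r = 0" using less J0 by auto
  then show ?case using p zero by simp
qed

lemma sq_int1_exp: "sq_int1 (\<lambda>x. exp (t * \<bar>x\<bar>))"
proof -
  have "(exp (t * \<bar>x\<bar>))\<^sup>2 = exp ((2 * t) * \<bar>x\<bar>)" for x by (simp add: exp_double[symmetric] mult_ac)
  then show ?thesis using integrable_exp_poly_W[of "2 * t" 1] by (simp add: sq_int1_def)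
qed

lemma sq_int1_indicator: "B \<in> sets borel \<Longrightarrow> sq_int1 (indicator B)"
  by (rule sq_int1_bounded_by_poly[where p = 1]) (auto split: split_indicator)

lemma sq_int1_const: "sq_int1 (\<lambda>_. c)"
proof -
  have "poly [:c:] = (\<lambda>_. c)" by auto
  then show ?thesis using sq_int1_poly[of "[:c:]"] by (simp only:)
qed

lemma indicator_box_tensor: "indicator (box a' b') x = tensor (\<lambda>i. indicator {a' $ i <..< b' $ i}) x"
  by (auto simp: tensor_def indicator_def mem_box_cart prod_zero_iff)

text \<open>Coordinates pass one at a time from polynomials to indicators. For the coordinate
  \<open>j\<close> in turn, everything else is absorbed into a signed density \<open>u\<close> whose
  moments in \<open>x $ j\<close> vanish by induction; determinacy of the moment problem then admits
  the indicator of \<open>B j\<close>.\<close>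

lemma complete_aux:
  fixes f :: "real ^ 'd::finite \<Rightarrow> real"
  assumes f: "sq_int f" and orth: "\<And>k. ip f (P k) = 0" and "finite S" and B: "\<And>i. B i \<in> sets borel"
  shows "ip f (tensor (\<lambda>i. if i \<in> S then indicator (B i) else poly (orth_poly (k i)))) = 0"
  using \<open>finite S\<close>
proof (induction S arbitrary: k rule: finite_induct)
  case empty
  show ?case using orth[of k] by (simp add: P_def)
next
  case (insert j S)
  define c where "c i = (if i \<in> S then indicator (B i) else poly (orth_poly (k i)))" for i
  have ac: "sq_int1 (c i)" for i using B by (auto simp: c_def sq_int1_indicator sq_int1_poly)
  define u where "u x = f x * tensor (c(j := \<lambda>_. 1)) x * WW x" for x
  have [measurable]: "f \<in> borel_measurable borel" using f by (rule sq_int_measurable)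
  have fac: "v (x $ j) * tensor (c(j := \<lambda>_. 1)) x = tensor (c(j := v)) x" for v x
    unfolding tensor_fun_upd by simp
  have uv: "u x * v (x $ j) = f x * tensor (c(j := v)) x * WW x" for v x
  proof -
    have "u x * v (x $ j) = f x * (v (x $ j) * tensor (c(j := \<lambda>_. 1)) x) * WW x" by (simp add: u_def)
    then show ?thesis unfolding fac .
  qed
  have int: "integrable lborel (\<lambda>x. u x * v (x $ j))" if "sq_int1 v" for v
    unfolding uv using ac that by (intro sq_int_mult f sq_int_tensor) auto
  have u_int: "integrable lborel u" using int[OF sq_int1_const[of 1]] by simp
  have [measurable]: "u \<in> borel_measurable borel" using u_int by simp
  have int_poly: "integrable lborel (\<lambda>x. u x * poly p (x $ j))" for p by (rule int[OF sq_int1_poly])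
  \<comment> \<open>The index in direction \<open>j\<close> is free in the induction hypothesis;
    letting it run through all \<open>m\<close> reaches every polynomial.\<close>
  have zero_poly: "(LBINT x. u x * poly p (x $ j)) = 0" for p
  proof (rule linear_functional_zero)
    fix m
    have "tensor (c(j := poly (orth_poly m))) = tensor (\<lambda>i. if i \<in> S then indicator (B i) else poly (orth_poly ((k(j := m)) i)))"
      using insert.hyps by (intro arg_cong[of _ _ tensor]) (auto simp: c_def)
    then have "ip f (tensor (c(j := poly (orth_poly m)))) = 0" using insert.IH[of "k(j := m)"] by (simp only:)
    then show "(LBINT x. u x * poly (orth_poly m) (x $ j)) = 0" unfolding uv ip_def .
  qed (simp_all add: distrib_left int_poly mult.left_commute)
  have "(LBINT x. u x * indicator (B j) (x $ j)) = 0"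
  proof (rule moments_zero_imp_indicator_integral_zero)
    show "B j \<in> sets borel" by (rule B)
    show "integrable lborel (\<lambda>x. \<bar>u x\<bar> * exp (t * \<bar>x $ j\<bar>))" for t
      using integrable_abs[OF int[OF sq_int1_exp[of t]]] by (simp add: abs_mult)
    show "integrable lborel (\<lambda>x. u x * (x $ j) ^ n)" "(LBINT x. u x * (x $ j) ^ n) = 0" for n
      using int_poly[of "monom 1 n"] zero_poly[of "monom 1 n"] by (simp_all add: poly_monom)
  qed auto
  then have "ip f (tensor (c(j := indicator (B j)))) = 0" unfolding uv ip_def .
  moreover have "c(j := indicator (B j)) = (\<lambda>i. if i \<in> insert j S then indicator (B i) else poly (orth_poly (k i)))"
    by (auto simp: c_def)
  ultimately show ?case by (simp only:)
qed

theorem complete: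
  fixes f :: "real ^ 'd::finite \<Rightarrow> real"
  assumes f: "sq_int f" and orth: "\<And>k. ip f (P k) = 0"
  shows "AE x in lborel. f x = 0"
proof -
  have [measurable]: "f \<in> borel_measurable borel" using f by (rule sq_int_measurable)
  have "AE x in lborel. f x * WW x = 0"
  proof (rule AE_zero_if_box_integrals_zero)
    fix a' b' :: "real ^ 'd"
    let ?t = "tensor (\<lambda>i. indicator {a' $ i <..< b' $ i})"
    have eq: "(\<lambda>x. indicator (box a' b') x * (f x * WW x)) = (\<lambda>x. f x * ?t x * WW x)"
      by (auto simp: fun_eq_iff indicator_box_tensor)
    show "integrable lborel (\<lambda>x. indicator (box a' b') x * (f x * WW x))"
      unfolding eq by (intro sq_int_mult f sq_int_tensor sq_int1_indicator) auto
    show "(LBINT x. indicator (box a' b') x * (f x * WW x)) = 0"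
      using complete_aux[OF f orth, of UNIV "\<lambda>i. {a' $ i <..< b' $ i}"] unfolding eq ip_def by simp
  qed measurable
  then show ?thesis by eventually_elim simp
qed

section \<open>Projections, Bessel's inequality and Parseval's identity\<close>

lemma ip_diff: "sq_int f \<Longrightarrow> sq_int g \<Longrightarrow> sq_int f' \<Longrightarrow> ip (\<lambda>x. f x - g x) f' = ip f f' - ip g f'"
  by (simp add: ip_def left_diff_distrib sq_int_mult)

lemma ip_sum:
  assumes "\<And>k. k \<in> A \<Longrightarrow> sq_int (F k)" "sq_int g"
  shows "ip (\<lambda>x. \<Sum>k\<in>A. F k x) g = (\<Sum>k\<in>A. ip (F k) g)"
  using assms by (simp add: ip_def sum_distrib_right sq_int_mult Bochner_Integration.integral_sum)

lemma ip_cong_AE: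
  assumes "f \<in> borel_measurable borel" "f' \<in> borel_measurable borel" "g \<in> borel_measurable borel" "AE x in lborel. f x = f' x"
  shows "ip f g = ip f' g"
proof -
  have [measurable]: "f \<in> borel_measurable borel" "f' \<in> borel_measurable borel" "g \<in> borel_measurable borel" by fact+
  show ?thesis unfolding ip_def
    by (intro integral_cong_AE, measurable) (use assms(4) in \<open>eventually_elim, simp\<close>)
qed

definition proj :: "('d::finite \<Rightarrow> nat) set \<Rightarrow> (real ^ 'd \<Rightarrow> real) \<Rightarrow> real ^ 'd \<Rightarrow> real" where
  "proj A f x = (\<Sum>k\<in>A. ip f (P k) * P k x)"

lemma sq_int_proj: "sq_int (proj A f)"
  unfolding proj_def[abs_def] by (intro sq_int_sum sq_int_cmult sq_int_P)

lemma ip_proj_P: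
  assumes "finite A"
  shows "ip (proj A f) (P k) = (if k \<in> A then ip f (P k) else 0)"
proof -
  have "ip (proj A f) (P k) = (\<Sum>l\<in>A. ip (\<lambda>x. ip f (P l) * P l x) (P k))"
    unfolding proj_def[abs_def] by (intro ip_sum sq_int_cmult sq_int_P)
  also have "\<dots> = (\<Sum>l\<in>A. if l = k then ip f (P k) else 0)"
    by (intro sum.cong) (auto simp: ip_cmult ip_P)
  finally show ?thesis using assms by simp
qed

lemma ip_proj:
  assumes "sq_int g"
  shows "ip (proj A f) g = (\<Sum>k\<in>A. ip f (P k) * ip g (P k))"
proof -
  have "ip (proj A f) g = (\<Sum>l\<in>A. ip (\<lambda>x. ip f (P l) * P l x) g)"
    unfolding proj_def[abs_def] by (intro ip_sum sq_int_cmult sq_int_P assms)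
  then show ?thesis by (simp add: ip_cmult ip_commute[of _ g])
qed

lemma ip_proj_proj: "finite A \<Longrightarrow> ip (proj A f) (proj A f) = (\<Sum>k\<in>A. (ip f (P k))\<^sup>2)"
  by (simp add: ip_proj sq_int_proj ip_proj_P power2_eq_square)

lemma ip_residual:
  assumes "sq_int f" "finite A"
  shows "ip (\<lambda>x. f x - proj A f x) (\<lambda>x. f x - proj A f x) = ip f f - (\<Sum>k\<in>A. (ip f (P k))\<^sup>2)"
proof -
  let ?p = "proj A f"
  have d: "sq_int (\<lambda>x. f x - ?p x)" using assms sq_int_proj by (intro sq_int_diff)
  let ?S = "\<Sum>k\<in>A. (ip f (P k))\<^sup>2"
  have pf: "ip ?p f = ?S"
    unfolding ip_proj[OF assms(1)] by (simp add: power2_eq_square)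
  have fp: "ip f ?p = ?S" using pf ip_commute[of f ?p] by (simp only:)
  have "ip (\<lambda>x. f x - ?p x) f = ip f f - ?S"
    unfolding ip_diff[OF assms(1) sq_int_proj assms(1)] pf by (rule refl)
  then have 1: "ip f (\<lambda>x. f x - ?p x) = ip f f - ?S" using ip_commute[of f "\<lambda>x. f x - ?p x"] by (simp only:)
  have "ip (\<lambda>x. f x - ?p x) ?p = 0"
    unfolding ip_diff[OF assms(1) sq_int_proj sq_int_proj] fp ip_proj_proj[OF assms(2)] by simp
  then have 2: "ip ?p (\<lambda>x. f x - ?p x) = 0" using ip_commute[of ?p "\<lambda>x. f x - ?p x"] by (simp only:)
  show ?thesis unfolding ip_diff[OF assms(1) sq_int_proj d] 1 2 by simp
qed

lemma bessel:
  assumes "sq_int f" "finite A"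
  shows "(\<Sum>k\<in>A. (ip f (P k))\<^sup>2) \<le> ip f f"
  using ip_residual[OF assms] ip_self_nonneg[of "\<lambda>x. f x - proj A f x"] by linarith

text \<open>Fatou's lemma; only the lower limit enters, so the bound is asked of late terms.\<close>

lemma sq_int_limit:
  assumes s: "\<And>j. sq_int (s j)" and g [measurable]: "g \<in> borel_measurable borel"
    and lim: "AE x in lborel. (\<lambda>j. s j x) \<longlonglongrightarrow> g x" and C: "\<And>j. j \<ge> i \<Longrightarrow> ip (s j) (s j) \<le> C"
  shows "sq_int g" and "ip g g \<le> C"
proof -
  have [measurable]: "s j \<in> borel_measurable borel" for j using s by (rule sq_int_measurable)
  have nn: "(\<integral>\<^sup>+x. ennreal ((s j x)\<^sup>2 * WW x) \<partial>lborel) = ennreal (ip (s j) (s j))" for j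
    using s[of j] unfolding ip_def by (subst nn_integral_eq_integral) (auto simp: sq_int_def power2_eq_square)
  have C0: "C \<ge> 0" using C[of i] ip_self_nonneg[of "s i"] by simp
  have "(\<integral>\<^sup>+x. ennreal ((g x)\<^sup>2 * WW x) \<partial>lborel) = (\<integral>\<^sup>+x. liminf (\<lambda>j. ennreal ((s j x)\<^sup>2 * WW x)) \<partial>lborel)"
  proof (intro nn_integral_cong_AE)
    show "AE x in lborel. ennreal ((g x)\<^sup>2 * WW x) = liminf (\<lambda>j. ennreal ((s j x)\<^sup>2 * WW x))"
      using lim
    proof eventually_elim
      case (elim x)
      have "(\<lambda>j. ennreal ((s j x)\<^sup>2 * WW x)) \<longlonglongrightarrow> ennreal ((g x)\<^sup>2 * WW x)"
        by (intro tendsto_ennrealI tendsto_intros elim)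
      then show ?case by (rule lim_imp_Liminf[OF trivial_limit_sequentially, symmetric])
    qed
  qed
  also have "\<dots> \<le> liminf (\<lambda>j. \<integral>\<^sup>+x. ennreal ((s j x)\<^sup>2 * WW x) \<partial>lborel)"
    by (intro nn_integral_liminf) measurable
  also have "\<dots> \<le> ennreal C"
  proof -
    have "\<forall>\<^sub>F j in sequentially. ennreal (ip (s j) (s j)) \<le> ennreal C"
      using eventually_ge_at_top[of i] by eventually_elim (intro ennreal_leI C)
    then show ?thesis unfolding nn by (intro Liminf_le) auto
  qed
  finally have le: "(\<integral>\<^sup>+x. ennreal ((g x)\<^sup>2 * WW x) \<partial>lborel) \<le> ennreal C" .
  have int: "integrable lborel (\<lambda>x. (g x)\<^sup>2 * WW x)"
    by (rule integrableI_bounded) (use le in \<open>auto simp: less_top[symmetric] top_unique\<close>)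
  then show "sq_int g" by (simp add: sq_int_def)
  have "ennreal (ip g g) \<le> ennreal C"
    using le int unfolding ip_def by (subst (asm) nn_integral_eq_integral) (auto simp: power2_eq_square)
  then show "ip g g \<le> C" using C0 by simp
qed

lemma WW_integrable: "integrable lborel (WW :: real ^ 'd::finite \<Rightarrow> real)"
  using sq_int_tensor[of "\<lambda>_::'d. \<lambda>_. 1", OF sq_int1_const] by (simp add: sq_int_def tensor_def)

text \<open>A subsequence of the partial sums converges almost everywhere, as it is Cauchy in \<open>L\<^sub>1(w\<^sup>2)\<close>
  with summable increments; by completeness of the polynomials its limit is \<open>f\<close>.\<close>

theorem parseval:
  fixes f :: "real ^ 'd::finite \<Rightarrow> real"
  assumes f: "sq_int f"
  shows "(\<integral>\<^sup>+k. ennreal ((ip f (P k))\<^sup>2) \<partial>count_space UNIV) = ennreal (ip f f)"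
proof -
  define A where "A n = {k :: 'd \<Rightarrow> nat. \<forall>i. k i \<le> n}" for n
  have "A n = PiE UNIV (\<lambda>_. {..n})" for n by (auto simp: A_def)
  then have fin: "finite (A n)" for n by (simp add: finite_PiE)
  have mono: "A m \<subseteq> A n" if "m \<le> n" for m n using that by (auto simp: A_def intro: order.trans)
  have ex: "\<exists>n. k \<in> A n" for k
  proof
    show "k \<in> A (\<Sum>i\<in>UNIV. k i)" unfolding A_def by (auto intro: member_le_sum)
  qed
  define c where "c k = ip f (P k)" for k
  define a where "a n = (\<Sum>k\<in>A n. (c k)\<^sup>2)" for n
  have a_mono: "a m \<le> a n" if "m \<le> n" for m n unfolding a_def using mono[OF that] fin by (intro sum_mono2) auto
  have a_le: "a n \<le> ip f f" for n unfolding a_def c_def by (rule bessel[OF f fin])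
  have "incseq a" using a_mono by (auto simp: incseq_def)
  then obtain L where L: "a \<longlonglongrightarrow> L" and aL: "\<And>n. a n \<le> L"
    using incseq_convergent[of a "ip f f"] a_le by blast
  have L_le: "L \<le> ip f f" using L a_le by (intro LIMSEQ_le_const2) auto
  have "(\<integral>\<^sup>+k. ennreal ((c k)\<^sup>2) \<partial>count_space UNIV) = (\<integral>\<^sup>+k. (SUP n. ennreal ((c k)\<^sup>2) * indicator (A n) k) \<partial>count_space UNIV)"
  proof (intro nn_integral_cong antisym)
    fix k
    obtain n where "k \<in> A n" using ex by blast
    then have "ennreal ((c k)\<^sup>2) = ennreal ((c k)\<^sup>2) * indicator (A n) k" by simp
    then show "ennreal ((c k)\<^sup>2) \<le> (SUP n. ennreal ((c k)\<^sup>2) * indicator (A n) k)"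
      by (metis SUP_upper UNIV_I)
    show "(SUP n. ennreal ((c k)\<^sup>2) * indicator (A n) k) \<le> ennreal ((c k)\<^sup>2)"
      by (intro SUP_least) (auto split: split_indicator)
  qed
  also have "\<dots> = (SUP n. \<integral>\<^sup>+k. ennreal ((c k)\<^sup>2) * indicator (A n) k \<partial>count_space UNIV)"
    using mono by (intro nn_integral_monotone_convergence_SUP)
      (auto simp: incseq_def le_fun_def split: split_indicator)
  also have "(\<lambda>n. \<integral>\<^sup>+k. ennreal ((c k)\<^sup>2) * indicator (A n) k \<partial>count_space UNIV) = (\<lambda>n. ennreal (a n))"
  proof
    fix n
    have "(\<integral>\<^sup>+k. ennreal ((c k)\<^sup>2) * indicator (A n) k \<partial>count_space UNIV) = (\<integral>\<^sup>+k. ennreal ((c k)\<^sup>2) \<partial>count_space (A n))"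
      by (subst nn_integral_count_space_indicator) auto
    also have "\<dots> = ennreal (a n)" using fin by (simp add: nn_integral_count_space_finite a_def sum_ennreal)
    finally show "(\<integral>\<^sup>+k. ennreal ((c k)\<^sup>2) * indicator (A n) k \<partial>count_space UNIV) = ennreal (a n)" .
  qed
  also have "(SUP n. ennreal (a n)) = ennreal L"
  proof (rule LIMSEQ_unique[OF LIMSEQ_SUP])
    show "incseq (\<lambda>n. ennreal (a n))" using a_mono by (auto simp: incseq_def intro: ennreal_leI)
    show "(\<lambda>n. ennreal (a n)) \<longlonglongrightarrow> ennreal L" using L by (rule tendsto_ennrealI)
  qed
  finally have sum_L: "(\<integral>\<^sup>+k. ennreal ((c k)\<^sup>2) \<partial>count_space UNIV) = ennreal L" .

  have "\<exists>M. \<forall>m\<ge>M. L - a m \<le> (1/4) ^ i" for i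
  proof -
    have "\<forall>\<^sub>F m in sequentially. a m > L - (1/4) ^ i" using L by (rule order_tendstoD) simp
    then show ?thesis unfolding eventually_sequentially by (auto intro: less_imp_le simp: algebra_simps)
  qed
  then obtain M where M: "\<And>i m. m \<ge> M i \<Longrightarrow> L - a m \<le> (1/4) ^ i" by metis
  \<comment> \<open>Summing \<open>Suc (M j)\<close> gives a nondecreasing sequence that dominates
    both \<open>M i\<close> and \<open>i\<close>, so the energy outside \<open>A (N i)\<close> is at
    most \<open>4^(-i)\<close>.\<close>
  define N where "N i = (\<Sum>j\<le>i. Suc (M j))" for i
  have N_mono: "N i \<le> N j" if "i \<le> j" for i j unfolding N_def using that by (intro sum_mono2) auto
  have "M i \<le> N i" for i
  proof -
    have "Suc (M i) \<le> N i" unfolding N_def by (rule member_le_sum) auto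
    then show ?thesis by simp
  qed
  then have LN: "L - a (N i) \<le> (1/4) ^ i" for i by (rule M)
  have N_ge: "i \<le> N i" for i by (induction i) (auto simp: N_def)
  define s where "s i = proj (A (N i)) f" for i
  have ss: "sq_int (s i)" for i unfolding s_def by (rule sq_int_proj)
  have [measurable]: "s i \<in> borel_measurable borel" for i using ss by (rule sq_int_measurable)
  have fm [measurable]: "f \<in> borel_measurable borel" using f by (rule sq_int_measurable)
  have dist: "ip (\<lambda>x. s j x - s i x) (\<lambda>x. s j x - s i x) \<le> (1/4) ^ i" if "i \<le> j" for i j
  proof -
    have sub: "A (N i) \<subseteq> A (N j)" by (intro mono N_mono that)
    have "(\<lambda>x. s j x - s i x) = proj (A (N j) - A (N i)) f"
      unfolding s_def proj_def[abs_def] using sub fin by (simp add: sum_diff)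
    then have "ip (\<lambda>x. s j x - s i x) (\<lambda>x. s j x - s i x) = a (N j) - a (N i)"
      using fin sub by (simp add: ip_proj_proj a_def c_def sum_diff)
    then show ?thesis using LN[of i] aL[of "N j"] by linarith
  qed
  define d where "d i x = \<bar>s (Suc i) x - s i x\<bar>" for i x
  have [measurable]: "d i \<in> borel_measurable borel" for i unfolding d_def[abs_def] by measurable
  have "(\<integral>\<^sup>+x. (\<Sum>i. ennreal (d i x * WW x)) \<partial>lborel) < \<infinity>"
  proof -
    have "(\<integral>\<^sup>+x. ennreal (d i x * WW x) \<partial>lborel) \<le> ennreal ((1/2) ^ i * (1 + integral\<^sup>L lborel (WW :: real ^ 'd \<Rightarrow> real)))" for i
    proof -
      have sq: "sq_int (\<lambda>x. s (Suc i) x - s i x)" by (intro sq_int_diff ss)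
      have i1: "integrable lborel (\<lambda>x. 2 ^ i * ((s (Suc i) x - s i x)\<^sup>2 * WW x))"
        using sq unfolding sq_int_def by (intro integrable_mult_right) auto
      have i2: "integrable lborel (\<lambda>x :: real ^ 'd. (1/2) ^ i * WW x)"
        using WW_integrable by (intro integrable_mult_right)
      note int = Bochner_Integration.integrable_add[OF i1 i2]
      have "d i x * WW x \<le> 2 ^ i * ((s (Suc i) x - s i x)\<^sup>2 * WW x) + (1/2) ^ i * WW x" for x
      proof -
        \<comment> \<open>With \<open>z = 2 ^ i\<close> this turns the squared bound
          \<open>4^(-i)\<close> into an integral bound of order \<open>2^(-i)\<close>, which is
          summable.\<close>
        have "t \<le> z * t\<^sup>2 + 1 / z" if "z > 0" "t \<ge> 0" for z t :: real
        proof -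
          have "0 \<le> (z * t - 1)\<^sup>2 + z * t" using that by simp
          then have "z * t \<le> z * (z * t\<^sup>2 + 1 / z)" using that by (simp add: power2_eq_square algebra_simps)
          then show ?thesis using that by simp
        qed
        from this[of "2 ^ i" "d i x"] have "d i x \<le> 2 ^ i * (s (Suc i) x - s i x)\<^sup>2 + (1/2) ^ i"
          by (simp add: d_def power_divide)
        then have "d i x * WW x \<le> (2 ^ i * (s (Suc i) x - s i x)\<^sup>2 + (1/2) ^ i) * WW x"
          by (intro mult_right_mono) auto
        then show ?thesis by (simp add: algebra_simps)
      qed
      then have "(\<integral>\<^sup>+x. ennreal (d i x * WW x) \<partial>lborel) \<le>
          (\<integral>\<^sup>+x. ennreal (2 ^ i * ((s (Suc i) x - s i x)\<^sup>2 * WW x) + (1/2) ^ i * WW x) \<partial>lborel)"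
        by (intro nn_integral_mono ennreal_leI)
      also have "\<dots> = ennreal (LBINT x. 2 ^ i * ((s (Suc i) x - s i x)\<^sup>2 * WW x) + (1/2) ^ i * WW x)"
        using int by (intro nn_integral_eq_integral) auto
      also have "(LBINT x. 2 ^ i * ((s (Suc i) x - s i x)\<^sup>2 * WW x) + (1/2) ^ i * WW x) =
          2 ^ i * ip (\<lambda>x. s (Suc i) x - s i x) (\<lambda>x. s (Suc i) x - s i x) + (1/2) ^ i * integral\<^sup>L lborel (WW :: real ^ 'd \<Rightarrow> real)"
        unfolding Bochner_Integration.integral_add[OF i1 i2] integral_mult_right_zero ip_def
        by (simp add: power2_eq_square)
      also have "\<dots> \<le> 2 ^ i * (1/4) ^ i + (1/2) ^ i * integral\<^sup>L lborel (WW :: real ^ 'd \<Rightarrow> real)"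
        by (intro add_right_mono mult_left_mono dist) auto
      also have "(2::real) ^ i * (1/4) ^ i = (1/2) ^ i" by (simp flip: power_mult_distrib)
      finally show ?thesis by (simp add: distrib_left ennreal_leI)
    qed
    then have "(\<Sum>i. \<integral>\<^sup>+x. ennreal (d i x * WW x) \<partial>lborel) \<le> (\<Sum>i. ennreal ((1/2) ^ i * (1 + integral\<^sup>L lborel (WW :: real ^ 'd \<Rightarrow> real))))"
      by (intro suminf_le) auto
    also have "\<dots> < \<infinity>"
    proof -
      have "integral\<^sup>L lborel (WW :: real ^ 'd \<Rightarrow> real) \<ge> 0" by (simp add: integral_nonneg_AE)
      then have nn: "0 \<le> (1/2::real) ^ i * (1 + integral\<^sup>L lborel (WW :: real ^ 'd \<Rightarrow> real))" for i by simp
      have "summable (\<lambda>i. (1/2::real) ^ i * (1 + integral\<^sup>L lborel (WW :: real ^ 'd \<Rightarrow> real)))"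
        by (intro summable_mult2 summable_geometric) simp
      from suminf_ennreal2[OF nn this] show ?thesis by simp
    qed
    finally show ?thesis
      using nn_integral_suminf[of "\<lambda>i x. ennreal (d i x * WW x)" lborel] by simp
  qed
  then have "AE x in lborel. (\<Sum>i. ennreal (d i x * WW x)) \<noteq> \<infinity>"
    by (intro nn_integral_PInf_AE) auto
  then have conv: "AE x in lborel. convergent (\<lambda>i. s i x)"
  proof eventually_elim
    case (elim x)
    then have fin: "(\<Sum>i. ennreal (d i x * WW x)) \<noteq> top" by simp
    have nn: "0 \<le> d i x * WW x" for i by (simp add: d_def)
    have "summable (\<lambda>i. d i x * WW x)" by (rule summable_suminf_not_top[OF nn fin])
    then have "summable (\<lambda>i. d i x * WW x * (1 / WW x))" by (rule summable_mult2)
    then have "summable (\<lambda>i. \<bar>s (Suc i) x - s i x\<bar>)" by (simp add: d_def)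
    then have "summable (\<lambda>i. s (Suc i) x - s i x)" by (rule summable_rabs_cancel)
    then have "convergent (\<lambda>n. \<Sum>i<n. s (Suc i) x - s i x)" by (simp add: summable_iff_convergent)
    then have "convergent (\<lambda>n. s n x - s 0 x)" unfolding sum_lessThan_telescope[of "\<lambda>i. s i x"] .
    then show ?case using convergent_add[of "\<lambda>n. s n x - s 0 x" "\<lambda>_. s 0 x"] by (simp add: convergent_const)
  qed
  define g where "g x = lim (\<lambda>i. s i x)" for x
  have [measurable]: "g \<in> borel_measurable borel" unfolding g_def[abs_def] by measurable
  have lim_g: "AE x in lborel. (\<lambda>i. s i x) \<longlonglongrightarrow> g x"
    using conv by eventually_elim (simp add: g_def convergent_LIMSEQ_iff)
  \<comment> \<open>Fatou's lemma applied to \<open>s j - s i\<close> with \<open>i\<close> fixed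
    carries the Cauchy estimate over to the limit.\<close>
  have gs: "sq_int (\<lambda>x. g x - s i x)" "ip (\<lambda>x. g x - s i x) (\<lambda>x. g x - s i x) \<le> (1/4) ^ i" for i
  proof -
    have "AE x in lborel. (\<lambda>j. s j x - s i x) \<longlonglongrightarrow> g x - s i x"
      using lim_g by eventually_elim (intro tendsto_diff tendsto_const)
    note l = sq_int_limit[of "\<lambda>j x. s j x - s i x" "\<lambda>x. g x - s i x" i "(1/4) ^ i", OF sq_int_diff[OF ss ss] _ this dist]
    show "sq_int (\<lambda>x. g x - s i x)" by (rule l) auto
    show "ip (\<lambda>x. g x - s i x) (\<lambda>x. g x - s i x) \<le> (1/4) ^ i" by (rule l) auto
  qed
  have sg: "sq_int g" using sq_int_add[OF gs(1)[of 0] ss[of 0]] by simp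
  have sr: "sq_int (\<lambda>x. f x - g x)" by (intro sq_int_diff f sg)
  have pow0: "(\<lambda>i. (1/4::real) ^ i) \<longlonglongrightarrow> 0" by (intro LIMSEQ_power_zero) simp
  have "ip (\<lambda>x. f x - g x) (P k) = 0" for k
  proof -
    obtain n where n: "k \<in> A n" using ex by blast
    have "(ip (\<lambda>x. f x - g x) (P k))\<^sup>2 \<le> (1/4) ^ i" if "i \<ge> n" for i
    proof -
      have kA: "k \<in> A (N i)" using n mono[of n "N i"] N_ge[of i] that by auto
      have "ip (s i) (P k) = ip f (P k)" unfolding s_def using kA fin by (simp add: ip_proj_P)
      then have "ip (\<lambda>x. f x - g x) (P k) = - ip (\<lambda>x. g x - s i x) (P k)"
        by (simp add: ip_diff f sg ss sq_int_P)
      then have "(ip (\<lambda>x. f x - g x) (P k))\<^sup>2 = (ip (\<lambda>x. g x - s i x) (P k))\<^sup>2" by simp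
      also have "\<dots> \<le> ip (\<lambda>x. g x - s i x) (\<lambda>x. g x - s i x)" using bessel[OF gs(1), of "{k}"] by simp
      also have "\<dots> \<le> (1/4) ^ i" by (rule gs)
      finally show ?thesis .
    qed
    then have "(ip (\<lambda>x. f x - g x) (P k))\<^sup>2 \<le> 0"
      by (intro LIMSEQ_le_const[OF pow0]) auto
    then show ?thesis by simp
  qed
  then have "AE x in lborel. f x - g x = 0" by (intro complete sr)
  then have fg: "AE x in lborel. f x - s i x = g x - s i x" for i by eventually_elim simp
  have "ip f f \<le> L + (1/4) ^ i" for i
  proof -
    have "ip f f - a (N i) = ip (\<lambda>x. f x - s i x) (\<lambda>x. f x - s i x)"
      unfolding s_def a_def c_def by (rule ip_residual[OF f fin, symmetric])
    also have "\<dots> = ip (\<lambda>x. g x - s i x) (\<lambda>x. f x - s i x)" by (rule ip_cong_AE[OF _ _ _ fg]) measurable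
    also have "\<dots> = ip (\<lambda>x. f x - s i x) (\<lambda>x. g x - s i x)" by (rule ip_commute)
    also have "\<dots> = ip (\<lambda>x. g x - s i x) (\<lambda>x. g x - s i x)" by (rule ip_cong_AE[OF _ _ _ fg]) measurable
    also have "\<dots> \<le> (1/4) ^ i" by (rule gs)
    finally show ?thesis using aL[of "N i"] by linarith
  qed
  then have "ip f f \<le> L"
    using tendsto_add[OF tendsto_const pow0, of L] by (intro LIMSEQ_le_const[of "\<lambda>i. L + (1/4) ^ i"]) auto
  then have "L = ip f f" using L_le by simp
  then show ?thesis using sum_L by (simp add: c_def)
qed

end

subsection \<open>Widths of sets in an inner product space\<close>

text \<open>Gaussian elimination: if equation \<open>e\<close> involves the unknown
  \<open>k0\<close>, solving it for \<open>c k0\<close> removes one equation and one unknown, so the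
  surplus of unknowns persists.\<close>

lemma underdetermined_system:
  fixes m :: "'k \<Rightarrow> 'e \<Rightarrow> real"
  assumes "finite E" "finite K" "card E < card K"
  shows "\<exists>c. (\<exists>k\<in>K. c k \<noteq> 0) \<and> (\<forall>e\<in>E. (\<Sum>k\<in>K. c k * m k e) = 0)"
  using assms
proof (induction E arbitrary: K m rule: finite_induct)
  case empty
  then have "K \<noteq> {}" by auto
  then show ?case by (intro exI[of _ "\<lambda>_. 1"]) auto
next
  case (insert e E)
  show ?case
  proof (cases "\<forall>k\<in>K. m k e = 0")
    case True
    have "card E < card K" using insert by simp
    then obtain c where "\<exists>k\<in>K. c k \<noteq> 0" "\<forall>e\<in>E. (\<Sum>k\<in>K. c k * m k e) = 0"
      using insert.IH[OF insert.prems(1)] by blast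
    then show ?thesis using True by (intro exI[of _ c]) auto
  next
    case False
    then obtain k0 where k0: "k0 \<in> K" "m k0 e \<noteq> 0" by blast
    define K' where "K' = K - {k0}"
    have K': "finite K'" "card E < card K'" "k0 \<notin> K'" and K: "K = insert k0 K'"
      using insert k0 by (auto simp: K'_def)
    obtain c where c: "\<exists>k\<in>K'. c k \<noteq> 0"
        "\<And>x. x \<in> E \<Longrightarrow> (\<Sum>k\<in>K'. c k * (m k x - m k e / m k0 e * m k0 x)) = 0"
      using insert.IH[OF K'(1,2), of "\<lambda>k x. m k x - m k e / m k0 e * m k0 x"] by blast
    define c0 where "c0 = - (\<Sum>k\<in>K'. c k * m k e) / m k0 e"
    have S: "(\<Sum>k\<in>K. (c(k0 := c0)) k * m k x) = c0 * m k0 x + (\<Sum>k\<in>K'. c k * m k x)" for x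
    proof -
      have "(\<Sum>k\<in>K. (c(k0 := c0)) k * m k x) = (c(k0 := c0)) k0 * m k0 x + (\<Sum>k\<in>K'. (c(k0 := c0)) k * m k x)"
        unfolding K using K' by (intro sum.insert) auto
      also have "(\<Sum>k\<in>K'. (c(k0 := c0)) k * m k x) = (\<Sum>k\<in>K'. c k * m k x)"
        using K' by (intro sum.cong) auto
      finally show ?thesis by simp
    qed
    have "(\<Sum>k\<in>K. (c(k0 := c0)) k * m k x) = 0" if "x \<in> insert e E" for x
    proof (cases "x = e")
      case True
      then show ?thesis unfolding S using k0 by (simp add: c0_def)
    next
      case False
      then have "(\<Sum>k\<in>K'. c k * (m k x - m k e / m k0 e * m k0 x)) = 0" using that c by blast
      also have "(\<Sum>k\<in>K'. c k * (m k x - m k e / m k0 e * m k0 x)) =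
          (\<Sum>k\<in>K'. c k * m k x) - (\<Sum>k\<in>K'. c k * m k e) * (m k0 x / m k0 e)"
        by (simp add: right_diff_distrib sum_subtractf sum_distrib_right sum_divide_distrib mult.assoc)
      finally show ?thesis unfolding S by (simp add: c0_def)
    qed
    moreover have "\<exists>k\<in>K. (c(k0 := c0)) k \<noteq> 0" using c(1) K' by (auto simp: K)
    ultimately show ?thesis by blast
  qed
qed

text \<open>The \<open>L\<^sub>2\<close> space is only a subset of the type of measurable classes,
  so the axioms are required on a subspace \<open>X\<close> of an ambient vector space, and
  \<open>N\<close> is tied to \<open>ipr\<close> only there.\<close>

locale inner_subspace =
  fixes X :: "'v::real_vector set" and ipr :: "'v \<Rightarrow> 'v \<Rightarrow> real" and N :: "'v \<Rightarrow> real"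
  assumes X: "subspace X"
    and add: "\<And>f g h. f \<in> X \<Longrightarrow> g \<in> X \<Longrightarrow> h \<in> X \<Longrightarrow> ipr (f + g) h = ipr f h + ipr g h"
    and scale: "\<And>c f h. f \<in> X \<Longrightarrow> h \<in> X \<Longrightarrow> ipr (c *\<^sub>R f) h = c * ipr f h"
    and comm: "\<And>f g. f \<in> X \<Longrightarrow> g \<in> X \<Longrightarrow> ipr f g = ipr g f"
    and nonneg: "\<And>f. f \<in> X \<Longrightarrow> ipr f f \<ge> 0"
    and definite: "\<And>f. f \<in> X \<Longrightarrow> ipr f f = 0 \<Longrightarrow> f = 0"
    and N: "\<And>f. f \<in> X \<Longrightarrow> N f = sqrt (ipr f f)"
begin

lemma X_sum: "(\<And>k. k \<in> A \<Longrightarrow> p k \<in> X) \<Longrightarrow> (\<Sum>k\<in>A. c k *\<^sub>R p k) \<in> X"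
  using X by (intro subspace_sum subspace_scale) auto

lemma zero_left: "h \<in> X \<Longrightarrow> ipr 0 h = 0"
  using scale[of 0 h 0] X by (simp add: subspace_0)

lemma ipr_sum: "(\<And>k. k \<in> A \<Longrightarrow> p k \<in> X) \<Longrightarrow> h \<in> X \<Longrightarrow> ipr (\<Sum>k\<in>A. c k *\<^sub>R p k) h = (\<Sum>k\<in>A. c k * ipr (p k) h)"
proof (induction A rule: infinite_finite_induct)
  case (insert k A)
  then have "(\<Sum>k\<in>A. c k *\<^sub>R p k) \<in> X" by (intro X_sum) auto
  then show ?case using insert X by (simp add: add scale subspace_scale)
qed (simp_all add: zero_left)

lemma diff: "f \<in> X \<Longrightarrow> g \<in> X \<Longrightarrow> h \<in> X \<Longrightarrow> ipr (f - g) h = ipr f h - ipr g h"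
  using add[of f "(- 1) *\<^sub>R g" h] scale[of g h "- 1"] X by (simp add: subspace_neg)

definition orthonormal :: "'v set \<Rightarrow> bool" where
  "orthonormal E \<longleftrightarrow> finite E \<and> E \<subseteq> X \<and> (\<forall>e\<in>E. \<forall>e'\<in>E. ipr e e' = (if e = e' then 1 else 0))"

definition pr :: "'v set \<Rightarrow> 'v \<Rightarrow> 'v" where
  "pr E f = (\<Sum>e\<in>E. ipr f e *\<^sub>R e)"

lemma pr_in_span: "pr E f \<in> span E"
  unfolding pr_def by (intro span_sum span_scale span_base)

lemma span_in_X: "E \<subseteq> X \<Longrightarrow> span E \<subseteq> X"
  using X by (simp add: span_minimal)

lemma pr_in_X: "orthonormal E \<Longrightarrow> pr E f \<in> X"
  using pr_in_span span_in_X by (auto simp: orthonormal_def)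

lemma residual_orthogonal_base:
  assumes E: "orthonormal E" and f: "f \<in> X" and e: "e \<in> E"
  shows "ipr (f - pr E f) e = 0"
proof -
  have "ipr (pr E f) e = (\<Sum>e'\<in>E. ipr f e' * ipr e' e)"
    unfolding pr_def using E e by (intro ipr_sum) (auto simp: orthonormal_def)
  also have "\<dots> = (\<Sum>e'\<in>E. if e' = e then ipr f e else 0)"
    using E e by (intro sum.cong) (auto simp: orthonormal_def)
  also have "\<dots> = ipr f e" using E e by (simp add: orthonormal_def)
  finally show ?thesis using diff[of f "pr E f" e] E f e pr_in_X[OF E] by (auto simp: orthonormal_def)
qed

lemma orthogonal_span:
  assumes E: "E \<subseteq> X" and h: "h \<in> X" "\<And>e. e \<in> E \<Longrightarrow> ipr h e = 0" and g: "g \<in> span E"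
  shows "ipr h g = 0"
proof -
  have "g \<in> X \<and> ipr g h = 0"
    using g
  proof (induction rule: span_induct)
    case base
    show ?case
      unfolding subspace_def using X h by (auto simp: subspace_0 zero_left subspace_add add subspace_scale scale)
  next
    case (step e)
    then show ?case using E h(1) h(2)[of e] comm[of e h] by auto
  qed
  then show ?thesis using comm h(1) by metis
qed

lemma pr_best:
  assumes E: "orthonormal E" and f: "f \<in> X" and g: "g \<in> span E"
  shows "N (f - pr E f) \<le> N (f - g)"
proof -
  have EX: "E \<subseteq> X" using E by (simp add: orthonormal_def)
  have gX: "g \<in> X" using g span_in_X[OF EX] by auto
  define r d where "r = f - pr E f" and "d = pr E f - g"
  have rX: "r \<in> X" and dX: "d \<in> X" using X f gX pr_in_X[OF E] by (auto simp: r_def d_def subspace_diff)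
  have ds: "d \<in> span E" unfolding d_def by (intro span_diff pr_in_span g)
  have rd: "ipr r d = 0"
    by (rule orthogonal_span[OF EX rX _ ds]) (simp add: r_def residual_orthogonal_base[OF E f])
  then have dr: "ipr d r = 0" using comm rX dX by metis
  have fg: "f - g = r + d" by (simp add: r_def d_def)
  have "ipr (r + d) (r + d) = ipr r (r + d) + ipr d (r + d)" using rX dX X by (simp add: add subspace_add)
  also have "\<dots> = ipr (r + d) r + ipr (r + d) d" using rX dX X comm by (simp add: subspace_add)
  also have "\<dots> = ipr r r + ipr d d" using rX dX X rd dr by (simp add: add)
  finally have "ipr r r \<le> ipr (f - g) (f - g)" using nonneg[OF dX] unfolding fg by simp
  then show ?thesis using N[OF rX] N[of "f - g"] X f gX by (simp add: subspace_diff r_def)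
qed

text \<open>Gram-Schmidt. A vector already in the span adds nothing, whence only an inequality
  between the cardinalities.\<close>

lemma orthonormal_basis_exists:
  assumes "finite B" "B \<subseteq> X"
  shows "\<exists>E. orthonormal E \<and> card E \<le> card B \<and> span E = span B"
  using assms
proof (induction B rule: finite_induct)
  case empty
  show ?case by (intro exI[of _ "{}"]) (auto simp: orthonormal_def)
next
  case (insert b B)
  then obtain E where E: "orthonormal E" "card E \<le> card B" "span E = span B" by auto
  have EX: "E \<subseteq> X" "finite E" using E by (auto simp: orthonormal_def)
  have bX: "b \<in> X" using insert by simp
  define r where "r = b - pr E b"
  have rX: "r \<in> X" using X bX pr_in_X[OF E(1)] by (simp add: r_def subspace_diff)
  show ?case
  proof (cases "r = 0")
    case True
    then have "b \<in> span B" using pr_in_span[of E b] E by (simp add: r_def)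
    then have "span (insert b B) = span B" by (rule span_redundant)
    then show ?thesis using E insert by (intro exI[of _ E]) auto
  next
    case False
    define s where "s = sqrt (ipr r r)"
    have "ipr r r > 0" using nonneg[OF rX] definite[OF rX] False by (auto simp: less_le)
    then have s: "s > 0" "s * s = ipr r r" by (auto simp: s_def)
    define e where "e = (1 / s) *\<^sub>R r"
    have eX: "e \<in> X" using X rX by (simp add: e_def subspace_scale)
    have er: "ipr e e = 1"
    proof -
      have "ipr e e = (1 / s) * ipr r e" using scale[OF rX eX, of "1 / s"] by (simp only: e_def[symmetric])
      also have "ipr r e = ipr e r" using rX eX by (rule comm)
      also have "ipr e r = (1 / s) * ipr r r" using scale[OF rX rX, of "1 / s"] by (simp only: e_def[symmetric])
      finally show ?thesis unfolding s(2)[symmetric] using s(1) by simp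
    qed
    have eo: "ipr e x = 0" if "x \<in> E" for x
      using residual_orthogonal_base[OF E(1) bX that] rX EX that by (simp add: e_def scale r_def[symmetric] subsetD)
    then have oe: "ipr x e = 0" if "x \<in> E" for x using comm[of x e] eX EX that by (auto simp: subsetD)
    have eE: "e \<notin> E" using eo er by force
    have "orthonormal (insert e E)"
      using E(1) eX er eo oe eE unfolding orthonormal_def by auto
    moreover have "card (insert e E) \<le> card (insert b B)" using E insert eE EX by simp
    moreover have "span (insert e E) = span (insert b B)"
      unfolding span_eq
    proof (rule conjI)
      show "insert e E \<subseteq> span (insert b B)"
      proof safe
        have "pr E b \<in> span (insert b B)" using pr_in_span[of E b] E span_mono[of B "insert b B"] by auto
        then have "r \<in> span (insert b B)" unfolding r_def by (rule span_diff[OF span_base[OF insertI1]])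
        then show "e \<in> span (insert b B)" unfolding e_def by (rule span_scale)
        show "x \<in> span (insert b B)" if "x \<in> E" for x
          using that span_base[of x E] E span_mono[of B "insert b B"] by auto
      qed
      show "insert b B \<subseteq> span (insert e E)"
      proof safe
        have "b = s *\<^sub>R e + pr E b" using s by (simp add: e_def r_def)
        moreover have "s *\<^sub>R e \<in> span (insert e E)" by (intro span_scale span_base) simp
        moreover have "pr E b \<in> span (insert e E)" using pr_in_span[of E b] span_mono[of E "insert e E"] by auto
        ultimately show "b \<in> span (insert e E)" using span_add by metis
        show "x \<in> span (insert e E)" if "x \<in> B" for x
          using span_base[OF that] E span_mono[of E "insert e E"] by auto
      qed
    qed
    ultimately show ?thesis by blast
  qed
qed

lemma dim_at_most_orthonormal:
  assumes "dim_at_most n L" "L \<subseteq> X"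
  obtains E where "orthonormal E" "card E \<le> n" "span E = L"
proof -
  obtain B where B: "finite B" "card B \<le> n" "span B = L" using assms by (auto simp: dim_at_most_def)
  then have "B \<subseteq> X" using assms span_superset by blast
  from orthonormal_basis_exists[OF B(1) this] that B show ?thesis by (metis order_trans)
qed

lemma linear_operator_pr: "orthonormal E \<Longrightarrow> linear_operator_in X (pr E)"
  unfolding linear_operator_in_def using pr_in_X
  by (auto simp: pr_def add scale orthonormal_def scaleR_left_distrib sum.distrib scaleR_sum_right subset_iff)

lemma pr_image: assumes "orthonormal E" shows "pr E ` X = span E"
proof
  show "pr E ` X \<subseteq> span E" using pr_in_span by auto
  show "span E \<subseteq> pr E ` X"
  proof
    fix g assume g: "g \<in> span E"
    have EX: "E \<subseteq> X" using assms by (simp add: orthonormal_def)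
    have gX: "g \<in> X" using g span_in_X[OF EX] by auto
    have "N (g - pr E g) \<le> N (g - g)" by (rule pr_best[OF assms gX g])
    moreover have "N (g - g) = 0" using N[of 0] X by (simp add: subspace_0 zero_left)
    moreover have rX: "g - pr E g \<in> X" using X gX pr_in_X[OF assms] by (simp add: subspace_diff)
    ultimately have "ipr (g - pr E g) (g - pr E g) = 0" using N[OF rX] nonneg[OF rX] by simp
    then have "g - pr E g = 0" by (rule definite[OF rX])
    then show "g \<in> pr E ` X" using gX by (intro image_eqI[of _ _ g]) auto
  qed
qed

theorem linear_width_eq_kolmogorov_width:
  assumes F: "F \<subseteq> X"
  shows "linear_width F X N n = kolmogorov_width F X N n"
proof (rule antisym)
  show "linear_width F X N n \<le> kolmogorov_width F X N n"
    unfolding kolmogorov_width_def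
  proof (rule INF_greatest)
    fix L assume "L \<in> {L. subspace L \<and> L \<subseteq> X \<and> dim_at_most n L}"
    then have L: "L \<subseteq> X" "dim_at_most n L" by auto
    obtain E where E: "orthonormal E" "card E \<le> n" "span E = L" using dim_at_most_orthonormal[OF L(2,1)] .
    have "linear_width F X N n \<le> (SUP f\<in>F. ereal (N (f - pr E f)))"
      unfolding linear_width_def using linear_operator_pr[OF E(1)] pr_image[OF E(1)] L E by (intro INF_lower) auto
    also have "\<dots> \<le> (SUP f\<in>F. INF g\<in>L. ereal (N (f - g)))"
      using F pr_best[OF E(1)] E(3) by (intro SUP_subset_mono[OF subset_refl] INF_greatest) auto
    finally show "linear_width F X N n \<le> (SUP f\<in>F. INF g\<in>L. ereal (N (f - g)))" .
  qed
  \<comment> \<open>The range of an admissible operator is an admissible subspace, and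
    \<open>A f\<close> is one of the competitors in it.\<close>
  show "kolmogorov_width F X N n \<le> linear_width F X N n"
    unfolding linear_width_def
  proof (rule INF_greatest)
    fix A assume "A \<in> {A. linear_operator_in X A \<and> dim_at_most n (A ` X)}"
    then have A: "linear_operator_in X A" "dim_at_most n (A ` X)" by auto
    have AX: "A ` X \<subseteq> X" using A by (simp add: linear_operator_in_def)
    obtain B where "span B = A ` X" using A by (auto simp: dim_at_most_def)
    then have "subspace (A ` X)" by (metis subspace_span)
    then have "kolmogorov_width F X N n \<le> (SUP f\<in>F. INF g\<in>A ` X. ereal (N (f - g)))"
      unfolding kolmogorov_width_def using A AX by (intro INF_lower) auto
    also have "\<dots> \<le> (SUP f\<in>F. ereal (N (f - A f)))"
      using F by (intro SUP_subset_mono[OF subset_refl] INF_lower) auto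
    finally show "kolmogorov_width F X N n \<le> (SUP f\<in>F. ereal (N (f - A f)))" .
  qed
qed

lemma kolmogorov_width_le:
  assumes "finite B" "card B \<le> n" "B \<subseteq> X" and approx: "\<And>f. f \<in> F \<Longrightarrow> \<exists>g\<in>span B. N (f - g) \<le> \<delta>"
  shows "kolmogorov_width F X N n \<le> ereal \<delta>"
proof -
  have "kolmogorov_width F X N n \<le> (SUP f\<in>F. INF g\<in>span B. ereal (N (f - g)))"
    unfolding kolmogorov_width_def using assms span_in_X[OF assms(3)]
    by (intro INF_lower) (auto simp: dim_at_most_def)
  also have "\<dots> \<le> ereal \<delta>"
  proof (rule SUP_least)
    fix f assume "f \<in> F"
    then obtain g where g: "g \<in> span B" "N (f - g) \<le> \<delta>" using approx by blast
    show "(INF g\<in>span B. ereal (N (f - g))) \<le> ereal \<delta>" by (rule INF_lower2[OF g(1)]) (simp add: g)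
  qed
  finally show ?thesis .
qed

text \<open>Orthogonality to a space of dimension at most \<open>n\<close> imposes at most
  \<open>n\<close> linear equations on more than \<open>n\<close> coefficients, so the sphere of
  radius \<open>\<delta>\<close> contains a point orthogonal to that space. Its distance from the
  space is at least its norm \<open>\<delta>\<close>.\<close>

lemma kolmogorov_width_ge:
  fixes p :: "'k \<Rightarrow> 'v"
  assumes K: "finite K" "n < card K" and p: "\<And>k. k \<in> K \<Longrightarrow> p k \<in> X"
    and on: "\<And>k l. k \<in> K \<Longrightarrow> l \<in> K \<Longrightarrow> ipr (p k) (p l) = (if k = l then 1 else 0)"
    and \<delta>: "\<delta> \<ge> 0" and F: "\<And>c. (\<Sum>k\<in>K. (c k)\<^sup>2) = \<delta>\<^sup>2 \<Longrightarrow> (\<Sum>k\<in>K. c k *\<^sub>R p k) \<in> F"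
  shows "ereal \<delta> \<le> kolmogorov_width F X N n"
  unfolding kolmogorov_width_def
proof (rule INF_greatest)
  fix L assume "L \<in> {L. subspace L \<and> L \<subseteq> X \<and> dim_at_most n L}"
  then have L: "L \<subseteq> X" "dim_at_most n L" by auto
  obtain E where E: "orthonormal E" "card E \<le> n" "span E = L" using dim_at_most_orthonormal[OF L(2,1)] .
  have EX: "E \<subseteq> X" "finite E" using E by (auto simp: orthonormal_def)
  obtain c where c: "\<exists>k\<in>K. c k \<noteq> 0" "\<forall>e\<in>E. (\<Sum>k\<in>K. c k * ipr (p k) e) = 0"
    using underdetermined_system[OF EX(2) K(1), of "\<lambda>k. ipr (p k)"] E(2) K(2) by auto
  define S where "S = (\<Sum>k\<in>K. (c k)\<^sup>2)"
  obtain k where k: "k \<in> K" "c k \<noteq> 0" using c by blast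
  have "(c k)\<^sup>2 \<le> S" unfolding S_def using K k by (intro member_le_sum) auto
  then have S: "S > 0" using k by (smt (verit) zero_less_power2)
  define c' where "c' k = \<delta> / sqrt S * c k" for k
  have c'S: "(\<Sum>k\<in>K. (c' k)\<^sup>2) = \<delta>\<^sup>2"
  proof -
    have "(\<Sum>k\<in>K. (c' k)\<^sup>2) = (\<delta> / sqrt S)\<^sup>2 * S"
      unfolding c'_def power_mult_distrib S_def sum_distrib_left by (rule refl)
    then show ?thesis using S by (simp add: power_divide)
  qed
  define f where "f = (\<Sum>k\<in>K. c' k *\<^sub>R p k)"
  have fF: "f \<in> F" unfolding f_def by (rule F[OF c'S])
  have fX: "f \<in> X" unfolding f_def using p by (rule X_sum)
  have fe: "ipr f e = 0" if "e \<in> E" for e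
  proof -
    have "ipr f e = (\<Sum>k\<in>K. c' k * ipr (p k) e)" unfolding f_def using p that EX by (intro ipr_sum) auto
    also have "\<dots> = \<delta> / sqrt S * (\<Sum>k\<in>K. c k * ipr (p k) e)" by (simp add: c'_def sum_distrib_left mult.assoc)
    finally show ?thesis using c that by simp
  qed
  have ff: "ipr f f = \<delta>\<^sup>2"
  proof -
    have pf: "ipr (p k) f = c' k" if "k \<in> K" for k
    proof -
      have "ipr (p k) f = ipr f (p k)" using comm p that fX by blast
      also have "\<dots> = (\<Sum>l\<in>K. c' l * ipr (p l) (p k))" unfolding f_def using p that by (intro ipr_sum) auto
      also have "\<dots> = (\<Sum>l\<in>K. if l = k then c' k else 0)" using on that by (intro sum.cong) auto
      finally show ?thesis using K that by simp
    qed
    have "ipr f f = (\<Sum>k\<in>K. c' k * ipr (p k) f)" by (subst f_def, rule ipr_sum) (use p fX in auto)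
    then show ?thesis using pf c'S by (simp add: power2_eq_square)
  qed
  have "\<delta> \<le> N (f - g)" if g: "g \<in> L" for g
  proof -
    have gX: "g \<in> X" using g L by auto
    have fg: "ipr f g = 0" using orthogonal_span[OF EX(1) fX fe] g E by blast
    then have gf: "ipr g f = 0" using comm fX gX by metis
    have d: "f - g \<in> X" using X fX gX by (simp add: subspace_diff)
    have "ipr (f - g) (f - g) = ipr f (f - g) - ipr g (f - g)" using fX gX d by (rule diff)
    also have "\<dots> = ipr (f - g) f - ipr (f - g) g" using comm fX gX d by metis
    also have "\<dots> = ipr f f + ipr g g" using fX gX fg gf by (simp add: diff)
    finally have "\<delta>\<^sup>2 \<le> ipr (f - g) (f - g)" using ff nonneg[OF gX] by simp
    then show ?thesis unfolding N[OF d] by (rule real_le_rsqrt)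
  qed
  then have "ereal \<delta> \<le> (INF g\<in>L. ereal (N (f - g)))" by (intro INF_greatest) simp
  also have "\<dots> \<le> (SUP f\<in>F. INF g\<in>L. ereal (N (f - g)))" using fF by (rule SUP_upper)
  finally show "ereal \<delta> \<le> (SUP f\<in>F. INF g\<in>L. ereal (N (f - g)))" .
qed

end

subsection \<open>Hyperbolic crosses\<close>

lemma harm_le_ln: "n > 0 \<Longrightarrow> harm n \<le> 1 + ln (real n)"
  using decseqD[OF decseq_harm_diff_ln, of 0 "n - 1"] by (simp add: harm_expand)

lemma harm_shift: "(\<Sum>s<n. 1 / (real s + 1)) = harm n"
  by (induction n) (simp_all add: harm_Suc harm_expand inverse_eq_divide add.commute)

definition hyp_cross :: "real \<Rightarrow> ('d::finite \<Rightarrow> nat) set" where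
  "hyp_cross T = {k. (\<Prod>i\<in>UNIV. real (k i) + 1) \<le> T}"

lemma hyp_cross_le:
  assumes "k \<in> hyp_cross T"
  shows "real (k i) + 1 \<le> T"
proof -
  have "real (k i) + 1 = (\<Prod>l\<in>{i}. real (k l) + 1)" by simp
  also have "\<dots> \<le> (\<Prod>l\<in>UNIV. real (k l) + 1)" by (intro prod_mono2) auto
  finally show ?thesis using assms by (simp add: hyp_cross_def)
qed

lemma hyp_cross_fin: "finite (hyp_cross T :: ('d::finite \<Rightarrow> nat) set)"
proof (rule finite_subset)
  show "hyp_cross T \<subseteq> PiE (UNIV :: 'd set) (\<lambda>_. {..nat \<lceil>T\<rceil>})"
  proof
    fix k :: "'d \<Rightarrow> nat" assume "k \<in> hyp_cross T"
    then have "real (k i) \<le> real (nat \<lceil>T\<rceil>)" for i using hyp_cross_le[of k T i] by linarith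
    then show "k \<in> PiE UNIV (\<lambda>_. {..nat \<lceil>T\<rceil>})" by (auto simp: PiE_def extensional_def)
  qed
qed (simp add: finite_PiE)

lemma hyp_cross_empty: "T < 1 \<Longrightarrow> hyp_cross T = {}"
  using hyp_cross_le by fastforce

lemma prod_split: "(\<Prod>i\<in>UNIV. real (k i) + 1) = (real (k j) + 1) * (\<Prod>i\<in>UNIV - {j}. real (k i) + 1)"
  for k :: "'d::finite \<Rightarrow> nat"
  by (rule prod.remove) auto

text \<open>Over given values \<open>y\<close> of the other coordinates, one coordinate takes at
  most \<open>T / Q y\<close> values. The sum of \<open>1 / Q y\<close> over the cube of side
  \<open>m\<close>, which contains every \<open>y\<close> that occurs, factors into
  \<open>CARD('d) - 1\<close> harmonic sums.\<close>

lemma card_hyp_cross_upper: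
  assumes T: "T \<ge> 1"
  shows "real (card (hyp_cross T :: ('d::finite \<Rightarrow> nat) set)) \<le> T * (1 + ln T) ^ (CARD('d) - 1)"
proof -
  fix j :: 'd
  define J where "J = UNIV - {j}"
  have J: "finite J" "card J = CARD('d) - 1" by (auto simp: J_def)
  define m where "m = nat \<lfloor>T\<rfloor>"
  have m: "m > 0" "real m \<le> T" using T by (auto simp: m_def)
  define Y where "Y = PiE J (\<lambda>_. {..<m})"
  define Q where "Q y = (\<Prod>i\<in>J. real (y i) + 1)" for y
  have Q: "Q y > 0" for y unfolding Q_def by (intro prod_pos) auto
  define Z where "Z y = {t. (real t + 1) * Q y \<le> T}" for y
  have Zsub: "Z y \<subseteq> {..<nat \<lfloor>T / Q y\<rfloor>}" for y
  proof
    fix t assume "t \<in> Z y"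
    then have "real t + 1 \<le> T / Q y" using Q[of y] by (simp add: Z_def field_simps)
    then show "t \<in> {..<nat \<lfloor>T / Q y\<rfloor>}" by simp linarith
  qed
  have Zfin: "finite (Z y)" for y by (rule finite_subset[OF Zsub]) simp
  have Zcard: "real (card (Z y)) \<le> T / Q y" for y
  proof -
    have "card (Z y) \<le> nat \<lfloor>T / Q y\<rfloor>" using card_mono[OF _ Zsub] by simp
    moreover have "0 \<le> T / Q y" using T Q[of y] by simp
    ultimately show ?thesis by (meson of_nat_floor of_nat_le_iff order_trans)
  qed
  have Yfin: "finite Y" using J by (simp add: Y_def finite_PiE)
  have "hyp_cross T \<subseteq> (\<lambda>(y, t). y(j := t)) ` (SIGMA y:Y. Z y)"
  proof
    fix k :: "'d \<Rightarrow> nat" assume k: "k \<in> hyp_cross T"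
    define y where "y = restrict k J"
    have "y \<in> Y"
    proof -
      have "k i < m" for i
      proof -
        have "real (k i) + 1 \<le> T" by (rule hyp_cross_le[OF k])
        then have "int (k i) + 1 \<le> \<lfloor>T\<rfloor>" by (simp add: le_floor_iff)
        then show ?thesis by (simp add: m_def)
      qed
      then show ?thesis by (auto simp: y_def Y_def)
    qed
    moreover have "k j \<in> Z y"
    proof -
      have "Q y = (\<Prod>i\<in>J. real (k i) + 1)" unfolding Q_def y_def by (intro prod.cong) auto
      then show ?thesis using k prod_split[of k j] by (simp add: Z_def hyp_cross_def J_def)
    qed
    moreover have "k = (\<lambda>i. if i = j then k j else k i)" by auto
    ultimately show "k \<in> (\<lambda>(y, t). y(j := t)) ` (SIGMA y:Y. Z y)"
      by (intro image_eqI[of _ _ "(y, k j)"]) (auto simp: y_def J_def fun_eq_iff)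
  qed
  then have "card (hyp_cross T :: ('d \<Rightarrow> nat) set) \<le> card (SIGMA y:Y. Z y)"
    using Yfin Zfin by (intro surj_card_le) auto
  also have "\<dots> = (\<Sum>y\<in>Y. card (Z y))" using Yfin Zfin by (intro card_SigmaI) auto
  finally have "real (card (hyp_cross T :: ('d \<Rightarrow> nat) set)) \<le> (\<Sum>y\<in>Y. real (card (Z y)))"
    by (metis of_nat_le_iff of_nat_sum)
  also have "\<dots> \<le> (\<Sum>y\<in>Y. T * (1 / Q y))" using Zcard by (intro sum_mono) simp
  also have "\<dots> = T * (\<Sum>y\<in>Y. \<Prod>i\<in>J. 1 / (real (y i) + 1))"
    by (simp add: sum_distrib_left Q_def prod_dividef)
  also have "(\<Sum>y\<in>Y. \<Prod>i\<in>J. 1 / (real (y i) + 1)) = (\<Prod>i\<in>J. \<Sum>s<m. 1 / (real s + 1))"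
    unfolding Y_def using J by (subst prod_sum_PiE) auto
  also have "\<dots> = harm m ^ (CARD('d) - 1)" using J by (simp add: harm_shift)
  also have "T * harm m ^ (CARD('d) - 1) \<le> T * (1 + ln T) ^ (CARD('d) - 1)"
  proof -
    have "harm m \<le> 1 + ln (real m)" using m by (intro harm_le_ln)
    also have "\<dots> \<le> 1 + ln T" using m T by simp
    finally show ?thesis using T by (intro mult_left_mono power_mono) (auto simp: harm_nonneg)
  qed
  finally show ?thesis .
qed

text \<open>Confining the other coordinates to a cube of side about
  \<open>S = T powr (1 / CARD('d))\<close> keeps \<open>Q y <= T\<close>, so rounding
  \<open>T / Q y\<close> down loses at most half. The sum again factors into harmonic numbers, each
  at least \<open>ln S = ln T / CARD('d)\<close>.\<close>

lemma card_hyp_cross_lower: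
  assumes T: "T \<ge> 1"
  shows "T / 2 * (ln T / CARD('d)) ^ (CARD('d) - 1) \<le> real (card (hyp_cross T :: ('d::finite \<Rightarrow> nat) set))"
proof -
  fix j :: 'd
  define J where "J = UNIV - {j}"
  have J: "finite J" "card J = CARD('d) - 1" "j \<notin> J" by (auto simp: J_def)
  define S where "S = T powr (1 / CARD('d))"
  have S: "S \<ge> 1" using T by (simp add: S_def ge_one_powr_ge_zero)
  have ST: "S ^ CARD('d) = T" using T by (simp add: S_def powr_realpow[symmetric] powr_powr)
  define m where "m = nat \<lfloor>S\<rfloor>"
  have m: "real m \<le> S" "S < real m + 1" using S by (auto simp: m_def)
  define Y where "Y = PiE J (\<lambda>_. {..<m})"
  define Q where "Q y = (\<Prod>i\<in>J. real (y i) + 1)" for y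
  have Q: "Q y > 0" for y unfolding Q_def by (intro prod_pos) auto
  have Q_le: "Q y \<le> T" if "y \<in> Y" for y
  proof -
    have "Q y \<le> (\<Prod>i\<in>J. S)" unfolding Q_def
    proof (intro prod_mono conjI)
      fix i assume "i \<in> J"
      then have "y i < m" using that by (auto simp: Y_def)
      then show "real (y i) + 1 \<le> S" using m(1) by linarith
    qed auto
    also have "\<dots> = S ^ (CARD('d) - 1)" using J by simp
    also have "\<dots> \<le> S ^ CARD('d)" using S by (intro power_increasing) auto
    finally show ?thesis using ST by simp
  qed
  define Z where "Z y = {..<nat \<lfloor>T / Q y\<rfloor>}" for y
  have Zcard: "T / 2 * (1 / Q y) \<le> real (card (Z y))" if "y \<in> Y" for y
  proof -
    have "1 \<le> T / Q y" using Q_le[OF that] Q[of y] by simp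
    moreover have "x / 2 \<le> real (nat \<lfloor>x\<rfloor>)" if "1 \<le> x" for x :: real
    proof -
      have "1 \<le> \<lfloor>x\<rfloor>" using that by simp
      then have "real (nat \<lfloor>x\<rfloor>) = of_int \<lfloor>x\<rfloor>" "(1::real) \<le> of_int \<lfloor>x\<rfloor>" by simp_all
      then show ?thesis using floor_correct[of x] by linarith
    qed
    ultimately have "T / Q y / 2 \<le> real (nat \<lfloor>T / Q y\<rfloor>)" by blast
    then show ?thesis by (simp add: Z_def)
  qed
  have Yfin: "finite Y" using J by (simp add: Y_def finite_PiE)
  have inj: "inj_on (\<lambda>(y, t). y(j := t)) (SIGMA y:Y. Z y)"
  proof (rule inj_onI, clarify)
    fix y t y' t' assume y: "y \<in> Y" "y' \<in> Y" and eq: "y(j := t) = y'(j := t')"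
    have "y i = y' i" for i
    proof (cases "i = j")
      case True
      then have "y i = undefined" "y' i = undefined" using y J by (auto simp: Y_def PiE_def extensional_def)
      then show ?thesis by simp
    next
      case False
      then show ?thesis using fun_cong[OF eq, of i] by simp
    qed
    then show "y = y' \<and> t = t'" using fun_cong[OF eq, of j] by auto
  qed
  have sub: "(\<lambda>(y, t). y(j := t)) ` (SIGMA y:Y. Z y) \<subseteq> hyp_cross T"
  proof safe
    fix y t assume yt: "y \<in> Y" "t \<in> Z y"
    define k where "k = y(j := t)"
    have "(\<Prod>i\<in>UNIV - {j}. real (k i) + 1) = Q y" unfolding Q_def J_def k_def by (intro prod.cong) auto
    moreover have "real t + 1 \<le> T / Q y" using yt(2) unfolding Z_def by simp linarith
    ultimately show "y(j := t) \<in> hyp_cross T"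
      using prod_split[of k j] Q[of y] by (simp add: hyp_cross_def k_def[symmetric]) (simp add: k_def field_simps)
  qed
  have "T / 2 * (ln T / CARD('d)) ^ (CARD('d) - 1) \<le> T / 2 * harm m ^ (CARD('d) - 1)"
  proof -
    have "ln T / CARD('d) = ln S" using T by (simp add: S_def ln_powr)
    also have "\<dots> \<le> ln (real m + 1)" using m S by simp
    also have "\<dots> \<le> harm m" by (rule ln_le_harm)
    finally show ?thesis using T by (intro mult_left_mono power_mono) auto
  qed
  also have "harm m ^ (CARD('d) - 1) = (\<Prod>i\<in>J. \<Sum>s<m. 1 / (real s + 1))" using J by (simp add: harm_shift)
  also have "\<dots> = (\<Sum>y\<in>Y. \<Prod>i\<in>J. 1 / (real (y i) + 1))"
    unfolding Y_def using J by (subst prod_sum_PiE) auto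
  also have "T / 2 * \<dots> = (\<Sum>y\<in>Y. T / 2 * (1 / Q y))"
    by (simp add: sum_distrib_left Q_def prod_dividef)
  also have "\<dots> \<le> (\<Sum>y\<in>Y. real (card (Z y)))" using Zcard by (intro sum_mono)
  also have "\<dots> = real (card (SIGMA y:Y. Z y))" using Yfin by (subst card_SigmaI) (auto simp: Z_def)
  also have "card (SIGMA y:Y. Z y) = card ((\<lambda>(y, t). y(j := t)) ` (SIGMA y:Y. Z y))" using inj by (simp add: card_image)
  also have "real \<dots> \<le> real (card (hyp_cross T :: ('d \<Rightarrow> nat) set))"
    using card_mono[OF hyp_cross_fin sub] by simp
  finally show ?thesis .
qed

lemma ln_ge_half: "n \<ge> 2 \<Longrightarrow> ln (real n) \<ge> 1 / 2"
proof -
  assume "n \<ge> 2"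
  then have "ln 2 \<le> ln (real n)" by simp
  moreover have "ln (exp (1/2)) \<le> ln (2 :: real)" using exp_half_le2 by (subst ln_le_cancel_iff) auto
  then have "ln 2 \<ge> (1/2 :: real)" by simp
  ultimately show ?thesis by linarith
qed

lemma hyp_cross_few:
  "\<exists>c>0. \<forall>n\<ge>2. card (hyp_cross (c * real n / ln (real n) ^ (CARD('d) - 1)) :: ('d::finite \<Rightarrow> nat) set) \<le> n"
proof -
  define D where "D = CARD('d) - 1"
  \<comment> \<open>This \<open>c\<close> serves twice: \<open>c <= (1/2) ^ D <= l ^ D\<close> gives
    \<open>T <= n\<close>, and \<open>c * 3 ^ D <= 1\<close> absorbs the bound
    \<open>1 + ln T <= 3 * l\<close>.\<close>
  define c :: real where "c = 1 / 6 ^ D"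
  have "card (hyp_cross (c * real n / ln (real n) ^ D) :: ('d \<Rightarrow> nat) set) \<le> n" if n: "n \<ge> 2" for n
  proof (cases "c * real n / ln (real n) ^ D \<ge> 1")
    case False
    then show ?thesis by (simp add: hyp_cross_empty)
  next
    case True
    define l where "l = ln (real n)"
    have l: "l \<ge> 1 / 2" unfolding l_def using n by (rule ln_ge_half)
    define T where "T = c * real n / l ^ D"
    have T: "T \<ge> 1" using True by (simp add: T_def l_def)
    have "(1 / 2) ^ D \<le> l ^ D" using l by (intro power_mono) auto
    then have "c \<le> l ^ D" by (simp add: c_def power_divide) (smt (verit) divide_left_mono power_mono zero_less_power mult_pos_pos)
    then have "T \<le> real n" using l mult_left_mono[OF \<open>c \<le> l ^ D\<close>, of "real n"]
      by (simp add: T_def divide_le_eq mult.commute)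
    then have "ln T \<le> l" unfolding l_def using T n by simp
    then have "1 + ln T \<le> 3 * l" using l by linarith
    then have "(1 + ln T) ^ D \<le> (3 * l) ^ D" using T by (intro power_mono) auto
    then have "T * (1 + ln T) ^ D \<le> T * (3 * l) ^ D" using T by (intro mult_left_mono) auto
    also have "\<dots> = c * 3 ^ D * real n" using l by (simp add: T_def power_mult_distrib)
    also have "\<dots> \<le> 1 * real n"
    proof (intro mult_right_mono)
      have "(3::real) ^ D \<le> 6 ^ D" by (intro power_mono) auto
      then show "c * 3 ^ D \<le> 1" by (simp add: c_def)
    qed auto
    finally have "real (card (hyp_cross T :: ('d \<Rightarrow> nat) set)) \<le> real n"
      using card_hyp_cross_upper[where 'd = 'd, OF T] by (simp add: D_def)
    then show ?thesis by (simp add: T_def l_def)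
  qed
  moreover have "c > 0" by (simp add: c_def)
  ultimately show ?thesis unfolding D_def by blast
qed

lemma hyp_cross_many:
  "\<exists>C>0. \<forall>n\<ge>2. n < card (hyp_cross (C * real n / ln (real n) ^ (CARD('d) - 1)) :: ('d::finite \<Rightarrow> nat) set)"
proof -
  define D d where "D = CARD('d) - 1" and "d = real CARD('d)"
  have d: "d > 0" by (simp add: d_def)
  \<comment> \<open>\<open>A\<close> comes from \<open>power_le_exp_real\<close> with
    \<open>s = 1/2\<close>: \<open>l ^ D <= A * sqrt n\<close> gives \<open>T >= sqrt n\<close>,
    hence \<open>ln T >= l / 2\<close>. The second summand of \<open>C\<close> outweighs the
    constants lost in \<open>card_hyp_cross_lower\<close> and leaves at least \<open>2 * n\<close>
    points.\<close>
  define A C :: real where "A = fact D * 2 ^ D" and "C = A + 4 * (2 * d) ^ D"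
  have A: "A > 0" by (simp add: A_def)
  have C: "C > 0" "C \<ge> A" "C \<ge> 4 * (2 * d) ^ D" using A d by (auto simp: C_def add_pos_pos)
  have "n < card (hyp_cross (C * real n / ln (real n) ^ D) :: ('d \<Rightarrow> nat) set)" if n: "n \<ge> 2" for n
  proof -
    define l where "l = ln (real n)"
    have l: "l \<ge> 1 / 2" unfolding l_def using n by (rule ln_ge_half)
    have lD: "l ^ D > 0" using l by simp
    define T where "T = C * real n / l ^ D"
    have "l ^ D \<le> fact D / (1/2) ^ D * exp (1 / 2 * l)" using l by (intro power_le_exp_real) auto
    also have "exp (1 / 2 * l) = sqrt (real n)"
      using n by (simp add: l_def powr_half_sqrt[symmetric] powr_def)
    finally have "l ^ D \<le> A * sqrt (real n)" by (simp add: A_def power_divide)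
    then have "l ^ D * sqrt (real n) \<le> A * (sqrt (real n) * sqrt (real n))"
      using mult_right_mono[of "l ^ D" "A * sqrt (real n)" "sqrt (real n)"] by (simp add: mult.assoc)
    also have "\<dots> \<le> C * real n" using C by (simp add: mult_right_mono)
    finally have sT: "sqrt (real n) \<le> T" using lD by (simp add: T_def pos_le_divide_eq mult.commute)
    then have T: "T \<ge> 1" using n by (intro order.trans[OF _ sT]) simp
    have "l / 2 = ln (sqrt (real n))" using n by (simp add: l_def ln_sqrt)
    also have "\<dots> \<le> ln T" using sT n T by (subst ln_le_cancel_iff) auto
    finally have "(l / 2 / d) ^ D \<le> (ln T / d) ^ D" using l d by (intro power_mono divide_right_mono) auto
    then have "T / 2 * (l / 2 / d) ^ D \<le> T / 2 * (ln T / d) ^ D" using T by (intro mult_left_mono) auto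
    also have "\<dots> \<le> real (card (hyp_cross T :: ('d \<Rightarrow> nat) set))"
      using card_hyp_cross_lower[where 'd = 'd, OF T] by (simp add: D_def d_def)
    finally have "T / 2 * (l / 2 / d) ^ D \<le> real (card (hyp_cross T :: ('d \<Rightarrow> nat) set))" .
    moreover have "T / 2 * (l / 2 / d) ^ D = C * real n / (2 * (2 * d) ^ D)"
      using lD d l by (simp add: T_def power_divide power_mult_distrib)
    moreover have "C * real n / (2 * (2 * d) ^ D) \<ge> 2 * real n"
    proof -
      have "4 * (2 * d) ^ D * real n \<le> C * real n" using C(3) by (intro mult_right_mono) auto
      then show ?thesis using d by (simp add: pos_le_divide_eq mult_ac)
    qed
    ultimately have "2 * real n \<le> real (card (hyp_cross T :: ('d \<Rightarrow> nat) set))" by linarith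
    then have "n < card (hyp_cross T :: ('d \<Rightarrow> nat) set)" using n by linarith
    then show ?thesis by (simp add: T_def l_def)
  qed
  then show ?thesis unfolding D_def using C(1) by blast
qed

subsection \<open>The norm equivalence and the widths\<close>

lemma ae_eq_rep [simp]: "ae_eq (rep_mfun F) (rep_mfun F)"
  by (rule Quotient3_rep_reflp[OF Quotient3_mfun])

lemma measurable_rep [measurable]: "rep_mfun F \<in> borel_measurable borel"
  using ae_eq_rep[of F] by (simp add: ae_eq_def)

lemma abs_rep [simp]: "abs_mfun (rep_mfun F) = F"
  by (rule Quotient3_abs_rep[OF Quotient3_mfun])

lemma ae_eq_refl: "f \<in> borel_measurable borel \<Longrightarrow> ae_eq f f"
  by (simp add: ae_eq_def)

lemma rep_abs: "f \<in> borel_measurable borel \<Longrightarrow> ae_eq (rep_mfun (abs_mfun f)) f"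
  using rep_abs_rsp_left[OF Quotient3_mfun ae_eq_refl] .

lemma mfun_eqI: "AE x in lborel. rep_mfun F x = rep_mfun G x \<Longrightarrow> F = G"
  using Quotient3_rel_rep[OF Quotient3_mfun, of F G] by (simp add: ae_eq_def)

lemma rep_add: "ae_eq (rep_mfun (F + G)) (\<lambda>x. rep_mfun F x + rep_mfun G x)"
  using plus_mfun.abs_eq[OF ae_eq_rep[of F] ae_eq_rep[of G]] rep_abs[of "\<lambda>x. rep_mfun F x + rep_mfun G x"] by simp

lemma rep_scaleR: "ae_eq (rep_mfun (c *\<^sub>R F)) (\<lambda>x. c * rep_mfun F x)"
  using scaleR_mfun.abs_eq[OF ae_eq_rep[of F], of c] rep_abs[of "\<lambda>x. c * rep_mfun F x"] by simp

lemma rep_zero: "ae_eq (rep_mfun 0) (\<lambda>_. 0)"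
  using rep_abs[of "\<lambda>_. 0"] by (simp add: zero_mfun.abs_eq)

lemma multi_deriv_continuous_compact:
  assumes "test_function \<phi>"
  shows "continuous_on UNIV (multi_deriv k \<phi>)" and "x \<notin> closure {x. \<phi> x \<noteq> 0} \<Longrightarrow> multi_deriv k \<phi> x = 0"
proof -
  show "continuous_on UNIV (multi_deriv k \<phi>)"
    unfolding multi_deriv_def using assms by (intro continuous_partials) (simp add: test_function_def)
  assume x: "x \<notin> closure {x. \<phi> x \<noteq> 0}"
  show "multi_deriv k \<phi> x = 0"
    unfolding multi_deriv_def
  proof (rule partials_zero_outside[where U = "- closure {x. \<phi> x \<noteq> 0}"])
    show "\<phi> y = 0" if "y \<in> - closure {x. \<phi> x \<noteq> 0}" for y
      using that closure_subset[of "{x. \<phi> x \<noteq> 0}"] by auto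
  qed (use x in auto)
qed

lemma multi_deriv_0: "multi_deriv (\<lambda>_. 0) \<phi> = \<phi>"
proof -
  define js where "js = (SOME js :: 'a list. \<forall>j. count_list js j = 0)"
  have c: "count_list js j = 0" for j unfolding js_def using count_list_SOME[of "\<lambda>_. 0" j] by simp
  have "js = []"
  proof (cases js)
    case (Cons y ys)
    then show ?thesis using c[of y] by simp
  qed
  then show ?thesis by (simp add: multi_deriv_def js_def[symmetric] partials_def)
qed

lemma locally_integrable_add:
  "locally_integrable f \<Longrightarrow> locally_integrable g \<Longrightarrow> locally_integrable (\<lambda>x. f x + g x)"
  by (auto simp: locally_integrable_def)

lemma locally_integrable_cmult: "locally_integrable f \<Longrightarrow> locally_integrable (\<lambda>x. c * f x)"
  by (auto simp: locally_integrable_def)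

lemma is_weak_deriv_add:
  assumes "is_weak_deriv k f g" "is_weak_deriv k f' g'"
    and m: "f \<in> borel_measurable borel" "g \<in> borel_measurable borel" "f' \<in> borel_measurable borel" "g' \<in> borel_measurable borel"
  shows "is_weak_deriv k (\<lambda>x. f x + f' x) (\<lambda>x. g x + g' x)"
  unfolding is_weak_deriv_def
proof (intro conjI allI impI)
  have loc: "locally_integrable f" "locally_integrable g" "locally_integrable f'" "locally_integrable g'"
    using assms(1,2) by (auto simp: is_weak_deriv_def)
  then show "locally_integrable (\<lambda>x. f x + f' x)" "locally_integrable (\<lambda>x. g x + g' x)"
    by (auto intro: locally_integrable_add)
  fix \<phi> :: "real ^ 'a \<Rightarrow> real" assume \<phi>: "test_function \<phi>"
  let ?K = "closure {x. \<phi> x \<noteq> 0}"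
  have K: "compact ?K" using \<phi> by (simp add: test_function_def)
  have md: "integrable lborel (\<lambda>x. u x * multi_deriv l \<phi> x)"
    if "locally_integrable u" "u \<in> borel_measurable borel" for u l
    by (rule locally_integrable_mult[OF that multi_deriv_continuous_compact(1)[OF \<phi>] K multi_deriv_continuous_compact(2)[OF \<phi>]])
  have i1: "integrable lborel (\<lambda>x. f x * multi_deriv k \<phi> x)" "integrable lborel (\<lambda>x. f' x * multi_deriv k \<phi> x)"
    using loc m by (auto intro!: md)
  have i2: "integrable lborel (\<lambda>x. g x * \<phi> x)" "integrable lborel (\<lambda>x. g' x * \<phi> x)"
    using loc m md[of _ "\<lambda>_. 0"] by (simp_all add: multi_deriv_0)
  show "(LBINT x. (f x + f' x) * multi_deriv k \<phi> x) = (- 1) ^ (\<Sum>j\<in>UNIV. k j) * (LBINT x. (g x + g' x) * \<phi> x)"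
    using assms(1,2) \<phi> i1 i2 by (simp add: is_weak_deriv_def distrib_right distrib_left)
qed

lemma is_weak_deriv_cmult:
  assumes "is_weak_deriv k f g"
  shows "is_weak_deriv k (\<lambda>x. c * f x) (\<lambda>x. c * g x)"
  using assms by (simp add: is_weak_deriv_def locally_integrable_cmult mult.assoc)

lemma has_weak_deriv_add:
  assumes "has_weak_deriv k F G" "has_weak_deriv k F' G'"
  shows "has_weak_deriv k (F + F') (G + G')"
  unfolding has_weak_deriv.rep_eq
  by (rule is_weak_deriv_cong[OF ae_eq_sym[OF rep_add] ae_eq_sym[OF rep_add]], rule is_weak_deriv_add)
    (use assms in \<open>auto simp: has_weak_deriv.rep_eq\<close>)

lemma has_weak_deriv_scaleR:
  assumes "has_weak_deriv k F G"
  shows "has_weak_deriv k (c *\<^sub>R F) (c *\<^sub>R G)"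
  unfolding has_weak_deriv.rep_eq
  by (rule is_weak_deriv_cong[OF ae_eq_sym[OF rep_scaleR] ae_eq_sym[OF rep_scaleR]], rule is_weak_deriv_cmult)
    (use assms in \<open>auto simp: has_weak_deriv.rep_eq\<close>)

context freud_weight
begin

abbreviation L2 :: "(real ^ 'd::finite) mfun set" where "L2 \<equiv> L2w (real e) a b"
abbreviation W2 :: "nat \<Rightarrow> (real ^ 'd::finite) mfun set" where "W2 r \<equiv> W2w r (real e) a b"
abbreviation N2 :: "(real ^ 'd::finite) mfun \<Rightarrow> real" where "N2 \<equiv> norm_L2w (real e) a b"

definition inner_mfun :: "(real ^ 'd::finite) mfun \<Rightarrow> (real ^ 'd) mfun \<Rightarrow> real" where
  "inner_mfun F G = ip (rep_mfun F) (rep_mfun G)"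

lemma L2_iff: "F \<in> L2 \<longleftrightarrow> sq_int (rep_mfun F)"
  by (simp add: L2w_def in_L2w.rep_eq sq_int_def power_mult_distrib weight_sq)

lemma N2_eq: "N2 F = sqrt (inner_mfun F F)"
  by (simp add: norm_L2w.rep_eq inner_mfun_def ip_def power_mult_distrib weight_sq) (simp add: power2_eq_square)

lemma sq_int_cong:
  assumes "ae_eq f g" "sq_int f"
  shows "sq_int g"
proof -
  have [measurable]: "f \<in> borel_measurable borel" "g \<in> borel_measurable borel" and ae: "AE x in lborel. f x = g x"
    using assms by (auto simp: ae_eq_def)
  have "integrable lborel (\<lambda>x. (f x)\<^sup>2 * WW x) \<longleftrightarrow> integrable lborel (\<lambda>x. (g x)\<^sup>2 * WW x)"
    by (intro integrable_cong_AE, measurable) (use ae in \<open>eventually_elim, simp\<close>)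
  then show ?thesis using assms by (simp add: sq_int_def)
qed

lemma ip_cong: "ae_eq f f' \<Longrightarrow> ae_eq g g' \<Longrightarrow> ip f g = ip f' g'"
  using ip_cong_AE[of f f' g] ip_cong_AE[of g g' f'] by (simp add: ae_eq_def ip_commute[of f'])

lemma inner_L2: "inner_subspace (L2 :: (real ^ 'd::finite) mfun set) inner_mfun N2"
proof
  show "subspace (L2 :: (real ^ 'd) mfun set)"
    unfolding subspace_def L2_iff
  proof (intro conjI ballI allI, simp_all only: L2_iff)
    show "sq_int (rep_mfun (0 :: (real ^ 'd) mfun))"
      by (rule sq_int_cong[OF ae_eq_sym[OF rep_zero] sq_int_zero])
    show "sq_int (rep_mfun (F + G))" if "sq_int (rep_mfun F)" "sq_int (rep_mfun G)" for F G :: "(real ^ 'd) mfun"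
      by (rule sq_int_cong[OF ae_eq_sym[OF rep_add] sq_int_add[OF that]])
    show "sq_int (rep_mfun (c *\<^sub>R F))" if "sq_int (rep_mfun F)" for c and F :: "(real ^ 'd) mfun"
      by (rule sq_int_cong[OF ae_eq_sym[OF rep_scaleR] sq_int_cmult[OF that]])
  qed
  fix f g k :: "(real ^ 'd) mfun"
  show "inner_mfun (f + g) k = inner_mfun f k + inner_mfun g k" if "f \<in> L2" "g \<in> L2" "k \<in> L2"
    unfolding inner_mfun_def ip_cong[OF rep_add ae_eq_rep] using that by (intro ip_add) (simp_all add: L2_iff)
  show "inner_mfun (c *\<^sub>R f) g = c * inner_mfun f g" for c
    unfolding inner_mfun_def ip_cong[OF rep_scaleR ae_eq_rep] by (rule ip_cmult)
  show "inner_mfun f g = inner_mfun g f" unfolding inner_mfun_def by (rule ip_commute)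
  show "inner_mfun f f \<ge> 0" unfolding inner_mfun_def by (rule ip_self_nonneg)
  show "f = 0" if f: "f \<in> L2" "inner_mfun f f = 0"
  proof -
    have s: "sq_int (rep_mfun f)" using f by (simp add: L2_iff)
    have "AE x in lborel. rep_mfun f x * rep_mfun f x * WW x = 0"
      using f(2) sq_int_mult[OF s s] unfolding inner_mfun_def ip_def
      by (subst (asm) integral_nonneg_eq_0_iff_AE) auto
    then have "AE x in lborel. rep_mfun f x = 0" by eventually_elim simp
    moreover have "AE x in lborel. rep_mfun (0 :: (real ^ 'd) mfun) x = 0" using rep_zero by (simp add: ae_eq_def)
    ultimately have "AE x in lborel. rep_mfun f x = rep_mfun 0 x" by eventually_elim simp
    then show "f = 0" by (rule mfun_eqI)
  qed
  show "N2 f = sqrt (inner_mfun f f)" by (rule N2_eq)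
qed

definition P_class :: "('d::finite \<Rightarrow> nat) \<Rightarrow> (real ^ 'd) mfun" where
  "P_class k = abs_mfun (P k)"

lemma rep_P_class: "ae_eq (rep_mfun (P_class k)) (P k)"
  unfolding P_class_def by (rule rep_abs) (rule sq_int_measurable[OF sq_int_P])

lemma P_class_L2: "P_class k \<in> L2"
  unfolding L2_iff by (rule sq_int_cong[OF ae_eq_sym[OF rep_P_class] sq_int_P])

lemma inner_mfun_P_class: "inner_mfun F (P_class k) = ip (rep_mfun F) (P k)"
  unfolding inner_mfun_def by (rule ip_cong[OF ae_eq_rep rep_P_class])

lemma inner_mfun_P_class_P_class: "inner_mfun (P_class k) (P_class l) = (if k = l then 1 else 0)"
  unfolding inner_mfun_def ip_cong[OF rep_P_class rep_P_class] by (rule ip_P)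

text \<open>The weak derivatives of polynomials are polynomials, hence square integrable against the
  weight.\<close>

lemma P_class_W2: "P_class k \<in> W2 r"
proof -
  have "\<exists>G\<in>L2. has_weak_deriv l (P_class k) G" for l
  proof -
    define Q where "Q = tensor (\<lambda>i. poly ((pderiv ^^ l i) (orth_poly (k i))))"
    have sQ: "sq_int Q" unfolding Q_def by (intro sq_int_tensor sq_int1_poly)
    have w: "is_weak_deriv l (P k) Q"
      unfolding is_weak_deriv_def
      using sq_int_locally_integrable[OF sq_int_P[of k]] sq_int_locally_integrable[OF sQ] tensor_poly_multi_deriv
      by (auto simp: P_def Q_def)
    have rQ: "ae_eq (rep_mfun (abs_mfun Q)) Q" by (rule rep_abs[OF sq_int_measurable[OF sQ]])
    have "has_weak_deriv l (P_class k) (abs_mfun Q)"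
      unfolding has_weak_deriv.rep_eq by (rule is_weak_deriv_cong[OF ae_eq_sym[OF rep_P_class] ae_eq_sym[OF rQ] w])
    moreover have "abs_mfun Q \<in> L2" unfolding L2_iff by (rule sq_int_cong[OF ae_eq_sym[OF rQ] sQ])
    ultimately show ?thesis by blast
  qed
  then show ?thesis using P_class_L2 by (simp add: W2w_def)
qed

lemma W2_sum:
  fixes A :: "('d::finite \<Rightarrow> nat) set"
  assumes "finite A" "A \<noteq> {}"
  shows "(\<Sum>k\<in>A. c k *\<^sub>R P_class k) \<in> W2 r"
proof -
  interpret inner_subspace "L2 :: (real ^ 'd) mfun set" inner_mfun N2 by (rule inner_L2)
  have sc: "x *\<^sub>R F \<in> W2 r" if F: "F \<in> W2 r" for x and F :: "(real ^ 'd) mfun"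
    unfolding W2w_def
  proof safe
    show "x *\<^sub>R F \<in> L2" using F X by (auto simp: W2w_def intro: subspace_scale)
    fix l :: "'d \<Rightarrow> nat" assume l: "\<forall>j. l j \<le> r"
    then obtain F' where "F' \<in> L2" "has_weak_deriv l F F'" using F unfolding W2w_def by blast
    then show "\<exists>g\<in>L2. has_weak_deriv l (x *\<^sub>R F) g"
      using X by (intro bexI[of _ "x *\<^sub>R F'"] has_weak_deriv_scaleR) (auto intro: subspace_scale)
  qed
  have ad: "F + G \<in> W2 r" if FG: "F \<in> W2 r" "G \<in> W2 r" for F G :: "(real ^ 'd) mfun"
    unfolding W2w_def
  proof safe
    show "F + G \<in> L2" using FG X by (auto simp: W2w_def intro: subspace_add)
    fix l :: "'d \<Rightarrow> nat" assume l: "\<forall>j. l j \<le> r"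
    then obtain F' G' where "F' \<in> L2" "has_weak_deriv l F F'" "G' \<in> L2" "has_weak_deriv l G G'"
      using FG unfolding W2w_def by blast
    then show "\<exists>g\<in>L2. has_weak_deriv l (F + G) g"
      using X by (intro bexI[of _ "F' + G'"] has_weak_deriv_add) (auto intro: subspace_add)
  qed
  show ?thesis using assms by (induction A rule: finite_ne_induct) (auto intro: sc ad P_class_W2)
qed

definition growth :: "nat \<Rightarrow> real" where "growth m = (real m + 1) powr (2 * sigma)"

lemma banded_exists: "\<exists>q c1 c2. banded growth alpha beta q c1 c2"
proof -
  obtain c1 c2 where c: "c1 > 0" "c2 > 0" "\<And>n. c1 * real (Suc n) powr (2 * sigma) \<le> (alpha (Suc n))\<^sup>2"
      "\<And>n. (alpha (Suc n))\<^sup>2 \<le> c2 * real (Suc n) powr (2 * sigma)"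
    using alpha_sq_bounds by blast
  obtain q where q: "q \<ge> 0" "q < 1" "\<And>n. beta (n + 3) \<le> q * alpha (n + 3)" using beta_le_alpha by blast
  have s: "0 \<le> 2 * sigma" "2 * sigma \<le> 2" by (auto simp: sigma_bounds)
  have "banded growth alpha beta q c1 c2"
  proof
    show "growth 0 = 1" by (simp add: growth_def)
    show "growth m \<le> growth n" if "m \<le> n" for m n unfolding growth_def using that s by (intro powr_mono2) auto
    show "growth (Suc m) \<le> 4 * growth m" for m
    proof -
      have "growth (Suc m) \<le> (2 * (real m + 1)) powr (2 * sigma)" unfolding growth_def using s by (intro powr_mono2) auto
      also have "\<dots> = 2 powr (2 * sigma) * growth m" unfolding growth_def by (subst powr_mult) auto
      also have "\<dots> \<le> 2 powr 2 * growth m" using s by (intro mult_right_mono powr_mono) (auto simp: growth_def)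
      finally show ?thesis by simp
    qed
    show "growth m \<le> (real m + 1)\<^sup>2" for m
    proof -
      have "growth m \<le> (real m + 1) powr 2" unfolding growth_def using s by (intro powr_mono) auto
      then show ?thesis by simp
    qed
    show "0 \<le> q" "q < 1" "beta (m + 3) \<le> q * alpha (m + 3)" for m using q by auto
    show "0 \<le> beta (m + 3)" "alpha m \<ge> 0" for m by (rule beta_nonneg, rule alpha_nonneg)
    show "alpha 0 = 0" by (simp add: alpha_def step1_coeff_def)
    show "c1 > 0" "c2 > 0" using c by auto
    show "c1 * growth m \<le> (alpha (m + 1))\<^sup>2" "(alpha (m + 1))\<^sup>2 \<le> c2 * growth m" for m
      using c(3,4)[of m] by (simp_all add: growth_def add.commute)
  qed
  then show ?thesis by blast
qed

text \<open>The coefficient arrays of the weak derivatives form a family for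
  \<open>band_family\<close>; Bessel's inequality supplies its boundedness hypothesis, and
  Parseval's identity turns the squared Sobolev norm into the sum of their unweighted sums.\<close>

theorem norm_equivalence:
  "\<exists>C\<ge>1. \<forall>F\<in>W2 r. wsum growth (\<lambda>_. r) (\<lambda>k. inner_mfun F (P_class k)) \<le> ennreal (C * (norm_W2w r (real e) a b F)\<^sup>2) \<and>
     ennreal ((norm_W2w r (real e) a b F)\<^sup>2) \<le> ennreal C * wsum growth (\<lambda>_. r) (\<lambda>k::'d::finite \<Rightarrow> nat. inner_mfun F (P_class k))"
proof -
  obtain q c1 c2 where "banded growth alpha beta q c1 c2" using banded_exists by blast
  then interpret B: banded growth alpha beta q c1 c2 .
  define C1 C2 where "C1 = (1 + 4 * 4 ^ r / (c1 * (1 - q)\<^sup>2)) ^ (r * CARD('d))"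
    and "C2 = (real r + 1) ^ CARD('d) * (1 + 4 * c2) ^ (r * CARD('d))"
  have C0: "C1 \<ge> 0" "C2 \<ge> 0" using B.c1 B.c2 by (auto simp: C1_def C2_def)
  have main: "wsum growth (\<lambda>_. r) (\<lambda>k. inner_mfun F (P_class k)) \<le> ennreal (C1 * (norm_W2w r (real e) a b F)\<^sup>2) \<and>
     ennreal ((norm_W2w r (real e) a b F)\<^sup>2) \<le> ennreal C2 * wsum growth (\<lambda>_. r) (\<lambda>k. inner_mfun F (P_class k))"
    if F: "F \<in> W2 r" for F :: "(real ^ 'd) mfun"
  proof -
    define G where "G l = weak_deriv l F" for l
    have G: "has_weak_deriv l F (G l)" "sq_int (rep_mfun (G l))" if l: "\<And>i. l i \<le> r" for l
    proof -
      obtain g where g: "g \<in> L2" "has_weak_deriv l F g" using F l unfolding W2w_def by blast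
      then have "G l = g" unfolding G_def by (intro weak_deriv_eqI)
      then show "has_weak_deriv l F (G l)" "sq_int (rep_mfun (G l))" using g by (auto simp: L2_iff)
    qed
    have sF: "sq_int (rep_mfun F)" using F by (simp add: W2w_def L2_iff)
    have G0: "G (\<lambda>_. 0) = F"
      unfolding G_def
    proof (rule weak_deriv_eqI)
      show "has_weak_deriv (\<lambda>_. 0) F F"
        unfolding has_weak_deriv.rep_eq is_weak_deriv_def
        by (simp add: multi_deriv_0 sq_int_locally_integrable[OF sF])
    qed
    define c where "c l k = ip (rep_mfun (G l)) (P k)" for l k
    have rec: "c (shift j 1 l) = B.band j (c l)" if l: "\<And>i. shift j 1 l i \<le> r" for l j
    proof
      fix k
      have "l i \<le> r" for i using l[of i] by (auto simp: shift_apply split: if_splits)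
      note Gl = G[of l, OF this]
      note Gs = G[of "shift j 1 l", OF l]
      show "c (shift j 1 l) k = B.band j (c l) k"
        unfolding c_def B.band_def
        by (rule weak_deriv_coefficient_relation[OF Gl(2) Gl(1)[unfolded has_weak_deriv.rep_eq] Gs(2) Gs(1)[unfolded has_weak_deriv.rep_eq]])
    qed
    have bdd: "\<exists>B. \<forall>k. \<bar>c l k\<bar> \<le> B" if l: "\<And>i. l i \<le> r" for l
    proof (intro exI allI)
      fix k
      have "(c l k)\<^sup>2 \<le> ip (rep_mfun (G l)) (rep_mfun (G l))"
        using bessel[OF G(2)[of l, OF l], of "{k}"] by (simp add: c_def)
      then show "\<bar>c l k\<bar> \<le> sqrt (ip (rep_mfun (G l)) (rep_mfun (G l)))"
        by (metis real_sqrt_abs real_sqrt_le_mono)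
    qed
    have ws: "wsum growth (\<lambda>_. 0) (c l) = ennreal ((N2 (G l))\<^sup>2)" if l: "\<And>i. l i \<le> r" for l
    proof -
      have "wsum growth (\<lambda>_. 0) (c l) = ennreal (ip (rep_mfun (G l)) (rep_mfun (G l)))"
        unfolding parseval[OF G(2)[of l, OF l], symmetric] by (simp add: wsum_def c_def)
      then show ?thesis by (simp add: N2_eq inner_mfun_def ip_self_nonneg)
    qed
    have "(\<Sum>l | \<forall>i. l i \<le> r. wsum growth (\<lambda>_. 0) (c l)) = (\<Sum>l | \<forall>i. l i \<le> r. ennreal ((N2 (G l))\<^sup>2))"
      by (intro sum.cong) (auto simp: ws)
    also have "\<dots> = ennreal (\<Sum>l | \<forall>i. l i \<le> r. (N2 (G l))\<^sup>2)" by (rule sum_ennreal) auto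
    also have "(\<Sum>l | \<forall>i. l i \<le> r. (N2 (G l))\<^sup>2) = (norm_W2w r (real e) a b F)\<^sup>2"
      by (simp add: norm_W2w_def G_def sum_nonneg)
    finally have S: "(\<Sum>l | \<forall>i. l i \<le> r. wsum growth (\<lambda>_. 0) (c l)) = ennreal ((norm_W2w r (real e) a b F)\<^sup>2)" .
    have c0: "c (\<lambda>_. 0) = (\<lambda>k. inner_mfun F (P_class k))" by (simp add: fun_eq_iff c_def G0 inner_mfun_P_class)
    note fam = B.band_family[where c = c and r = r, OF rec bdd]
    have "wsum growth (\<lambda>_. r) (\<lambda>k. inner_mfun F (P_class k)) \<le> ennreal (C1 * (norm_W2w r (real e) a b F)\<^sup>2)"
      using fam(1) C0 unfolding S c0 C1_def[symmetric] by (simp add: ennreal_mult)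
    moreover have "ennreal ((norm_W2w r (real e) a b F)\<^sup>2) \<le> ennreal C2 * wsum growth (\<lambda>_. r) (\<lambda>k. inner_mfun F (P_class k))"
      using fam(2) unfolding S c0 by (simp add: C2_def)
    ultimately show ?thesis ..
  qed
  define C where "C = 1 + C1 + C2"
  have C: "C \<ge> 1" "C1 \<le> C" "C2 \<le> C" using C0 by (auto simp: C_def)
  have "wsum growth (\<lambda>_. r) (\<lambda>k. inner_mfun F (P_class k)) \<le> ennreal (C * (norm_W2w r (real e) a b F)\<^sup>2) \<and>
     ennreal ((norm_W2w r (real e) a b F)\<^sup>2) \<le> ennreal C * wsum growth (\<lambda>_. r) (\<lambda>k. inner_mfun F (P_class k))"
    if "F \<in> W2 r" for F :: "(real ^ 'd) mfun"
  proof
    have "C1 * (norm_W2w r (real e) a b F)\<^sup>2 \<le> C * (norm_W2w r (real e) a b F)\<^sup>2"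
      using C by (intro mult_right_mono) auto
    then show "wsum growth (\<lambda>_. r) (\<lambda>k. inner_mfun F (P_class k)) \<le> ennreal (C * (norm_W2w r (real e) a b F)\<^sup>2)"
      by (rule order.trans[OF conjunct1[OF main[OF that]] ennreal_leI])
    have "ennreal C2 * wsum growth (\<lambda>_. r) (\<lambda>k. inner_mfun F (P_class k)) \<le> ennreal C * wsum growth (\<lambda>_. r) (\<lambda>k. inner_mfun F (P_class k))"
      using C by (intro mult_right_mono ennreal_leI) auto
    then show "ennreal ((norm_W2w r (real e) a b F)\<^sup>2) \<le> ennreal C * wsum growth (\<lambda>_. r) (\<lambda>k. inner_mfun F (P_class k))"
      by (rule order.trans[OF conjunct2[OF main[OF that]]])
  qed
  then show ?thesis using C(1) by blast
qed

end

section \<open>From the norm equivalence to bounds for the widths\<close>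

lemma (in inner_subspace) ipr_residual:
  assumes E: "orthonormal E" and f: "f \<in> X"
  shows "ipr (f - pr E f) (f - pr E f) = ipr f f - (\<Sum>e\<in>E. (ipr f e)\<^sup>2)"
proof -
  have EX: "E \<subseteq> X" using E by (simp add: orthonormal_def)
  have pX: "pr E f \<in> X" using E by (rule pr_in_X)
  have rX: "f - pr E f \<in> X" using X f pX by (simp add: subspace_diff)
  have "ipr (f - pr E f) (pr E f) = 0"
    by (rule orthogonal_span[OF EX rX residual_orthogonal_base[OF E f] pr_in_span])
  then have "ipr (pr E f) (f - pr E f) = 0" using comm[OF rX pX] by simp
  then have "ipr (f - pr E f) (f - pr E f) = ipr (f - pr E f) f"
    using diff[OF f pX rX] comm[OF rX f] by simp
  also have "\<dots> = ipr f f - ipr (pr E f) f" by (rule diff[OF f pX f])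
  also have "ipr (pr E f) f = (\<Sum>e\<in>E. ipr f e * ipr e f)"
    unfolding pr_def using EX f by (intro ipr_sum) auto
  also have "\<dots> = (\<Sum>e\<in>E. (ipr f e)\<^sup>2)"
    using EX comm f by (intro sum.cong) (auto simp: power2_eq_square)
  finally show ?thesis .
qed

context freud_weight
begin

text \<open>With the same exponent in every direction only the product over the coordinates matters,
  and its sublevel sets are the hyperbolic crosses.\<close>

lemma wsum_growth:
  "wsum growth (\<lambda>_. r) u = (\<integral>\<^sup>+k. ennreal ((\<Prod>i\<in>UNIV. real (k i) + 1) powr (2 * (sigma * real r)) * (u k)\<^sup>2) \<partial>count_space UNIV)"
proof -
  have "growth m ^ r = (real m + 1) powr (2 * (sigma * real r))" for m
    unfolding growth_def by (subst powr_power) (auto simp: mult_ac)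
  then show ?thesis unfolding wsum_def by (simp add: prod_powr_distrib)
qed

lemma inner_mfun_parseval:
  assumes "F \<in> L2"
  shows "(\<integral>\<^sup>+k. ennreal ((inner_mfun F (P_class k))\<^sup>2) \<partial>count_space UNIV) = ennreal (inner_mfun F F)"
  using parseval[of "rep_mfun F"] assms by (simp add: L2_iff inner_mfun_P_class inner_mfun_def[of F F])

text \<open>A Chebyshev estimate: outside \<open>hyp_cross T\<close> the weight is at least
  \<open>T powr (2 * (sigma * real r))\<close>.\<close>

lemma hyp_cross_tail:
  fixes F :: "(real ^ 'd::finite) mfun"
  assumes F: "F \<in> L2" and T: "T > 0" and B: "B \<ge> 0"
    and bound: "wsum growth (\<lambda>_. r) (\<lambda>k. inner_mfun F (P_class k)) \<le> ennreal B"
  shows "inner_mfun F F - (\<Sum>k\<in>hyp_cross T. (inner_mfun F (P_class k))\<^sup>2) \<le> B / T powr (2 * (sigma * real r))"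
proof -
  define c where "c k = (inner_mfun F (P_class k))\<^sup>2" for k :: "'d \<Rightarrow> nat"
  define s where "s = 2 * (sigma * real r)"
  have s: "s \<ge> 0" by (simp add: s_def sigma_bounds)
  define Y where "Y = (\<integral>\<^sup>+k. ennreal (c k) * indicator (- hyp_cross T) k \<partial>count_space UNIV)"
  have "ennreal (inner_mfun F F) = (\<integral>\<^sup>+k. ennreal (c k) * indicator (hyp_cross T) k + ennreal (c k) * indicator (- hyp_cross T) k \<partial>count_space UNIV)"
    unfolding inner_mfun_parseval[OF F, symmetric] c_def by (intro nn_integral_cong) (auto split: split_indicator)
  also have "\<dots> = (\<integral>\<^sup>+k. ennreal (c k) * indicator (hyp_cross T) k \<partial>count_space UNIV) + Y"
    unfolding Y_def by (intro nn_integral_add) auto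
  also have "(\<integral>\<^sup>+k. ennreal (c k) * indicator (hyp_cross T) k \<partial>count_space UNIV) = (\<Sum>k\<in>hyp_cross T. ennreal (c k) * indicator (hyp_cross T) k)"
    by (intro nn_integral_count_space') (auto simp: hyp_cross_fin)
  also have "\<dots> = ennreal (\<Sum>k\<in>hyp_cross T. c k)" by (simp add: sum_ennreal c_def)
  finally have eq: "ennreal (inner_mfun F F) = ennreal (\<Sum>k\<in>hyp_cross T. c k) + Y" .
  then have "Y \<noteq> \<infinity>" by (metis ennreal_add_eq_top ennreal_neq_top infinity_ennreal_def)
  then obtain y where y: "y \<ge> 0" "Y = ennreal y" by (cases Y) auto
  have c0: "(\<Sum>k\<in>hyp_cross T. c k) \<ge> 0" by (simp add: sum_nonneg c_def)
  have m0: "inner_mfun F F \<ge> 0" unfolding inner_mfun_def by (rule ip_self_nonneg)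
  have "inner_mfun F F = (\<Sum>k\<in>hyp_cross T. c k) + y"
    using eq c0 y m0 by (simp flip: ennreal_plus)
  moreover have "T powr s * y \<le> B"
  proof -
    have "ennreal (T powr s * y) = ennreal (T powr s) * Y" using y by (simp add: ennreal_mult)
    also have "\<dots> = (\<integral>\<^sup>+k. ennreal (T powr s) * (ennreal (c k) * indicator (- hyp_cross T) k) \<partial>count_space UNIV)"
      unfolding Y_def by (simp add: nn_integral_cmult)
    also have "\<dots> \<le> wsum growth (\<lambda>_. r) (\<lambda>k. inner_mfun F (P_class k))"
      unfolding wsum_growth
    proof (intro nn_integral_mono)
      fix k :: "'d \<Rightarrow> nat"
      show "ennreal (T powr s) * (ennreal (c k) * indicator (- hyp_cross T) k) \<le>
          ennreal ((\<Prod>i\<in>UNIV. real (k i) + 1) powr (2 * (sigma * real r)) * (inner_mfun F (P_class k))\<^sup>2)"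
      proof (cases "k \<in> hyp_cross T")
        case False
        then have "T powr s \<le> (\<Prod>i\<in>UNIV. real (k i) + 1) powr s"
          using T s by (intro powr_mono2) (auto simp: hyp_cross_def)
        then have "T powr s * c k \<le> (\<Prod>i\<in>UNIV. real (k i) + 1) powr s * c k"
          by (intro mult_right_mono) (auto simp: c_def)
        then show ?thesis using False by (simp add: ennreal_mult[symmetric] c_def s_def ennreal_leI)
      qed simp
    qed
    also have "\<dots> \<le> ennreal B" by (rule bound)
    finally show ?thesis using B by simp
  qed
  ultimately show ?thesis using T by (simp add: c_def s_def pos_le_divide_eq mult.commute)
qed

lemma width_upper:
  fixes BW :: "(real ^ 'd::finite) mfun set" and r :: nat
  defines "BW \<equiv> unit_ball_W2w r (real e) a b"
  shows "\<exists>C>0. \<forall>T n. T > 0 \<longrightarrow> card (hyp_cross T :: ('d \<Rightarrow> nat) set) \<le> n \<longrightarrow>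
    kolmogorov_width BW L2 N2 n \<le> ereal (C * T powr (- (sigma * real r)))"
proof -
  interpret inner_subspace "L2 :: (real ^ 'd) mfun set" inner_mfun N2 by (rule inner_L2)
  obtain C where C: "C \<ge> 1" "\<And>F :: (real ^ 'd) mfun. F \<in> W2 r \<Longrightarrow>
      wsum growth (\<lambda>_. r) (\<lambda>k. inner_mfun F (P_class k)) \<le> ennreal (C * (norm_W2w r (real e) a b F)\<^sup>2)"
    using norm_equivalence[where 'd = 'd, of r] by blast
  have "kolmogorov_width BW L2 N2 n \<le> ereal (sqrt C * T powr (- (sigma * real r)))"
    if T: "T > 0" and n: "card (hyp_cross T :: ('d \<Rightarrow> nat) set) \<le> n" for T n
  proof (rule kolmogorov_width_le)
    define A where "A = (hyp_cross T :: ('d \<Rightarrow> nat) set)"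
    have inj: "inj_on P_class A"
      by (rule inj_onI) (metis inner_mfun_P_class_P_class zero_neq_one)
    show "finite (P_class ` A)" by (simp add: A_def hyp_cross_fin)
    show "card (P_class ` A) \<le> n" unfolding card_image[OF inj] using n by (simp add: A_def)
    show sub: "P_class ` A \<subseteq> L2" using P_class_L2 by auto
    have on: "orthonormal (P_class ` A)"
      unfolding orthonormal_def using sub hyp_cross_fin by (auto simp: inner_mfun_P_class_P_class A_def dest: inj_onD[OF inj])
    fix F :: "(real ^ 'd) mfun" assume "F \<in> BW"
    then have F: "F \<in> W2 r" "norm_W2w r (real e) a b F \<le> 1" by (auto simp: BW_def unit_ball_W2w_def)
    have FL: "F \<in> L2" using F by (simp add: W2w_def)
    have "norm_W2w r (real e) a b F \<ge> 0" by (simp add: norm_W2w_def sum_nonneg)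
    then have "(norm_W2w r (real e) a b F)\<^sup>2 \<le> 1" using F(2) by (simp add: power_le_one)
    then have "C * (norm_W2w r (real e) a b F)\<^sup>2 \<le> C" using C(1) by (simp add: mult_left_le)
    then have "wsum growth (\<lambda>_. r) (\<lambda>k. inner_mfun F (P_class k)) \<le> ennreal C"
      using C(2)[OF F(1)] by (meson ennreal_leI order_trans)
    then have "inner_mfun F F - (\<Sum>k\<in>A. (inner_mfun F (P_class k))\<^sup>2) \<le> C / T powr (2 * (sigma * real r))"
      unfolding A_def using C(1) by (intro hyp_cross_tail FL T) auto
    moreover have "(\<Sum>k\<in>A. (inner_mfun F (P_class k))\<^sup>2) = (\<Sum>p\<in>P_class ` A. (inner_mfun F p)\<^sup>2)"
      by (simp add: sum.reindex[OF inj])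
    ultimately have "inner_mfun (F - pr (P_class ` A) F) (F - pr (P_class ` A) F) \<le> C / T powr (2 * (sigma * real r))"
      unfolding ipr_residual[OF on FL] by simp
    then have "N2 (F - pr (P_class ` A) F) \<le> sqrt (C / T powr (2 * (sigma * real r)))"
      by (simp add: N2_eq)
    also have "\<dots> = sqrt C * T powr (- (sigma * real r))"
    proof -
      have "T powr (2 * (sigma * real r)) = (T powr (sigma * real r))\<^sup>2"
        by (simp only: power2_eq_square powr_add[symmetric] mult_2)
      then show ?thesis using T by (simp add: real_sqrt_divide powr_minus_divide)
    qed
    finally show "\<exists>g\<in>span (P_class ` A). N2 (F - g) \<le> sqrt C * T powr (- (sigma * real r))"
      using pr_in_span by blast
  qed
  then show ?thesis using C(1) by (intro exI[of _ "sqrt C"]) auto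
qed

text \<open>A Bernstein-type inequality: inside the cross the weights are at most
  \<open>T powr s\<close>, so the sphere with squared radius \<open>1 / (C * T powr s)\<close> in
  the span lies in the unit ball, and more than \<open>n\<close> orthonormal directions are
  available.\<close>

lemma width_lower:
  fixes BW :: "(real ^ 'd::finite) mfun set" and r :: nat
  defines "BW \<equiv> unit_ball_W2w r (real e) a b"
  shows "\<exists>c>0. \<forall>T n. T > 0 \<longrightarrow> n < card (hyp_cross T :: ('d \<Rightarrow> nat) set) \<longrightarrow>
    ereal (c * T powr (- (sigma * real r))) \<le> kolmogorov_width BW L2 N2 n"
proof -
  interpret inner_subspace "L2 :: (real ^ 'd) mfun set" inner_mfun N2 by (rule inner_L2)
  obtain C where C: "C \<ge> 1" "\<And>F :: (real ^ 'd) mfun. F \<in> W2 r \<Longrightarrow>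
      ennreal ((norm_W2w r (real e) a b F)\<^sup>2) \<le> ennreal C * wsum growth (\<lambda>_. r) (\<lambda>k. inner_mfun F (P_class k))"
    using norm_equivalence[where 'd = 'd, of r] by blast
  define c where "c = 1 / sqrt C"
  have c: "c > 0" using C by (simp add: c_def)
  have "ereal (c * T powr (- (sigma * real r))) \<le> kolmogorov_width BW L2 N2 n"
    if T: "T > 0" and n: "n < card (hyp_cross T :: ('d \<Rightarrow> nat) set)" for T n
  proof (rule kolmogorov_width_ge[where p = P_class and K = "hyp_cross T"])
    define s where "s = 2 * (sigma * real r)"
    have s: "s \<ge> 0" by (simp add: s_def sigma_bounds)
    let ?\<delta> = "c * T powr (- (sigma * real r))"
    show "?\<delta> \<ge> 0" using c by simp
    have \<delta>: "?\<delta>\<^sup>2 = 1 / (C * T powr s)"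
    proof -
      have "T powr s = (T powr (sigma * real r))\<^sup>2"
        by (simp only: power2_eq_square powr_add[symmetric] mult_2 s_def)
      then show ?thesis using C by (simp add: c_def power_mult_distrib power_divide powr_minus_divide)
    qed
    fix x :: "('d \<Rightarrow> nat) \<Rightarrow> real" assume x: "(\<Sum>k\<in>hyp_cross T. (x k)\<^sup>2) = ?\<delta>\<^sup>2"
    define F where "F = (\<Sum>k\<in>hyp_cross T. x k *\<^sub>R P_class k)"
    have "hyp_cross T \<noteq> ({} :: ('d \<Rightarrow> nat) set)" using n by auto
    then have FW: "F \<in> W2 r" unfolding F_def by (intro W2_sum hyp_cross_fin)
    have co: "inner_mfun F (P_class k) = (if k \<in> hyp_cross T then x k else 0)" for k
    proof -
      have "inner_mfun F (P_class k) = (\<Sum>l\<in>hyp_cross T. x l * inner_mfun (P_class l) (P_class k))"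
        unfolding F_def using P_class_L2 by (intro ipr_sum) auto
      also have "\<dots> = (\<Sum>l\<in>hyp_cross T. if l = k then x k else 0)"
        by (intro sum.cong) (auto simp: inner_mfun_P_class_P_class)
      finally show ?thesis by (simp add: hyp_cross_fin)
    qed
    have "wsum growth (\<lambda>_. r) (\<lambda>k. inner_mfun F (P_class k)) =
        (\<Sum>k\<in>hyp_cross T. ennreal ((\<Prod>i\<in>UNIV. real (k i) + 1) powr s * (inner_mfun F (P_class k))\<^sup>2))"
      unfolding wsum_growth s_def by (intro nn_integral_count_space') (auto simp: co hyp_cross_fin)
    also have "\<dots> \<le> (\<Sum>k\<in>hyp_cross T. ennreal (T powr s * (x k)\<^sup>2))"
    proof (intro sum_mono ennreal_leI)
      fix k :: "'d \<Rightarrow> nat" assume k: "k \<in> hyp_cross T"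
      have "(\<Prod>i\<in>UNIV. real (k i) + 1) powr s \<le> T powr s"
        using k s by (intro powr_mono2 prod_nonneg) (auto simp: hyp_cross_def)
      then show "(\<Prod>i\<in>UNIV. real (k i) + 1) powr s * (inner_mfun F (P_class k))\<^sup>2 \<le> T powr s * (x k)\<^sup>2"
        using k by (simp add: co mult_right_mono)
    qed
    also have "\<dots> = ennreal (\<Sum>k\<in>hyp_cross T. T powr s * (x k)\<^sup>2)" by (intro sum_ennreal) auto
    also have "(\<Sum>k\<in>hyp_cross T. T powr s * (x k)\<^sup>2) = 1 / C"
      unfolding sum_distrib_left[symmetric] x \<delta> using T by simp
    finally have "ennreal C * wsum growth (\<lambda>_. r) (\<lambda>k. inner_mfun F (P_class k)) \<le> ennreal C * ennreal (1 / C)"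
      by (intro mult_left_mono) auto
    also have "\<dots> = ennreal 1" using C(1) by (simp add: ennreal_mult[symmetric])
    finally have "ennreal ((norm_W2w r (real e) a b F)\<^sup>2) \<le> ennreal 1" using C(2)[OF FW] by (rule order.trans[rotated])
    then have "(norm_W2w r (real e) a b F)\<^sup>2 \<le> 1" by simp
    then have "norm_W2w r (real e) a b F \<le> 1" by (simp add: power_le_one_iff abs_square_le_1)
    then show "(\<Sum>k\<in>hyp_cross T. x k *\<^sub>R P_class k) \<in> BW" using FW by (simp add: F_def BW_def unit_ball_W2w_def)
  qed (use n P_class_L2 in \<open>auto simp: hyp_cross_fin inner_mfun_P_class_P_class\<close>)
  then show ?thesis using c by blast
qed

lemma unit_ball_subset_L2: "unit_ball_W2w r (real e) a b \<subseteq> L2"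
  by (auto simp: unit_ball_W2w_def W2w_def)

text \<open>The threshold \<open>c * n / (ln n) ^ D\<close> inverts a count of order
  \<open>T * (ln T) ^ D\<close> up to constants; its power \<open>- s\<close> is the claimed
  rate.\<close>

lemma hyp_cross_rate:
  assumes "c > 0" "n \<ge> 2" "s \<ge> 0"
  shows "(c * real n / ln (real n) ^ D) powr (- s) = c powr (- s) * (real n powr (- s) * ln (real n) powr (s * real D))"
proof -
  have l: "ln (real n) > 0" using assms by simp
  have "(c * real n / ln (real n) ^ D) powr (- s) = (c powr (- s) * real n powr (- s)) / (ln (real n) ^ D) powr (- s)"
    by (simp add: powr_divide powr_mult)
  also have "(ln (real n) ^ D) powr (- s) = ln (real n) powr (- (s * real D))"
    using l by (simp add: powr_realpow[symmetric] powr_powr mult.commute)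
  finally show ?thesis by (simp add: powr_minus_divide)
qed

end

theorem theorem4p4:
  fixes lam a b :: real and r :: nat
    and BW X :: "(real ^ 'd::finite) mfun set"
    and N :: "(real ^ 'd) mfun \<Rightarrow> real"
    and r_lam :: real
  assumes "lam \<in> {2, 4}" and "a > 0" and "r \<ge> 1"
  defines "BW \<equiv> unit_ball_W2w r lam a b"
    and "X \<equiv> L2w lam a b"
    and "N \<equiv> norm_L2w lam a b"
    and "r_lam \<equiv> (1 - 1 / lam) * real r"
  shows "(\<forall>n\<ge>2. linear_width BW X N n = kolmogorov_width BW X N n) \<and>
    (\<exists>c>0. \<exists>C>0. \<forall>n\<ge>2.
       ereal (c * (real n powr (- r_lam) * ln (real n) powr (r_lam * real (CARD('d) - 1))))
         \<le> kolmogorov_width BW X N n \<and>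
       kolmogorov_width BW X N n
         \<le> ereal (C * (real n powr (- r_lam) * ln (real n) powr (r_lam * real (CARD('d) - 1)))))"
proof -
  \<comment> \<open>A natural exponent makes the logarithm of the weight a polynomial.\<close>
  obtain e :: nat where e: "e \<in> {2, 4}" and lam: "lam = real e"
  proof (cases "lam = 2")
    case True
    then show ?thesis using that[of 2] by simp
  next
    case False
    then show ?thesis using that[of 4] assms(1) by simp
  qed
  interpret freud_weight e a b using e assms(2) by unfold_locales
  interpret S: inner_subspace X inner_mfun N
    unfolding X_def N_def lam by (rule inner_L2)
  have s: "r_lam = sigma * real r" "r_lam \<ge> 0"
    by (simp_all add: r_lam_def sigma_def lam) (use e in auto)
  let ?D = "CARD('d) - 1"
  obtain C1 where C1: "C1 > 0" "\<And>T n. T > 0 \<Longrightarrow> card (hyp_cross T :: ('d \<Rightarrow> nat) set) \<le> n \<Longrightarrow>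
      kolmogorov_width BW X N n \<le> ereal (C1 * T powr (- r_lam))"
    using width_upper[where 'd = 'd, of r] unfolding BW_def X_def N_def lam s(1) by blast
  obtain c1 where c1: "c1 > 0" "\<And>T n. T > 0 \<Longrightarrow> n < card (hyp_cross T :: ('d \<Rightarrow> nat) set) \<Longrightarrow>
      ereal (c1 * T powr (- r_lam)) \<le> kolmogorov_width BW X N n"
    using width_lower[where 'd = 'd, of r] unfolding BW_def X_def N_def lam s(1) by blast
  \<comment> \<open>Two thresholds of the same order: a cross with at most \<open>n\<close> points
    gives the upper bound, one with more than \<open>n\<close> points the lower bound.\<close>
  obtain t1 where t1: "t1 > 0" "\<And>n. n \<ge> 2 \<Longrightarrow> card (hyp_cross (t1 * real n / ln (real n) ^ ?D) :: ('d \<Rightarrow> nat) set) \<le> n"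
    using hyp_cross_few[where 'd = 'd] by blast
  obtain t2 where t2: "t2 > 0" "\<And>n. n \<ge> 2 \<Longrightarrow> n < card (hyp_cross (t2 * real n / ln (real n) ^ ?D) :: ('d \<Rightarrow> nat) set)"
    using hyp_cross_many[where 'd = 'd] by blast
  have pos: "t * real n / ln (real n) ^ ?D > 0" if "t > 0" "n \<ge> 2" for t n
    using that by simp
  have "ereal (c1 * t2 powr (- r_lam) * (real n powr (- r_lam) * ln (real n) powr (r_lam * real ?D))) \<le> kolmogorov_width BW X N n"
    if n: "n \<ge> 2" for n
    using c1(2)[OF pos[OF t2(1) n] t2(2)[OF n]] unfolding hyp_cross_rate[OF t2(1) n s(2)] by (simp add: mult.assoc)
  moreover have "kolmogorov_width BW X N n \<le> ereal (C1 * t1 powr (- r_lam) * (real n powr (- r_lam) * ln (real n) powr (r_lam * real ?D)))"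
    if n: "n \<ge> 2" for n
    using C1(2)[OF pos[OF t1(1) n] t1(2)[OF n]] unfolding hyp_cross_rate[OF t1(1) n s(2)] by (simp add: mult.assoc)
  moreover have "c1 * t2 powr (- r_lam) > 0" "C1 * t1 powr (- r_lam) > 0" using c1 C1 t1 t2 by auto
  ultimately have "\<exists>c>0. \<exists>C>0. \<forall>n\<ge>2.
       ereal (c * (real n powr (- r_lam) * ln (real n) powr (r_lam * real ?D))) \<le> kolmogorov_width BW X N n \<and>
       kolmogorov_width BW X N n \<le> ereal (C * (real n powr (- r_lam) * ln (real n) powr (r_lam * real ?D)))"
    by blast
  moreover have "BW \<subseteq> X" unfolding BW_def X_def lam by (rule unit_ball_subset_L2)
  then have "linear_width BW X N n = kolmogorov_width BW X N n" for n
    by (rule S.linear_width_eq_kolmogorov_width)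
  ultimately show ?thesis by blast
qed

end
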